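(* Let $f\in L^2(\mathbb{P}_\eta)$ and $k\in\mathbb{N}$ be such that $$\mathbb{E}\|D^nf(\eta)\|_n^2<\infty,\qquad n=1,\ldots,2k .$$ Then $$\sum_{n=1}^{2k}\frac{(-1)^{n+1}}{n!}\mathbb{E}\|D^nf(\eta)\|_n^2\;\le\;\operatorname{Var}[f(\eta)]\;\le\;\sum_{n=1}^{2k-1}\frac{(-1)^{n+1}}{n!}\mathbb{E}\|D^nf(\eta)\|_n^2 .$$ The first inequality is an equality if and only if $D^{2k+1}_{y_1,\ldots,y_{2k+1}}f(\eta)=0$ almost surely, for $\lambda^{2k+1}$-almost all $(y_1,\ldots,y_{2k+1})\in\mathbb{Y}^{2k+1}$. The second inequality is an equality if and only if $D^{2k}_{y_1,\ldots,y_{2k}}f(\eta)=0$ almost surely, for $\lambda^{2k}$-almost all $(y_1,\ldots,y_{2k})\in\mathbb{Y}^{2k}$.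
   Context: Let $(\mathbb{Y},\mathcal{Y})$ be an arbitrary measurable space and $\lambda$ an arbitrary $\sigma$-finite measure on it. Let $\mathbf{N}$ be the space of all $\sigma$-finite measures $\mu$ on $\mathbb{Y}$ with values in $\{0,1,2,\ldots\}\cup\{\infty\}$, equipped with the smallest $\sigma$-field making $\mu\mapsto\mu(B)$ measurable for every $B\in\mathcal{Y}$. On a probability space $(\Omega,\mathcal{F},\mathbb{P})$, $\eta$ is a Poisson process on $\mathbb{Y}$ with intensity measure $\lambda$: a random element of $\mathbf{N}$ such that $\eta(B)$ is Poisson distributed with parameter $\lambda(B)$ for each $B\in\mathcal{Y}$, and $\eta(B_1),\ldots,\eta(B_k)$ are independent for pairwise disjoint $B_1,\ldots,B_k\in\mathcal{Y}$. $\mathbb{P}_\eta$ is the distribution of $\eta$, and $L^2(\mathbb{P}_\eta)$ is the space of measurable $f:\mathbf{N}\to\mathbb{R}$ with $\mathbb{E}f(\eta)^2<\infty$. For measurable $f:\mathbf{N}\to\mathbb{R}$ and $y\in\mathbb{Y}$, $D_yf(\mu):=f(\mu+\delta_y)-f(\mu)$, where $\delta_y$ is the Dirac measure at $y$; $D^1:=D$, and for $n\ge2$, $D^n_{y_1,\ldots,y_n}f:=D^1_{y_1}D^{n-1}_{y_2,\ldots,y_n}f$. $D^nf(\eta)$ denotes the (random) mapping $(y_1,\ldots,y_n)\mapsto D^n_{y_1,\ldots,y_n}f(\eta)$, and $\|\cdot\|_n$ is the norm of $L^2(\lambda^n)$, where $\lambda^n$ is the $n$-fold product measure. *)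

theory Defs
  imports "HOL-Probability.Probability"
begin

text \<open>
  The space \<open>\<^bold>N\<close> over the measurable space underlying \<open>Y\<close>; the measure
  carried by \<open>Y\<close> itself is irrelevant.
\<close>

definition counting_measures :: "'y measure \<Rightarrow> 'y measure set" where
  "counting_measures Y =
    {\<mu>. sets \<mu> = sets Y \<and> sigma_finite_measure \<mu> \<and>
        (\<forall>B\<in>sets Y. emeasure \<mu> B \<in> range of_nat \<union> {\<infinity>})}"

definition counting_measure_space :: "'y measure \<Rightarrow> 'y measure measure" where
  "counting_measure_space Y = sigma (counting_measures Y)
    {(\<lambda>\<mu>. emeasure \<mu> B) -` A \<inter> counting_measures Y | A B. A \<in> sets borel \<and> B \<in> sets Y}"

text \<open>
  The Poisson law on the extended half-line, with the usual conventions for the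
  parameters \<open>0\<close> and \<open>\<infinity>\<close> (point masses at \<open>0\<close> and \<open>\<infinity>\<close>); the library's
  \<open>poisson_pmf\<close> is only meaningful for a positive finite parameter.
\<close>

definition poisson_law :: "ennreal \<Rightarrow> ennreal measure" where
  "poisson_law r =
    (if r = 0 then return borel 0
     else if r = \<infinity> then return borel \<infinity>
     else distr (measure_pmf (poisson_pmf (enn2real r))) borel of_nat)"

definition poisson_process :: "'w measure \<Rightarrow> 'y measure \<Rightarrow> ('w \<Rightarrow> 'y measure) \<Rightarrow> bool" where
  "poisson_process M lam \<eta> \<longleftrightarrow>
    \<eta> \<in> measurable M (counting_measure_space lam) \<and>
    (\<forall>B\<in>sets lam. distr M borel (\<lambda>\<omega>. emeasure (\<eta> \<omega>) B) = poisson_law (emeasure lam B)) \<and>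
    (\<forall>(k::nat) (B :: nat \<Rightarrow> 'y set).
        (\<forall>i<k. B i \<in> sets lam) \<longrightarrow> disjoint_family_on B {..<k} \<longrightarrow>
        prob_space.indep_vars M (\<lambda>_. borel) (\<lambda>i \<omega>. emeasure (\<eta> \<omega>) (B i)) {..<k})"

definition add_measure :: "'y measure \<Rightarrow> 'y measure \<Rightarrow> 'y measure" where
  "add_measure \<mu> \<nu> = measure_of (space \<mu>) (sets \<mu>) (\<lambda>B. emeasure \<mu> B + emeasure \<nu> B)"

lemma space_add_measure [simp]: "space (add_measure \<mu> \<nu>) = space \<mu>"
  and sets_add_measure [simp]: "sets (add_measure \<mu> \<nu>) = sets \<mu>"
  by (simp_all add: add_measure_def)

lemma emeasure_add_measure:
  assumes "sets \<nu> = sets \<mu>"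
  shows "emeasure (add_measure \<mu> \<nu>) B = emeasure \<mu> B + emeasure \<nu> B"
proof (cases "B \<in> sets \<mu>")
  case True
  have "countably_additive (sets \<mu>) (\<lambda>B. emeasure \<mu> B + emeasure \<nu> B)"
    unfolding countably_additive_def
    by (auto simp: suminf_add[symmetric] suminf_emeasure assms)
  then show ?thesis
    using True unfolding add_measure_def
    by (intro emeasure_measure_of_sigma) (auto simp: positive_def sets.sigma_algebra_axioms)
qed (simp add: emeasure_notin_sets assms)

definition diff_op :: "'y \<Rightarrow> ('y measure \<Rightarrow> real) \<Rightarrow> 'y measure \<Rightarrow> real" where
  "diff_op y f \<mu> = f (add_measure \<mu> (return \<mu> y)) - f \<mu>"

text \<open>
  The points \<open>y\<^sub>1, \<dots>, y\<^sub>n\<close> are \<open>y 0, \<dots>, y (n - 1)\<close>, so that the product measure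
  \<open>\<lambda>\<^sup>n\<close> is \<open>Pi\<^sub>M {..<n} (\<lambda>_. \<lambda>)\<close>.
\<close>

primrec iter_diff :: "nat \<Rightarrow> (nat \<Rightarrow> 'y) \<Rightarrow> ('y measure \<Rightarrow> real) \<Rightarrow> 'y measure \<Rightarrow> real" where
  "iter_diff 0 y f = f"
| "iter_diff (Suc n) y f = diff_op (y 0) (iter_diff n (\<lambda>i. y (Suc i)) f)"

abbreviation product_measure :: "nat \<Rightarrow> 'y measure \<Rightarrow> (nat \<Rightarrow> 'y) measure" where
  "product_measure n lam \<equiv> Pi\<^sub>M {..<n} (\<lambda>_. lam)"

definition L2_norm_sq :: "'b measure \<Rightarrow> ('b \<Rightarrow> real) \<Rightarrow> ennreal" where
  "L2_norm_sq M g = (\<integral>\<^sup>+ x. ennreal ((g x)\<^sup>2) \<partial>M)"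

definition expected_diff_norm_sq ::
  "'w measure \<Rightarrow> 'y measure \<Rightarrow> ('w \<Rightarrow> 'y measure) \<Rightarrow> ('y measure \<Rightarrow> real) \<Rightarrow> nat \<Rightarrow> ennreal" where
  "expected_diff_norm_sq M lam \<eta> f n =
    (\<integral>\<^sup>+ \<omega>. L2_norm_sq (product_measure n lam) (\<lambda>y. iter_diff n y f (\<eta> \<omega>)) \<partial>M)"

end

theory Submission
  imports Defs "HOL-Real_Asymp.Real_Asymp"
begin

text \<open>
  For \<open>f\<close> in \<open>L\<^sup>2\<close> put \<open>T\<^sub>n f (y\<^sub>1, \<dots>, y\<^sub>n) = E D\<^sup>n f (\<eta>)\<close> and \<open>a\<^sub>n(f) = \<parallel>T\<^sub>n f\<parallel>\<^sup>2\<close>. The Fock space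
  representation (Last and Penrose) says \<open>E f(\<eta>)\<^sup>2 = \<Sum>\<^sub>m a\<^sub>m(f) / m!\<close>. On exponentials
  \<open>exp (- \<integral> w d\<mu>)\<close> both sides are explicit; these span a dense subspace of \<open>L\<^sup>2\<close>, and the Mecke
  equation bounds \<open>D\<^sup>n f\<close> in \<open>L\<^sup>1\<close> over boxes of finite measure by \<open>\<parallel>f\<parallel>\<close>, which makes \<open>T\<^sub>n\<close> continuous
  enough for the isometry to extend.

  Applying the representation to \<open>D\<^sup>n f\<close> gives \<open>E \<parallel>D\<^sup>n f\<parallel>\<^sup>2 = \<Sum>\<^sub>m a\<^bsub>m+n\<^esub>(f) / m!\<close> whenever the left-hand
  side is finite, and the alternating binomial sum \<open>\<Sum>\<^bsub>n\<le>K\<^esub> (-1)\<^sup>n (m choose n) = (-1)\<^sup>K (m-1 choose K)\<close>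
  turns the variance minus the \<open>K\<close>-th partial sum into \<open>(-1)\<^sup>K \<Sum>\<^bsub>m>K\<^esub> (m-1 choose K) a\<^sub>m(f) / m!\<close>.
\<close>

section \<open>The space of counting measures\<close>

text \<open>On an arbitrary measurable space a counting measure need not be a sum of Dirac masses,
  so the process is not handled through its points. The Poisson property enters through the Laplace
  functional alone: differentiating it yields the Mecke equation, whose two sides are measures
  identified by their Laplace functionals. Density is therefore proved for every finite measure on
  the space of counting measures, to serve both the law of the process and a sum
  \<open>m + m'\<close> in the uniqueness argument.

  A second obstacle: \<open>f\<close> is controlled only almost surely, while \<open>D_z f\<close>
  evaluates it at \<open>\<mu> + \<delta>_z\<close>. By the Mecke equation this shifted
  configuration, with \<open>z\<close> integrated over \<open>B\<close>, has the density
  \<open>\<mu>(B)\<close>. All continuity of \<open>D^n\<close> rests on this, and it is continuity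
  into \<open>L^1\<close> over boxes, since \<open>D^n f\<close> need not be square integrable.

  Its vanishing is deduced from \<open>a_m(f) = 0\<close> for \<open>m > K\<close> by induction,
  down to the fact that a variable with zero variance is almost surely constant.\<close>

lemma space_counting_measure_space: "space (counting_measure_space Y) = counting_measures Y"
  unfolding counting_measure_space_def by (subst space_measure_of) auto

lemma sets_counting_measure_space:
  "sets (counting_measure_space Y) = sigma_sets (counting_measures Y)
    {(\<lambda>\<mu>. emeasure \<mu> B) -` A \<inter> counting_measures Y | A B. A \<in> sets borel \<and> B \<in> sets Y}"
  unfolding counting_measure_space_def by (subst sets_measure_of) auto

lemma counting_measureD:
  assumes "\<mu> \<in> space (counting_measure_space Y)"
  shows "sets \<mu> = sets Y" "space \<mu> = space Y" "sigma_finite_measure \<mu>"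
    "B \<in> sets Y \<Longrightarrow> emeasure \<mu> B \<in> range of_nat \<union> {\<infinity>}"
  using assms sets_eq_imp_space_eq[of \<mu> Y]
  by (auto simp: space_counting_measure_space counting_measures_def)

lemma measurable_emeasure_counting [measurable]:
  assumes "B \<in> sets Y"
  shows "(\<lambda>\<mu>. emeasure \<mu> B) \<in> borel_measurable (counting_measure_space Y)"
proof (rule measurableI)
  fix A :: "ennreal set" assume "A \<in> sets borel"
  then show "(\<lambda>\<mu>. emeasure \<mu> B) -` A \<inter> space (counting_measure_space Y) \<in> sets (counting_measure_space Y)"
    using assms unfolding sets_counting_measure_space space_counting_measure_space by blast
qed auto

lemma measurable_counting_measure_spaceI:
  assumes "\<And>x. x \<in> space X \<Longrightarrow> g x \<in> space (counting_measure_space Y)"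
    and "\<And>B. B \<in> sets Y \<Longrightarrow> (\<lambda>x. emeasure (g x) B) \<in> borel_measurable X"
  shows "g \<in> measurable X (counting_measure_space Y)"
  unfolding counting_measure_space_def
proof (rule measurable_measure_of)
  fix C assume "C \<in> {(\<lambda>\<mu>. emeasure \<mu> B) -` A \<inter> counting_measures Y | A B. A \<in> sets borel \<and> B \<in> sets Y}"
  then obtain A B where C: "C = (\<lambda>\<mu>. emeasure \<mu> B) -` A \<inter> counting_measures Y"
    and A: "A \<in> sets borel" and B: "B \<in> sets Y" by auto
  have "g -` C \<inter> space X = (\<lambda>x. emeasure (g x) B) -` A \<inter> space X"
    using assms(1) by (auto simp: C space_counting_measure_space)
  then show "g -` C \<inter> space X \<in> sets X"
    using measurable_sets[OF assms(2)[OF B] A] by simp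
qed (use assms(1) in \<open>auto simp: space_counting_measure_space\<close>)

lemma nn_integral_add_measure:
  assumes s: "sets \<nu> = sets \<mu>" and "f \<in> borel_measurable \<mu>"
  shows "nn_integral (add_measure \<mu> \<nu>) f = nn_integral \<mu> f + nn_integral \<nu> f"
  using assms(2)
proof (induction rule: borel_measurable_induct)
  case (cong f g)
  then show ?case
    using sets_eq_imp_space_eq[OF s]
      nn_integral_cong[of \<mu> f g] nn_integral_cong[of \<nu> f g] nn_integral_cong[of "add_measure \<mu> \<nu>" f g]
    by auto
next
  case (set A)
  then show ?case using s by (simp add: emeasure_add_measure)
next
  case (mult u c)
  have "u \<in> borel_measurable \<nu>" "u \<in> borel_measurable (add_measure \<mu> \<nu>)"
    using mult(2) by (simp_all add: measurable_cong_sets[OF s refl] measurable_cong_sets[OF sets_add_measure refl])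
  with mult show ?case
    by (simp add: nn_integral_cmult distrib_left)
next
  case (add u v)
  have "u \<in> borel_measurable \<nu>" "u \<in> borel_measurable (add_measure \<mu> \<nu>)"
    "v \<in> borel_measurable \<nu>" "v \<in> borel_measurable (add_measure \<mu> \<nu>)"
    using add(1,3) by (simp_all add: measurable_cong_sets[OF s refl] measurable_cong_sets[OF sets_add_measure refl])
  with add show ?case
    by (simp add: nn_integral_add algebra_simps)
next
  case (seq U)
  have m: "U i \<in> borel_measurable \<nu>" "U i \<in> borel_measurable (add_measure \<mu> \<nu>)" for i
    using seq(1)[of i] by (simp_all add: measurable_cong_sets[OF s refl] measurable_cong_sets[OF sets_add_measure refl])
  show ?case
    using seq m
    by (simp add: nn_integral_monotone_convergence_SUP[of U] ennreal_SUP_add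
        incseq_nn_integral image_comp SUP_apply[abs_def]) 
qed

lemma add_return_in_counting:
  assumes mu: "\<mu> \<in> space (counting_measure_space Y)" and y: "y \<in> space Y"
  shows "add_measure \<mu> (return \<mu> y) \<in> space (counting_measure_space Y)"
proof -
  note D = counting_measureD[OF mu]
  have e: "emeasure (add_measure \<mu> (return \<mu> y)) B = emeasure \<mu> B + indicator B y" if "B \<in> sets Y" for B
    using that D by (subst emeasure_add_measure) auto
  interpret m: sigma_finite_measure \<mu> by (rule D)
  obtain A :: "nat \<Rightarrow> _" where A: "range A \<subseteq> sets \<mu>" "\<Union> (range A) = space \<mu>" "\<And>i. emeasure \<mu> (A i) \<noteq> \<infinity>"
    using m.sigma_finite by blast
  have "sigma_finite_measure (add_measure \<mu> (return \<mu> y))"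
  proof
    show "\<exists>A. countable A \<and> A \<subseteq> sets (add_measure \<mu> (return \<mu> y)) \<and> \<Union> A = space (add_measure \<mu> (return \<mu> y)) \<and>
         (\<forall>a\<in>A. emeasure (add_measure \<mu> (return \<mu> y)) a \<noteq> \<infinity>)"
    proof (intro exI[of _ "range A"] conjI ballI)
      fix a assume "a \<in> range A"
      then obtain i where i: "a = A i" by auto
      show "emeasure (add_measure \<mu> (return \<mu> y)) a \<noteq> \<infinity>"
        using A(1) A(3)[of i] e[of a] D(1) i by (auto simp: indicator_def)
    qed (use A in auto)
  qed
  moreover have "emeasure (add_measure \<mu> (return \<mu> y)) B \<in> range of_nat \<union> {\<infinity>}" if "B \<in> sets Y" for B
  proof -
    have "(of_nat n :: ennreal) + 1 \<in> range of_nat" for n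
      by (rule range_eqI[of _ _ "Suc n"]) (simp add: add.commute)
    then show ?thesis
      using D(4)[OF that] e[OF that] by (auto simp: indicator_def)
  qed
  ultimately show ?thesis
    using D by (auto simp: space_counting_measure_space counting_measures_def)
qed

lemma measurable_add_return [measurable]:
  "(\<lambda>(\<mu>, y). add_measure \<mu> (return \<mu> y)) \<in>
    measurable (counting_measure_space Y \<Otimes>\<^sub>M Y) (counting_measure_space Y)"
proof (rule measurable_counting_measure_spaceI)
  fix B assume [measurable]: "B \<in> sets Y"
  have "(\<lambda>(\<mu>, y). emeasure \<mu> B + indicator B y) \<in> borel_measurable (counting_measure_space Y \<Otimes>\<^sub>M Y)"
    by measurable
  also have "?this \<longleftrightarrow> (\<lambda>x. emeasure (case x of (\<mu>, y) \<Rightarrow> add_measure \<mu> (return \<mu> y)) B)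
      \<in> borel_measurable (counting_measure_space Y \<Otimes>\<^sub>M Y)"
    by (intro measurable_cong)
      (auto simp: space_pair_measure emeasure_add_measure dest: counting_measureD)
  finally show \<dots> .
qed (auto simp: space_pair_measure intro: add_return_in_counting)

section \<open>Laplace functionals\<close>

text \<open>This is \<open>exp (- x)\<close> continued by \<open>exp (- \<infinity>) = 0\<close>.
  The functional equation \<open>nexp_add\<close> then holds on the whole half-line, so Laplace
  functionals multiply even at configurations with infinitely many points.\<close>

definition nexp :: "ennreal \<Rightarrow> real" where
  "nexp x = (if x = \<infinity> then 0 else exp (- enn2real x))"

lemma nexp_measurable [measurable]: "nexp \<in> borel_measurable borel"
  unfolding nexp_def[abs_def] by measurable

lemma nexp_nonneg: "0 \<le> nexp x" and nexp_le_1: "nexp x \<le> 1"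
  by (auto simp: nexp_def)

lemma nexp_0 [simp]: "nexp 0 = 1" and nexp_top [simp]: "nexp \<infinity> = 0"
  by (auto simp: nexp_def)

lemma nexp_ennreal [simp]: "0 \<le> x \<Longrightarrow> nexp (ennreal x) = exp (- x)"
  by (auto simp: nexp_def)

lemma nexp_add: "nexp (x + y) = nexp x * nexp y"
  by (cases x; cases y)
    (auto simp: ennreal_plus[symmetric] mult_exp_exp nexp_def algebra_simps simp del: ennreal_plus)

lemma nexp_sum: "finite I \<Longrightarrow> nexp (sum g I) = (\<Prod>i\<in>I. nexp (g i))"
  by (induction I rule: finite_induct) (auto simp: nexp_add)

text \<open>For such \<open>w\<close> the integral against any counting measure is a finite
  combination of counts of disjoint sets of finite intensity, to which the defining properties of
  the process apply directly. Closure under sums makes the exponentials closed under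
  products.\<close>

definition step_fun :: "'y measure \<Rightarrow> ('y \<Rightarrow> real) \<Rightarrow> bool" where
  "step_fun Y w \<longleftrightarrow> simple_function Y w \<and> (\<forall>y. 0 \<le> w y) \<and> emeasure Y {y\<in>space Y. w y \<noteq> 0} < \<infinity>"

lemma step_fun_measurable: "step_fun Y w \<Longrightarrow> w \<in> borel_measurable Y"
  by (auto simp: step_fun_def intro: borel_measurable_simple_function)

lemma step_fun_zero: "step_fun Y (\<lambda>_. 0)"
  by (auto simp: step_fun_def)

lemma step_fun_add:
  assumes v: "step_fun Y v" and w: "step_fun Y w" shows "step_fun Y (\<lambda>y. v y + w y)"
proof -
  note [measurable] = v[THEN step_fun_measurable] w[THEN step_fun_measurable]
  have "emeasure Y {y\<in>space Y. v y + w y \<noteq> 0}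
      \<le> emeasure Y ({y\<in>space Y. v y \<noteq> 0} \<union> {y\<in>space Y. w y \<noteq> 0})"
    by (intro emeasure_mono) auto
  also have "\<dots> \<le> emeasure Y {y\<in>space Y. v y \<noteq> 0} + emeasure Y {y\<in>space Y. w y \<noteq> 0}"
    by (intro emeasure_subadditive) auto
  also have "\<dots> < \<infinity>" using v w by (auto simp: step_fun_def)
  finally show ?thesis using v w by (auto simp: step_fun_def)
qed

lemma step_fun_indicator:
  assumes "B \<in> sets Y" "emeasure Y B < \<infinity>" "0 \<le> c"
  shows "step_fun Y (\<lambda>y. c * indicator B y)"
proof -
  have "emeasure Y {y\<in>space Y. c * indicator B y \<noteq> (0::real)} \<le> emeasure Y B"
    using assms by (intro emeasure_mono) (auto simp: indicator_def)
  then show ?thesis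
    using assms by (auto simp: step_fun_def intro!: simple_function_mult simple_function_indicator)
qed

lemma step_fun_nn_integral:
  assumes w: "step_fun Y w" and \<mu>: "sets \<mu> = sets Y"
  shows "(\<integral>\<^sup>+y. ennreal (w y) \<partial>\<mu>) =
    (\<Sum>c\<in>w ` space Y - {0}. ennreal c * emeasure \<mu> {y\<in>space Y. w y = c})"
proof -
  note [measurable] = step_fun_measurable[OF w]
  have fin: "finite (w ` space Y)" using w by (auto simp: step_fun_def simple_function_def)
  have sp: "space \<mu> = space Y" by (rule sets_eq_imp_space_eq) fact
  have [measurable]: "{y\<in>space Y. w y = c} \<in> sets \<mu>" for c
    unfolding \<mu> by measurable
  have "(\<integral>\<^sup>+y. ennreal (w y) \<partial>\<mu>) =
      (\<integral>\<^sup>+y. (\<Sum>c\<in>w ` space Y - {0}. ennreal c * indicator {y\<in>space Y. w y = c} y) \<partial>\<mu>)"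
  proof (rule nn_integral_cong)
    fix y assume y: "y \<in> space \<mu>"
    have "(\<Sum>c\<in>w ` space Y - {0}. ennreal c * indicator {y\<in>space Y. w y = c} y) =
        (\<Sum>c\<in>w ` space Y - {0}. if c = w y then ennreal (w y) else 0)"
      using y sp by (intro sum.cong) (auto simp: indicator_def)
    also have "\<dots> = ennreal (w y)"
      using fin y sp by (subst sum.delta) auto
    finally show "ennreal (w y) = (\<Sum>c\<in>w ` space Y - {0}. ennreal c * indicator {y\<in>space Y. w y = c} y)" ..
  qed
  also have "\<dots> = (\<Sum>c\<in>w ` space Y - {0}. ennreal c * emeasure \<mu> {y\<in>space Y. w y = c})"
    by (subst nn_integral_sum) (auto simp: nn_integral_cmult_indicator)
  finally show ?thesis .
qed

lemma step_fun_integral: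
  assumes w: "step_fun Y w"
  shows "integrable Y (\<lambda>y. 1 - exp (- w y))"
    and "(\<integral>y. 1 - exp (- w y) \<partial>Y) =
    (\<Sum>c\<in>w ` space Y - {0}. (1 - exp (- c)) * measure Y {y\<in>space Y. w y = c})"
proof -
  note [measurable] = step_fun_measurable[OF w]
  have fin: "finite (w ` space Y)" using w by (auto simp: step_fun_def simple_function_def)
  have f: "emeasure Y {y\<in>space Y. w y = c} < \<infinity>" if "c \<noteq> 0" for c
  proof -
    have "emeasure Y {y\<in>space Y. w y = c} \<le> emeasure Y {y\<in>space Y. w y \<noteq> 0}"
      using that by (intro emeasure_mono) auto
    then show ?thesis using w by (auto simp: step_fun_def)
  qed
  have eq: "1 - exp (- w y) = (\<Sum>c\<in>w ` space Y - {0}. (1 - exp (- c)) * indicator {y\<in>space Y. w y = c} y)"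
    if y: "y \<in> space Y" for y
  proof -
    have "(\<Sum>c\<in>w ` space Y - {0}. (1 - exp (- c)) * indicator {y\<in>space Y. w y = c} y) =
        (\<Sum>c\<in>w ` space Y - {0}. if c = w y then 1 - exp (- w y) else 0)"
      using y by (intro sum.cong) (auto simp: indicator_def)
    also have "\<dots> = 1 - exp (- w y)"
      using fin y by (subst sum.delta) auto
    finally show ?thesis ..
  qed
  have int: "integrable Y (\<lambda>y. \<Sum>c\<in>w ` space Y - {0}. (1 - exp (- c)) * indicator {y\<in>space Y. w y = c} y)"
    using f by (intro Bochner_Integration.integrable_sum integrable_mult_right integrable_real_indicator) auto
  show "integrable Y (\<lambda>y. 1 - exp (- w y))"
    using int by (subst Bochner_Integration.integrable_cong[OF refl eq]) auto
  have "(\<integral>y. 1 - exp (- w y) \<partial>Y) =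
    (\<integral>y. (\<Sum>c\<in>w ` space Y - {0}. (1 - exp (- c)) * indicator {y\<in>space Y. w y = c} y) \<partial>Y)"
    by (intro Bochner_Integration.integral_cong eq refl)
  also have "\<dots> = (\<Sum>c\<in>w ` space Y - {0}. (1 - exp (- c)) * measure Y {y\<in>space Y. w y = c})"
    using f by (subst Bochner_Integration.integral_sum) (auto intro!: sum.cong integrable_mult_right integrable_real_indicator)
  finally show "(\<integral>y. 1 - exp (- w y) \<partial>Y) =
    (\<Sum>c\<in>w ` space Y - {0}. (1 - exp (- c)) * measure Y {y\<in>space Y. w y = c})" .
qed

definition lapl :: "('y \<Rightarrow> real) \<Rightarrow> 'y measure \<Rightarrow> real" where
  "lapl w \<mu> = nexp (\<integral>\<^sup>+y. ennreal (w y) \<partial>\<mu>)"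

lemma lapl_nonneg: "0 \<le> lapl w \<mu>" and lapl_le_1: "lapl w \<mu> \<le> 1"
  by (auto simp: lapl_def nexp_nonneg nexp_le_1)

lemma lapl_measurable [measurable]:
  assumes "step_fun Y w"
  shows "lapl w \<in> borel_measurable (counting_measure_space Y)"
proof -
  note [measurable] = step_fun_measurable[OF assms]
  have "(\<lambda>\<mu>. nexp (\<Sum>c\<in>w ` space Y - {0}. ennreal c * emeasure \<mu> {y\<in>space Y. w y = c}))
     \<in> borel_measurable (counting_measure_space Y)"
    by measurable
  also have "?this \<longleftrightarrow> ?thesis"
    by (intro measurable_cong)
      (simp add: lapl_def step_fun_nn_integral[OF assms counting_measureD(1)])
  finally show ?thesis .
qed

lemma lapl_add:
  assumes v: "step_fun Y v" and w: "step_fun Y w" and \<mu>: "\<mu> \<in> space (counting_measure_space Y)"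
  shows "lapl v \<mu> * lapl w \<mu> = lapl (\<lambda>y. v y + w y) \<mu>"
proof -
  have [measurable]: "v \<in> borel_measurable \<mu>" "w \<in> borel_measurable \<mu>"
    using step_fun_measurable[OF v] step_fun_measurable[OF w] measurable_cong_sets[OF counting_measureD(1)[OF \<mu>] refl]
    by auto
  show ?thesis
    using v w unfolding lapl_def nexp_add[symmetric]
    by (subst nn_integral_add[symmetric]) (auto simp: step_fun_def)
qed

lemma lapl_add_return:
  assumes w: "step_fun Y w" and \<mu>: "\<mu> \<in> space (counting_measure_space Y)" and y: "y \<in> space Y"
  shows "lapl w (add_measure \<mu> (return \<mu> y)) = exp (- w y) * lapl w \<mu>"
proof -
  have [measurable]: "w \<in> borel_measurable \<mu>"
    using step_fun_measurable[OF w] measurable_cong_sets[OF counting_measureD(1)[OF \<mu>] refl]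
    by auto
  show ?thesis
    using w y counting_measureD(2)[OF \<mu>] unfolding lapl_def
    by (subst nn_integral_add_measure)
      (auto simp: nn_integral_return nexp_add step_fun_def)
qed

text \<open>The generating function of the Poisson law at \<open>s = exp (- c)\<close>: the series
  of \<open>(s * q)^n / n!\<close> sums to \<open>exp (s * q)\<close>, and the weight
  \<open>exp (- q)\<close> turns it into \<open>exp (- (1 - s) * q)\<close>.\<close>

lemma poisson_law_nexp:
  assumes c: "0 \<le> c" and r: "r < \<infinity>"
  shows "(\<integral>x. nexp (ennreal c * x) \<partial>poisson_law r) = exp (- (1 - exp (- c)) * enn2real r)"
proof (cases "r = 0")
  case True
  then show ?thesis by (simp add: poisson_law_def integral_return)
next
  case False
  define q where "q = enn2real r"
  have q: "q > 0" using False r by (auto simp: q_def enn2real_positive_iff less_top[symmetric] zero_less_iff_neq_zero)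
  have e: "nexp (ennreal c * of_nat n) = exp (- c) ^ n" for n
    using c by (simp add: ennreal_of_nat_eq_real_of_nat ennreal_mult[symmetric] exp_of_nat_mult[symmetric] mult.commute)
  have s: "(\<lambda>n. (exp (- c) * q) ^ n /\<^sub>R fact n * exp (- q)) sums (exp (exp (- c) * q) * exp (- q))"
    by (intro sums_mult2 exp_converges)
  have "(\<integral>x. nexp (ennreal c * x) \<partial>poisson_law r) =
      (\<integral>n. exp (- c) ^ n \<partial>measure_pmf (poisson_pmf q))"
    using False r by (simp add: poisson_law_def q_def integral_distr e less_top[symmetric])
  also have "\<dots> = enn2real (\<integral>\<^sup>+n. ennreal (exp (- c) ^ n) \<partial>measure_pmf (poisson_pmf q))"
    by (intro integral_eq_nn_integral) auto
  also have "(\<integral>\<^sup>+n. ennreal (exp (- c) ^ n) \<partial>measure_pmf (poisson_pmf q)) =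
     (\<Sum>n. ennreal (pmf (poisson_pmf q) n) * ennreal (exp (- c) ^ n))"
    by (simp add: nn_integral_measure_pmf nn_integral_count_space_nat)
  also have "\<dots> = (\<Sum>n. ennreal ((exp (- c) * q) ^ n /\<^sub>R fact n * exp (- q)))"
    using q by (intro arg_cong[where f=suminf] ext)
      (simp add: ennreal_mult[symmetric] field_simps)
  also have "\<dots> = ennreal (exp (exp (- c) * q) * exp (- q))"
    using q s by (subst suminf_ennreal_eq[OF _ s]) auto
  also have "enn2real \<dots> = exp (- (1 - exp (- c)) * enn2real r)"
    by (simp add: mult_exp_exp q_def algebra_simps)
  finally show ?thesis .
qed

text \<open>The integral of \<open>w\<close> is a combination of independent Poisson counts over the
  level sets of \<open>w\<close>, so the expectation factors. Later arguments use the distribution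
  of the process only through this formula.\<close>

lemma poisson_process_lapl:
  assumes M: "prob_space M" and pp: "poisson_process M Y \<eta>" and w: "step_fun Y w"
  shows "(\<integral>\<omega>. lapl w (\<eta> \<omega>) \<partial>M) = exp (- (\<integral>y. 1 - exp (- w y) \<partial>Y))"
proof -
  interpret prob_space M by fact
  note [measurable] = step_fun_measurable[OF w]
  have eta: "\<eta> \<in> measurable M (counting_measure_space Y)"
    and law: "\<And>B. B \<in> sets Y \<Longrightarrow> distr M borel (\<lambda>\<omega>. emeasure (\<eta> \<omega>) B) = poisson_law (emeasure Y B)"
    and ind: "\<And>(n::nat) B. (\<forall>i<n. B i \<in> sets Y) \<Longrightarrow> disjoint_family_on B {..<n} \<Longrightarrow>
       indep_vars (\<lambda>_. borel) (\<lambda>i \<omega>. emeasure (\<eta> \<omega>) (B i)) {..<n}"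
    using pp unfolding poisson_process_def by auto
  let ?C = "w ` space Y - {0}"
  have fin: "finite ?C" using w by (auto simp: step_fun_def simple_function_def)
  have w0: "0 \<le> w y" for y using w by (auto simp: step_fun_def)
  \<comment> \<open>The nonzero values of \<open>w\<close> are numbered because independence is
    stated for families indexed by \<open>{..<k}\<close>. The value \<open>0\<close> is left out:
    its level set may have infinite intensity.\<close>
  obtain c where c: "bij_betw c {..<card ?C} ?C"
    using ex_bij_betw_nat_finite[OF fin] by (auto simp: atLeast0LessThan)
  define n where "n = card ?C"
  define B where "B i = {y\<in>space Y. w y = c i}" for i
  have [measurable]: "B i \<in> sets Y" for i unfolding B_def by measurable
  have c_in: "c i \<in> ?C" if "i < n" for i
    using c that by (auto simp: bij_betw_def n_def)
  have c_pos: "0 < c i" if "i < n" for i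
    using c_in[OF that] w0 by (auto simp: order.strict_iff_order)
  have B_fin: "emeasure Y (B i) < \<infinity>" if "i < n" for i
  proof -
    have "emeasure Y (B i) \<le> emeasure Y {y\<in>space Y. w y \<noteq> 0}"
      using c_pos[OF that] by (intro emeasure_mono) (auto simp: B_def)
    then show ?thesis using w by (auto simp: step_fun_def)
  qed
  have disj: "disjoint_family_on B {..<n}"
    using c by (auto simp: disjoint_family_on_def B_def n_def bij_betw_def inj_on_def)
  have em [measurable]: "(\<lambda>\<omega>. emeasure (\<eta> \<omega>) (B i)) \<in> borel_measurable M" for i
    using measurable_comp[OF eta measurable_emeasure_counting[of "B i" Y]] by (simp add: comp_def)
  have "(\<integral>\<omega>. lapl w (\<eta> \<omega>) \<partial>M) = (\<integral>\<omega>. (\<Prod>i<n. nexp (ennreal (c i) * emeasure (\<eta> \<omega>) (B i))) \<partial>M)"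
  proof (rule Bochner_Integration.integral_cong[OF refl])
    fix \<omega> assume "\<omega> \<in> space M"
    then have "sets (\<eta> \<omega>) = sets Y"
      using measurable_space[OF eta] by (auto dest: counting_measureD)
    then have "lapl w (\<eta> \<omega>) = nexp (\<Sum>i<n. ennreal (c i) * emeasure (\<eta> \<omega>) (B i))"
      unfolding lapl_def B_def n_def
      by (subst step_fun_nn_integral[OF w], assumption)
         (subst sum.reindex_bij_betw[OF c, symmetric], simp)
    then show "lapl w (\<eta> \<omega>) = (\<Prod>i<n. nexp (ennreal (c i) * emeasure (\<eta> \<omega>) (B i)))"
      by (simp add: nexp_sum)
  qed
  also have "\<dots> = (\<Prod>i<n. \<integral>\<omega>. nexp (ennreal (c i) * emeasure (\<eta> \<omega>) (B i)) \<partial>M)"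
  proof (rule indep_vars_lebesgue_integral)
    show "indep_vars (\<lambda>_. borel) (\<lambda>i \<omega>. nexp (ennreal (c i) * emeasure (\<eta> \<omega>) (B i))) {..<n}"
      by (rule indep_vars_compose2[OF ind[of n B]]) (auto simp: disj)
    show "integrable M (\<lambda>\<omega>. nexp (ennreal (c i) * emeasure (\<eta> \<omega>) (B i)))" for i
      by (rule integrable_const_bound[where B=1]) (auto simp: nexp_nonneg nexp_le_1)
  qed auto
  also have "\<dots> = (\<Prod>i<n. exp (- (1 - exp (- c i)) * measure Y (B i)))"
  proof (rule prod.cong[OF refl])
    fix i assume i: "i \<in> {..<n}"
    have "(\<integral>\<omega>. nexp (ennreal (c i) * emeasure (\<eta> \<omega>) (B i)) \<partial>M) =
       (\<integral>x. nexp (ennreal (c i) * x) \<partial>distr M borel (\<lambda>\<omega>. emeasure (\<eta> \<omega>) (B i)))"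
      by (subst integral_distr) auto
    also have "\<dots> = exp (- (1 - exp (- c i)) * measure Y (B i))"
      using i c_pos[of i] B_fin[of i] by (subst law) (auto simp: poisson_law_nexp measure_def)
    finally show "(\<integral>\<omega>. nexp (ennreal (c i) * emeasure (\<eta> \<omega>) (B i)) \<partial>M) = exp (- (1 - exp (- c i)) * measure Y (B i))" .
  qed
  also have "\<dots> = exp (- (\<Sum>i<n. (1 - exp (- c i)) * measure Y (B i)))"
    by (subst exp_sum[symmetric]) (auto simp: sum_negf[symmetric] algebra_simps)
  also have "(\<Sum>i<n. (1 - exp (- c i)) * measure Y (B i)) = (\<integral>y. 1 - exp (- w y) \<partial>Y)"
    unfolding B_def n_def step_fun_integral(2)[OF w] by (subst sum.reindex_bij_betw[OF c, symmetric]) simp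
  finally show ?thesis .
qed

section \<open>The algebra spanned by the exponentials\<close>

inductive_set lapl_span :: "'y measure \<Rightarrow> ('y measure \<Rightarrow> real) set" for Y where
  lapl: "step_fun Y w \<Longrightarrow> lapl w \<in> lapl_span Y"
| scale: "g \<in> lapl_span Y \<Longrightarrow> (\<lambda>\<mu>. c * g \<mu>) \<in> lapl_span Y"
| add: "g \<in> lapl_span Y \<Longrightarrow> h \<in> lapl_span Y \<Longrightarrow> (\<lambda>\<mu>. g \<mu> + h \<mu>) \<in> lapl_span Y"

lemma lapl_span_const: "(\<lambda>_. c) \<in> lapl_span Y"
proof -
  have "(\<lambda>\<mu>. c * lapl (\<lambda>_. 0) \<mu>) \<in> lapl_span Y"
    by (intro lapl_span.intros step_fun_zero)
  then show ?thesis by (simp add: lapl_def)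
qed

lemma lapl_span_measurable: "g \<in> lapl_span Y \<Longrightarrow> g \<in> borel_measurable (counting_measure_space Y)"
  by (induction rule: lapl_span.induct) auto

lemma lapl_span_bounded: "g \<in> lapl_span Y \<Longrightarrow> \<exists>K. \<forall>\<mu>. \<bar>g \<mu>\<bar> \<le> K"
proof (induction rule: lapl_span.induct)
  case (lapl w)
  then show ?case by (intro exI[of _ 1]) (simp add: lapl_nonneg lapl_le_1)
next
  case (scale g c)
  then obtain K where "\<bar>g \<mu>\<bar> \<le> K" for \<mu> by auto
  then have "\<bar>c * g \<mu>\<bar> \<le> \<bar>c\<bar> * K" for \<mu> by (auto simp: abs_mult intro: mult_left_mono)
  then show ?case by blast
next
  case (add g h)
  then obtain K L where "\<bar>g \<mu>\<bar> \<le> K" "\<bar>h \<mu>\<bar> \<le> L" for \<mu> by auto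
  then have "\<bar>g \<mu> + h \<mu>\<bar> \<le> K + L" for \<mu> by (meson abs_triangle_ineq add_mono order_trans)
  then show ?case by blast
qed

text \<open>Bilinearity reduces this to \<open>lapl_add\<close>. That identity needs a configuration
  with the right sigma-field, so the product is only matched by an element \<open>k\<close> of the
  span on the space of counting measures.\<close>

lemma lapl_span_mult:
  assumes "g \<in> lapl_span Y" "h \<in> lapl_span Y"
  obtains k where "k \<in> lapl_span Y" "\<And>\<mu>. \<mu> \<in> space (counting_measure_space Y) \<Longrightarrow> k \<mu> = g \<mu> * h \<mu>"
proof -
  have "\<exists>k\<in>lapl_span Y. \<forall>\<mu>\<in>space (counting_measure_space Y). k \<mu> = g \<mu> * h \<mu>"
    using assms
  proof (induction rule: lapl_span.induct)
    case (lapl v)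
    from lapl(2) show ?case
    proof (induction rule: lapl_span.induct)
      case (lapl w)
      with \<open>step_fun Y v\<close> show ?case
        by (intro bexI[of _ "lapl (\<lambda>y. v y + w y)"]) (auto simp: lapl_add intro: lapl_span.lapl step_fun_add)
    next
      case (scale h c)
      then obtain k where "k \<in> lapl_span Y" "\<And>\<mu>. \<mu> \<in> space (counting_measure_space Y) \<Longrightarrow> k \<mu> = lapl v \<mu> * h \<mu>"
        by auto
      then show ?case
        by (intro bexI[of _ "\<lambda>\<mu>. c * k \<mu>"]) (auto intro: lapl_span.scale)
    next
      case (add h1 h2)
      then obtain k1 k2 where "k1 \<in> lapl_span Y" "k2 \<in> lapl_span Y"
        "\<And>\<mu>. \<mu> \<in> space (counting_measure_space Y) \<Longrightarrow> k1 \<mu> = lapl v \<mu> * h1 \<mu>"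
        "\<And>\<mu>. \<mu> \<in> space (counting_measure_space Y) \<Longrightarrow> k2 \<mu> = lapl v \<mu> * h2 \<mu>"
        by metis
      then show ?case
        by (intro bexI[of _ "\<lambda>\<mu>. k1 \<mu> + k2 \<mu>"]) (auto intro: lapl_span.add simp: algebra_simps)
    qed
  next
    case (scale g c)
    then obtain k where "k \<in> lapl_span Y" "\<And>\<mu>. \<mu> \<in> space (counting_measure_space Y) \<Longrightarrow> k \<mu> = g \<mu> * h \<mu>"
      by auto
    then show ?case
      by (intro bexI[of _ "\<lambda>\<mu>. c * k \<mu>"]) (auto intro: lapl_span.scale)
  next
    case (add g1 g2)
    then obtain k1 k2 where "k1 \<in> lapl_span Y" "k2 \<in> lapl_span Y"
      "\<And>\<mu>. \<mu> \<in> space (counting_measure_space Y) \<Longrightarrow> k1 \<mu> = g1 \<mu> * h \<mu>"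
      "\<And>\<mu>. \<mu> \<in> space (counting_measure_space Y) \<Longrightarrow> k2 \<mu> = g2 \<mu> * h \<mu>"
      by metis
    then show ?case
      by (intro bexI[of _ "\<lambda>\<mu>. k1 \<mu> + k2 \<mu>"]) (auto intro: lapl_span.add simp: algebra_simps)
  qed
  then show ?thesis using that by auto
qed

section \<open>Density of the exponentials\<close>

text \<open>Membership in the \<open>L^2(Q)\<close> closure of the span, phrased with squared
  distances so that no quotient space is needed.\<close>

definition lapl_approx :: "'y measure \<Rightarrow> 'y measure measure \<Rightarrow> ('y measure \<Rightarrow> real) \<Rightarrow> bool" where
  "lapl_approx Y Q h \<longleftrightarrow> h \<in> borel_measurable Q \<and>
     (\<forall>e>0. \<exists>g\<in>lapl_span Y. (\<integral>\<^sup>+\<mu>. ennreal ((h \<mu> - g \<mu>)\<^sup>2) \<partial>Q) < ennreal e)"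

lemma nn_integral_sq_add_le:
  assumes [measurable]: "f \<in> borel_measurable Q" "g \<in> borel_measurable Q"
  shows "(\<integral>\<^sup>+x. ennreal ((f x + g x)\<^sup>2) \<partial>Q) \<le>
    2 * (\<integral>\<^sup>+x. ennreal ((f x)\<^sup>2) \<partial>Q) + 2 * (\<integral>\<^sup>+x. ennreal ((g x)\<^sup>2) \<partial>Q)"
proof -
  have *: "(a + b)\<^sup>2 \<le> 2 * a\<^sup>2 + 2 * b\<^sup>2" for a b :: real
    using zero_le_power2[of "a - b"] by (simp add: power2_eq_square algebra_simps)
  have "(\<integral>\<^sup>+x. ennreal ((f x + g x)\<^sup>2) \<partial>Q) \<le> (\<integral>\<^sup>+x. 2 * ennreal ((f x)\<^sup>2) + 2 * ennreal ((g x)\<^sup>2) \<partial>Q)"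
    using * by (intro nn_integral_mono)
      (auto simp: ennreal_plus[symmetric] ennreal_mult'[symmetric] ennreal_numeral[symmetric]
         simp del: ennreal_plus ennreal_numeral intro!: ennreal_leI)
  also have "\<dots> = 2 * (\<integral>\<^sup>+x. ennreal ((f x)\<^sup>2) \<partial>Q) + 2 * (\<integral>\<^sup>+x. ennreal ((g x)\<^sup>2) \<partial>Q)"
    by (simp add: nn_integral_add nn_integral_cmult)
  finally show ?thesis .
qed

context
  fixes Y :: "'y measure" and Q :: "'y measure measure"
  assumes fQ: "finite_measure Q" and sQ: "sets Q = sets (counting_measure_space Y)"
begin

interpretation Q: finite_measure Q by (rule fQ)

lemma lapl_span_meas_Q: "g \<in> lapl_span Y \<Longrightarrow> g \<in> borel_measurable Q"
  using lapl_span_measurable measurable_cong_sets[OF sQ refl] by auto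

lemma space_Q: "space Q = space (counting_measure_space Y)"
  by (rule sets_eq_imp_space_eq) (rule sQ)

lemma lapl_approx_closed:
  assumes [measurable]: "h \<in> borel_measurable Q"
    and "\<And>e. e > 0 \<Longrightarrow> \<exists>h'. lapl_approx Y Q h' \<and> (\<integral>\<^sup>+\<mu>. ennreal ((h \<mu> - h' \<mu>)\<^sup>2) \<partial>Q) < ennreal e"
  shows "lapl_approx Y Q h"
  unfolding lapl_approx_def
proof (intro conjI allI impI)
  fix e :: real assume "e > 0"
  \<comment> \<open>Two errors below \<open>e / 4\<close>, each doubled by
    \<open>(a + b)^2 \<le> 2 a^2 + 2 b^2\<close>, add up to \<open>e\<close>.\<close>
  then have e4: "e / 4 > 0" by simp
  from assms(2)[OF e4] obtain h' where h': "lapl_approx Y Q h'" "(\<integral>\<^sup>+\<mu>. ennreal ((h \<mu> - h' \<mu>)\<^sup>2) \<partial>Q) < ennreal (e / 4)"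
    by auto
  then obtain g where g: "g \<in> lapl_span Y" "(\<integral>\<^sup>+\<mu>. ennreal ((h' \<mu> - g \<mu>)\<^sup>2) \<partial>Q) < ennreal (e / 4)"
    using e4 unfolding lapl_approx_def by blast
  have [measurable]: "h' \<in> borel_measurable Q" using h' by (simp add: lapl_approx_def)
  note [measurable] = lapl_span_meas_Q[OF g(1)]
  have "(\<integral>\<^sup>+\<mu>. ennreal ((h \<mu> - g \<mu>)\<^sup>2) \<partial>Q) = (\<integral>\<^sup>+\<mu>. ennreal (((h \<mu> - h' \<mu>) + (h' \<mu> - g \<mu>))\<^sup>2) \<partial>Q)"
    by simp
  also have "\<dots> \<le> 2 * (\<integral>\<^sup>+\<mu>. ennreal ((h \<mu> - h' \<mu>)\<^sup>2) \<partial>Q) + 2 * (\<integral>\<^sup>+\<mu>. ennreal ((h' \<mu> - g \<mu>)\<^sup>2) \<partial>Q)"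
    by (rule nn_integral_sq_add_le) auto
  also have "\<dots> < 2 * ennreal (e / 4) + 2 * ennreal (e / 4)"
    using h'(2) g(2) by (intro add_strict_mono ennreal_mult_strict_left_mono) auto
  also have "\<dots> = ennreal e"
    using \<open>e > 0\<close> by (simp add: ennreal_plus[symmetric] ennreal_mult'[symmetric] ennreal_numeral[symmetric]
         del: ennreal_plus ennreal_numeral)
  finally show "\<exists>g\<in>lapl_span Y. (\<integral>\<^sup>+\<mu>. ennreal ((h \<mu> - g \<mu>)\<^sup>2) \<partial>Q) < ennreal e"
    using g(1) by blast
qed simp

lemma lapl_approx_lim:
  assumes "\<And>j::nat. lapl_approx Y Q (h j)"
    and [measurable]: "f \<in> borel_measurable Q"
    and "\<And>\<mu>. \<mu> \<in> space Q \<Longrightarrow> (\<lambda>j. h j \<mu>) \<longlonglongrightarrow> f \<mu>"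
    and "\<And>j \<mu>. \<mu> \<in> space Q \<Longrightarrow> (f \<mu> - h j \<mu>)\<^sup>2 \<le> b \<mu>"
    and "integrable Q b"
  shows "lapl_approx Y Q f"
proof (rule lapl_approx_closed)
  fix e :: real assume e: "e > 0"
  have [measurable]: "h j \<in> borel_measurable Q" for j using assms(1) by (simp add: lapl_approx_def)
  have [measurable]: "b \<in> borel_measurable Q" using assms(5) by auto
  have "(\<lambda>j. \<integral>\<^sup>+\<mu>. ennreal ((f \<mu> - h j \<mu>)\<^sup>2) \<partial>Q) \<longlonglongrightarrow> (\<integral>\<^sup>+\<mu>. 0 \<partial>Q)"
  proof (rule nn_integral_dominated_convergence[where w="\<lambda>\<mu>. ennreal (b \<mu>)"])
    show "(\<integral>\<^sup>+\<mu>. ennreal (b \<mu>) \<partial>Q) < \<infinity>"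
      using assms(5) by (simp add: integrable_iff_bounded)
        (metis (mono_tags, lifting) abs_ge_self ennreal_leI le_less_trans nn_integral_mono)
    show "AE \<mu> in Q. (\<lambda>j. ennreal ((f \<mu> - h j \<mu>)\<^sup>2)) \<longlonglongrightarrow> 0"
    proof (rule AE_I2)
      fix \<mu> assume "\<mu> \<in> space Q"
      then have "(\<lambda>j. (f \<mu> - h j \<mu>)\<^sup>2) \<longlonglongrightarrow> (f \<mu> - f \<mu>)\<^sup>2"
        by (intro tendsto_intros assms(3))
      then show "(\<lambda>j. ennreal ((f \<mu> - h j \<mu>)\<^sup>2)) \<longlonglongrightarrow> 0"
        using tendsto_ennrealI by fastforce
    qed
  qed (use assms(4) in \<open>auto intro!: AE_I2 ennreal_leI\<close>)
  then have "eventually (\<lambda>j. (\<integral>\<^sup>+\<mu>. ennreal ((f \<mu> - h j \<mu>)\<^sup>2) \<partial>Q) < ennreal e) sequentially"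
    using e by (intro order_tendstoD) auto
  then show "\<exists>h'. lapl_approx Y Q h' \<and> (\<integral>\<^sup>+\<mu>. ennreal ((f \<mu> - h' \<mu>)\<^sup>2) \<partial>Q) < ennreal e"
    using assms(1) by (auto simp: eventually_sequentially)
qed simp

lemma lapl_approx_span:
  assumes "g \<in> lapl_span Y" shows "lapl_approx Y Q g"
  using assms lapl_span_meas_Q by (auto simp: lapl_approx_def intro!: bexI[of _ g])

lemma lapl_approx_add:
  assumes f: "lapl_approx Y Q f" and h: "lapl_approx Y Q h"
  shows "lapl_approx Y Q (\<lambda>\<mu>. f \<mu> + h \<mu>)"
  unfolding lapl_approx_def
proof (intro conjI allI impI)
  have [measurable]: "f \<in> borel_measurable Q" "h \<in> borel_measurable Q"
    using f h by (auto simp: lapl_approx_def)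
  show "(\<lambda>\<mu>. f \<mu> + h \<mu>) \<in> borel_measurable Q" by measurable
  fix e :: real assume "e > 0"
  then have e4: "e / 4 > 0" by simp
  from f h e4 obtain u v where u: "u \<in> lapl_span Y" "(\<integral>\<^sup>+\<mu>. ennreal ((f \<mu> - u \<mu>)\<^sup>2) \<partial>Q) < ennreal (e / 4)"
    and v: "v \<in> lapl_span Y" "(\<integral>\<^sup>+\<mu>. ennreal ((h \<mu> - v \<mu>)\<^sup>2) \<partial>Q) < ennreal (e / 4)"
    unfolding lapl_approx_def by meson
  note [measurable] = lapl_span_meas_Q[OF u(1)] lapl_span_meas_Q[OF v(1)]
  have "(\<integral>\<^sup>+\<mu>. ennreal ((f \<mu> + h \<mu> - (u \<mu> + v \<mu>))\<^sup>2) \<partial>Q) = (\<integral>\<^sup>+\<mu>. ennreal (((f \<mu> - u \<mu>) + (h \<mu> - v \<mu>))\<^sup>2) \<partial>Q)"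
    by (simp add: algebra_simps)
  also have "\<dots> \<le> 2 * (\<integral>\<^sup>+\<mu>. ennreal ((f \<mu> - u \<mu>)\<^sup>2) \<partial>Q) + 2 * (\<integral>\<^sup>+\<mu>. ennreal ((h \<mu> - v \<mu>)\<^sup>2) \<partial>Q)"
    by (rule nn_integral_sq_add_le) auto
  also have "\<dots> < 2 * ennreal (e / 4) + 2 * ennreal (e / 4)"
    using u(2) v(2) by (intro add_strict_mono ennreal_mult_strict_left_mono) auto
  also have "\<dots> = ennreal e"
    using \<open>e > 0\<close> by (simp add: ennreal_plus[symmetric] ennreal_mult'[symmetric] ennreal_numeral[symmetric]
         del: ennreal_plus ennreal_numeral)
  finally show "\<exists>g\<in>lapl_span Y. (\<integral>\<^sup>+\<mu>. ennreal ((f \<mu> + h \<mu> - g \<mu>)\<^sup>2) \<partial>Q) < ennreal e"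
    using lapl_span.add[OF u(1) v(1)] by (intro bexI)
qed

text \<open>Approximants of \<open>f\<close> need not obey the bound \<open>K\<close>, so the two
  factors cannot be replaced at once. First \<open>v * f\<close> is approximated for
  \<open>v\<close> in the span, using a bound of \<open>v\<close>; then \<open>f * h\<close>, using
  the bound of \<open>f\<close>. Each time only the unbounded factor is replaced.\<close>

lemma lapl_approx_mult:
  assumes f: "lapl_approx Y Q f" and h: "lapl_approx Y Q h"
    and bd: "\<And>\<mu>. \<mu> \<in> space Q \<Longrightarrow> \<bar>f \<mu>\<bar> \<le> K"
  shows "lapl_approx Y Q (\<lambda>\<mu>. f \<mu> * h \<mu>)"
proof -
  have [measurable]: "f \<in> borel_measurable Q" "h \<in> borel_measurable Q"
    using f h by (auto simp: lapl_approx_def)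
  have step: "\<exists>u. lapl_approx Y Q u \<and> (\<integral>\<^sup>+\<mu>. ennreal ((h1 \<mu> * h2 \<mu> - u \<mu>)\<^sup>2) \<partial>Q) < ennreal e"
    if h2: "lapl_approx Y Q h2" and bd: "\<And>\<mu>. \<mu> \<in> space Q \<Longrightarrow> \<bar>h1 \<mu>\<bar> \<le> K"
      and 1: "\<And>g. g \<in> lapl_span Y \<Longrightarrow> lapl_approx Y Q (\<lambda>\<mu>. h1 \<mu> * g \<mu>)"
      and e: "e > 0" for h1 h2 K e
  proof -
    \<comment> \<open>The added \<open>1\<close> keeps the divisor positive when
      \<open>K = 0\<close>.\<close>
    have "e / (K\<^sup>2 + 1) > 0" using e by (simp add: add_nonneg_pos)
    then obtain v where v: "v \<in> lapl_span Y" "(\<integral>\<^sup>+\<mu>. ennreal ((h2 \<mu> - v \<mu>)\<^sup>2) \<partial>Q) < ennreal (e / (K\<^sup>2 + 1))"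
      using h2 unfolding lapl_approx_def by blast
    have [measurable]: "h2 \<in> borel_measurable Q" "v \<in> borel_measurable Q"
      using h2 lapl_span_meas_Q[OF v(1)] by (auto simp: lapl_approx_def)
    have "(\<integral>\<^sup>+\<mu>. ennreal ((h1 \<mu> * h2 \<mu> - h1 \<mu> * v \<mu>)\<^sup>2) \<partial>Q) \<le>
       (\<integral>\<^sup>+\<mu>. ennreal (K\<^sup>2 + 1) * ennreal ((h2 \<mu> - v \<mu>)\<^sup>2) \<partial>Q)"
    proof (intro nn_integral_mono)
      fix \<mu> assume "\<mu> \<in> space Q"
      then have "\<bar>h1 \<mu>\<bar>\<^sup>2 \<le> K\<^sup>2" by (intro power_mono bd) auto
      then have "(h1 \<mu>)\<^sup>2 * (h2 \<mu> - v \<mu>)\<^sup>2 \<le> (K\<^sup>2 + 1) * (h2 \<mu> - v \<mu>)\<^sup>2"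
        by (intro mult_right_mono) auto
      then have "(h1 \<mu> * h2 \<mu> - h1 \<mu> * v \<mu>)\<^sup>2 \<le> (K\<^sup>2 + 1) * (h2 \<mu> - v \<mu>)\<^sup>2"
        by (simp add: power_mult_distrib[symmetric] algebra_simps)
      then show "ennreal ((h1 \<mu> * h2 \<mu> - h1 \<mu> * v \<mu>)\<^sup>2) \<le> ennreal (K\<^sup>2 + 1) * ennreal ((h2 \<mu> - v \<mu>)\<^sup>2)"
        by (subst ennreal_mult[symmetric]) (auto intro: ennreal_leI)
    qed
    also have "\<dots> = ennreal (K\<^sup>2 + 1) * (\<integral>\<^sup>+\<mu>. ennreal ((h2 \<mu> - v \<mu>)\<^sup>2) \<partial>Q)"
      by (rule nn_integral_cmult) simp
    also have "\<dots> < ennreal (K\<^sup>2 + 1) * ennreal (e / (K\<^sup>2 + 1))"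
      using v(2) by (intro ennreal_mult_strict_left_mono) (auto simp: add_nonneg_pos)
    also have "\<dots> = ennreal ((K\<^sup>2 + 1) * (e / (K\<^sup>2 + 1)))"
      using e by (subst ennreal_mult) auto
    also have "(K\<^sup>2 + 1) * (e / (K\<^sup>2 + 1)) = e"
      using add_nonneg_pos[of "K\<^sup>2" 1] by simp
    finally show ?thesis using 1[OF v(1)] by blast
  qed
  have ss: "lapl_approx Y Q (\<lambda>\<mu>. u \<mu> * v \<mu>)" if u: "u \<in> lapl_span Y" and v: "v \<in> lapl_span Y" for u v
  proof -
    obtain k where k: "k \<in> lapl_span Y" "\<And>\<mu>. \<mu> \<in> space Q \<Longrightarrow> k \<mu> = u \<mu> * v \<mu>"
      using lapl_span_mult[OF u v] by (auto simp: space_Q)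
    note [measurable] = lapl_span_meas_Q[OF u(1)] lapl_span_meas_Q[OF v(1)]
    show ?thesis
    proof (rule lapl_approx_closed)
      show "\<exists>h'. lapl_approx Y Q h' \<and> (\<integral>\<^sup>+\<mu>. ennreal ((u \<mu> * v \<mu> - h' \<mu>)\<^sup>2) \<partial>Q) < ennreal e" if "e > 0" for e
        using k that lapl_approx_span[OF k(1)]
        by (intro exI[of _ k]) (auto cong: nn_integral_cong_simp)
    qed measurable
  qed
  have fs: "lapl_approx Y Q (\<lambda>\<mu>. f \<mu> * v \<mu>)" if v: "v \<in> lapl_span Y" for v
  proof -
    obtain L where L: "\<And>\<mu>. \<bar>v \<mu>\<bar> \<le> L" using lapl_span_bounded[OF v] by auto
    note [measurable] = lapl_span_meas_Q[OF v(1)]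
    have "lapl_approx Y Q (\<lambda>\<mu>. v \<mu> * f \<mu>)"
      by (rule lapl_approx_closed) (measurable, rule step[OF f L ss[OF v]])
    then show ?thesis by (simp add: mult.commute)
  qed
  show ?thesis
    by (rule lapl_approx_closed) (measurable, rule step[OF h bd fs])
qed

lemma lapl_approx_power:
  assumes f: "lapl_approx Y Q f" and bd: "\<And>\<mu>. \<mu> \<in> space Q \<Longrightarrow> \<bar>f \<mu>\<bar> \<le> K"
  shows "lapl_approx Y Q (\<lambda>\<mu>. f \<mu> ^ n)"
proof (induction n)
  case 0
  then show ?case using lapl_approx_span[OF lapl_span_const[of 1]] by simp
next
  case (Suc n)
  from lapl_approx_mult[OF f this bd] show ?case by simp
qed

lemma lapl_approx_const: "lapl_approx Y Q (\<lambda>_. c)"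
  by (rule lapl_approx_span[OF lapl_span_const])

lemma lapl_approx_scale:
  assumes "lapl_approx Y Q h" shows "lapl_approx Y Q (\<lambda>\<mu>. c * h \<mu>)"
  by (rule lapl_approx_mult[OF lapl_approx_const assms order_refl])

lemma lapl_approx_diff:
  assumes "lapl_approx Y Q f" "lapl_approx Y Q h" shows "lapl_approx Y Q (\<lambda>\<mu>. f \<mu> - h \<mu>)"
  using lapl_approx_add[OF assms(1) lapl_approx_scale[OF assms(2), of "-1"]] by simp

lemma lapl_approx_cong:
  assumes "lapl_approx Y Q f" "\<And>\<mu>. \<mu> \<in> space Q \<Longrightarrow> f \<mu> = h \<mu>" shows "lapl_approx Y Q h"
proof -
  have "f \<in> borel_measurable Q \<longleftrightarrow> h \<in> borel_measurable Q"
    by (rule measurable_cong) (rule assms)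
  moreover have "(\<integral>\<^sup>+\<mu>. ennreal ((f \<mu> - g \<mu>)\<^sup>2) \<partial>Q) = (\<integral>\<^sup>+\<mu>. ennreal ((h \<mu> - g \<mu>)\<^sup>2) \<partial>Q)" for g
    by (rule nn_integral_cong) (simp add: assms)
  ultimately show ?thesis using assms(1) unfolding lapl_approx_def by simp
qed

text \<open>
  Once \<open>{\<mu>(B) \<ge> n}\<close> is handled, \<open>Z = exp (n - \<mu>(B))\<close> restricted to it takes values in \<open>[0, 1]\<close>
  and equals \<open>1\<close> exactly where \<open>\<mu>(B) = n\<close>, so its powers converge to the indicator of that event.
\<close>

lemma lapl_approx_ge:
  assumes B: "B \<in> sets Y" "emeasure Y B < \<infinity>"
  shows "lapl_approx Y Q (indicator {\<mu>\<in>space Q. of_nat n \<le> emeasure \<mu> B})"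
proof (induction n)
  case 0
  show ?case by (rule lapl_approx_cong[OF lapl_approx_const[of 1]]) (auto simp: indicator_def)
next
  case (Suc n)
  let ?S = "\<lambda>n. {\<mu>\<in>space Q. (of_nat n :: ennreal) \<le> emeasure \<mu> B}"
  let ?E = "{\<mu>\<in>space Q. emeasure \<mu> B = (of_nat n :: ennreal)}"
  have [measurable]: "(\<lambda>\<mu>. emeasure \<mu> B) \<in> borel_measurable Q"
    using measurable_emeasure_counting[OF B(1)] measurable_cong_sets[OF sQ refl] by auto
  define X where "X = lapl (\<lambda>y. 1 * indicator B y)"
  have "lapl_approx Y Q X"
    unfolding X_def by (intro lapl_approx_span lapl_span.lapl step_fun_indicator B) simp
  moreover have Xeq: "X \<mu> = nexp (emeasure \<mu> B)" if "\<mu> \<in> space Q" for \<mu>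
    using counting_measureD(1)[of \<mu> Y] that B(1) sets_eq_imp_space_eq[OF sQ]
    by (simp add: X_def lapl_def ennreal_indicator)
  ultimately have Z: "lapl_approx Y Q (\<lambda>\<mu>. indicator (?S n) \<mu> * (exp n * X \<mu>))"
    by (intro lapl_approx_mult[where K=1] Suc lapl_approx_scale) (auto simp: indicator_def)
  define Z where "Z \<mu> = indicator (?S n) \<mu> * (exp n * X \<mu>)" for \<mu>
  \<comment> \<open>Integrality of the counts is decisive: on the event \<open>?S n\<close> every
    value other than \<open>n\<close> is at least \<open>n + 1\<close>, which keeps \<open>Z\<close>
    strictly below \<open>1\<close> there and makes removing \<open>?E\<close> give
    \<open>?S (Suc n)\<close>.\<close>
  have cases: "emeasure \<mu> B = \<infinity> \<or> (\<exists>m. emeasure \<mu> B = of_nat m)" if "\<mu> \<in> space Q" for \<mu>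
    using counting_measureD(4)[of \<mu> Y B] that sets_eq_imp_space_eq[OF sQ] B(1) by auto
  have nexp_nat: "nexp (of_nat m) = exp (- real m)" for m
    by (metis nexp_ennreal ennreal_of_nat_eq_real_of_nat of_nat_0_le_iff)
  have Zv: "Z \<mu> = (if m < n then 0 else exp (- (real m - real n)))"
    if "\<mu> \<in> space Q" "emeasure \<mu> B = of_nat m" for \<mu> m
    using that by (auto simp: Z_def Xeq nexp_nat mult_exp_exp indicator_def)
  have Zi: "Z \<mu> = 0" if "\<mu> \<in> space Q" "emeasure \<mu> B = \<infinity>" for \<mu>
    using that nexp_top by (auto simp: Z_def Xeq)
  have Z01: "0 \<le> Z \<mu> \<and> Z \<mu> \<le> 1" if "\<mu> \<in> space Q" for \<mu>
    using cases[OF that] Zv[OF that] Zi[OF that] by auto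
  have lim: "(\<lambda>k. Z \<mu> ^ k) \<longlonglongrightarrow> indicator ?E \<mu>" if "\<mu> \<in> space Q" for \<mu>
  proof (cases "emeasure \<mu> B = of_nat n")
    case True
    with Zv[OF that True] that show ?thesis by (simp add: indicator_def)
  next
    case False
    have "\<bar>Z \<mu>\<bar> < 1"
      using cases[OF that] Zv[OF that] Zi[OF that] False by auto
    with False show ?thesis by (simp add: indicator_def LIMSEQ_power_zero)
  qed
  have E: "lapl_approx Y Q (indicator ?E)"
  proof (rule lapl_approx_lim[where h="\<lambda>k \<mu>. Z \<mu> ^ k" and b="\<lambda>_. 1"])
    show "lapl_approx Y Q (\<lambda>\<mu>. Z \<mu> ^ k)" for k
      by (rule lapl_approx_power[where K=1]) (use Z Z01 in \<open>auto simp: Z_def\<close>)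
    show "(indicator ?E \<mu> - Z \<mu> ^ k)\<^sup>2 \<le> 1" if "\<mu> \<in> space Q" for \<mu> k
    proof -
      have "0 \<le> Z \<mu> ^ k" "Z \<mu> ^ k \<le> 1" using Z01[OF that] by (auto simp: power_le_one)
      then have "\<bar>indicator ?E \<mu> - Z \<mu> ^ k\<bar> \<le> 1" by (auto simp: indicator_def)
      then show ?thesis by (simp add: abs_square_le_1)
    qed
  qed (use lim in auto)
  show ?case
  proof (rule lapl_approx_cong[OF lapl_approx_diff[OF Suc E]])
    fix \<mu> assume "\<mu> \<in> space Q"
    with cases[OF this] show "indicator (?S n) \<mu> - indicator ?E \<mu> = (indicator (?S (Suc n)) \<mu> :: real)"
      by (auto simp: indicator_def simp del: of_nat_Suc)
  qed
qed

text \<open>Complements come from \<open>1 - indicator A\<close>, finite intersections from products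
  of bounded functions, countable intersections from dominated convergence, and unions from
  complements of intersections.\<close>

lemma lapl_approx_sigma_algebra:
  "sigma_algebra (space Q) {A \<in> sets Q. lapl_approx Y Q (indicator A)}"
proof -
  let ?S = "{A \<in> sets Q. lapl_approx Y Q (indicator A)}"
  have compl: "space Q - A \<in> ?S" if "A \<in> ?S" for A
    using that lapl_approx_diff[OF lapl_approx_const[of 1], of "indicator A"]
    by (auto intro!: sets.Diff elim!: lapl_approx_cong simp: indicator_def)
  show ?thesis
    unfolding sigma_algebra_iff2
  proof (intro conjI allI impI ballI)
    show "?S \<subseteq> Pow (space Q)" using sets.sets_into_space by auto
    show "{} \<in> ?S" by (auto intro!: lapl_approx_cong[OF lapl_approx_const[of 0]])
    show "space Q - s \<in> ?S" if "s \<in> ?S" for s by (rule compl[OF that])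
    fix A :: "nat \<Rightarrow> _" assume A: "range A \<subseteq> ?S"
    define C where "C i = space Q - A i" for i
    have C: "C i \<in> ?S" for i using A unfolding C_def by (intro compl) auto
    have fin: "lapl_approx Y Q (\<lambda>\<mu>. \<Prod>i<n. indicator (C i) \<mu>)" for n
    proof (induction n)
      case 0
      show ?case using lapl_approx_const[of 1] by simp
    next
      case (Suc n)
      have "lapl_approx Y Q (\<lambda>\<mu>. indicator (C n) \<mu> * (\<Prod>i<n. indicator (C i) \<mu>))"
        using C[of n] by (intro lapl_approx_mult[where K=1] Suc) (auto intro: indicator_le_1 simp: abs_of_nonneg)
      then show ?case by (simp add: mult.commute)
    qed
    have prod: "(\<Prod>i<n. indicator (C i) \<mu>) = (indicator {\<mu>. \<forall>i<n. \<mu> \<in> C i} \<mu> :: real)" for n \<mu>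
      by (induction n) (auto simp: indicator_def less_Suc_eq)
    have "lapl_approx Y Q (indicator (\<Inter>i. C i))"
    proof (rule lapl_approx_lim[where h="\<lambda>n \<mu>. \<Prod>i<n. indicator (C i) \<mu>" and b="\<lambda>_. 1"])
      have "(\<Inter>i. C i) \<in> sets Q" using C by (intro sets.countable_INT) auto
      then show "indicator (\<Inter>i. C i) \<in> borel_measurable Q" by simp
      show "(\<lambda>n. \<Prod>i<n. indicator (C i) \<mu>) \<longlonglongrightarrow> (indicator (\<Inter>i. C i) \<mu> :: real)" for \<mu>
      proof (cases "\<mu> \<in> (\<Inter>i. C i)")
        case True
        then show ?thesis by (simp add: prod)
      next
        case False
        then obtain i where "\<mu> \<notin> C i" by auto
        then have "eventually (\<lambda>n. (\<Prod>i<n. indicator (C i) \<mu>) = (indicator (\<Inter>i. C i) \<mu> :: real)) sequentially"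
          unfolding prod using False
          by (intro eventually_sequentiallyI[of "Suc i"]) (auto simp: indicator_def Suc_le_eq)
        then show ?thesis by (rule tendsto_eventually)
      qed
      show "(indicator (\<Inter>i. C i) \<mu> - (\<Prod>i<n. indicator (C i) \<mu>))\<^sup>2 \<le> (1::real)" for n \<mu>
        unfolding prod by (auto simp: indicator_def)
    qed (use fin in auto)
    moreover have "(\<Inter>i. C i) \<in> sets Q" using C by (intro sets.countable_INT) auto
    ultimately have "(\<Inter>i. C i) \<in> ?S" by simp
    from compl[OF this] have "space Q - (\<Inter>i. C i) \<in> ?S" .
    moreover have "space Q - (\<Inter>i. C i) = (\<Union>i. A i)"
      using A sets.sets_into_space by (auto simp: C_def image_subset_iff dest: sets.sets_into_space)
    ultimately show "(\<Union>i. A i) \<in> ?S" by simp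
  qed
qed

text \<open>The approximable events form a sigma-algebra containing all
  \<open>{\<mu>(B) \<ge> n}\<close> with \<open>B\<close> of finite intensity. This makes the
  identity measurable from \<open>R\<close> to the space of counting measures, hence every event is
  approximable. Sets of infinite intensity are reached through an increasing exhaustion
  \<open>C\<close>, by continuity from below of each \<open>\<mu>\<close>.\<close>

lemma lapl_approx_indicator:
  assumes Y: "sigma_finite_measure Y" and A: "A \<in> sets Q"
  shows "lapl_approx Y Q (indicator A)"
proof -
  interpret Y: sigma_finite_measure Y by fact
  let ?S = "{A \<in> sets Q. lapl_approx Y Q (indicator A)}"
  interpret S: sigma_algebra "space Q" ?S by (rule lapl_approx_sigma_algebra)
  define R where "R = sigma (space Q) ?S"
  have sR: "sets R = ?S" and spR: "space R = space Q"
    using S.sets_measure_of_eq S.space_measure_of_eq by (auto simp: R_def)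
  have spQ: "space Q = space (counting_measure_space Y)" by (rule sets_eq_imp_space_eq[OF sQ])
  have fin: "(\<lambda>\<mu>. emeasure \<mu> B) \<in> borel_measurable R" if B: "B \<in> sets Y" "emeasure Y B < \<infinity>" for B
  proof (rule borel_measurableI_greater)
    fix a :: ennreal
    have [measurable]: "(\<lambda>\<mu>. emeasure \<mu> B) \<in> borel_measurable Q"
      using measurable_emeasure_counting[OF B(1)] measurable_cong_sets[OF sQ refl] by auto
    have in_S: "{\<mu>\<in>space Q. of_nat n \<le> emeasure \<mu> B} \<in> sets R" for n
      using lapl_approx_ge[OF B] unfolding sR by auto
    \<comment> \<open>Since counts are integers or infinite, exceeding a threshold \<open>a\<close>
      means reaching some integer above it, or being infinite; the latter is covered because
      \<open>a < \<infinity>\<close> lies below some integer.\<close>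
    have "{\<mu> \<in> space R. a < emeasure \<mu> B} = (\<Union>n\<in>{n. a < of_nat n}. {\<mu>\<in>space Q. of_nat n \<le> emeasure \<mu> B})"
    proof (intro set_eqI iffI)
      fix \<mu> assume \<mu>: "\<mu> \<in> {\<mu> \<in> space R. a < emeasure \<mu> B}"
      then have "emeasure \<mu> B \<in> range of_nat \<union> {\<infinity>}"
        by (intro counting_measureD(4)[of \<mu> Y] B) (auto simp: spR spQ)
      moreover have "\<exists>n. a < of_nat n" if "a < \<infinity>"
        using that by (metis ennreal_Ex_less_of_nat infinity_ennreal_def)
      ultimately show "\<mu> \<in> (\<Union>n\<in>{n. a < of_nat n}. {\<mu>\<in>space Q. of_nat n \<le> emeasure \<mu> B})"
        using \<mu> by (auto simp: spR)
    qed (auto simp: spR)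
    also have "\<dots> \<in> sets R" using in_S by (intro sets.countable_UN') auto
    finally show "{\<mu> \<in> space R. a < emeasure \<mu> B} \<in> sets R" .
  qed
  have "(\<lambda>\<mu>. \<mu>) \<in> measurable R (counting_measure_space Y)"
  proof (rule measurable_counting_measure_spaceI)
    fix B assume B: "B \<in> sets Y"
    obtain C :: "nat \<Rightarrow> _" where C: "range C \<subseteq> sets Y" "(\<Union>i. C i) = space Y"
      "\<And>i. emeasure Y (C i) \<noteq> \<infinity>" "incseq C"
      using Y.sigma_finite_incseq by blast
    have "(\<lambda>\<mu>. SUP i. emeasure \<mu> (B \<inter> C i)) \<in> borel_measurable R"
    proof (intro borel_measurable_SUP fin)
      show "emeasure Y (B \<inter> C i) < \<infinity>" for i
        using emeasure_mono[of "B \<inter> C i" "C i" Y] C(1) C(3)[of i]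
        by (auto simp: less_top[symmetric] top_unique)
    qed (use B C in auto)
    also have "?this \<longleftrightarrow> (\<lambda>\<mu>. emeasure \<mu> B) \<in> borel_measurable R"
    proof (rule measurable_cong)
      fix \<mu> assume "\<mu> \<in> space R"
      then have "sets \<mu> = sets Y" by (intro counting_measureD) (auto simp: spR spQ)
      then have "(SUP i. emeasure \<mu> (B \<inter> C i)) = emeasure \<mu> (\<Union>i. B \<inter> C i)"
        using B C(1) incseq_SucD[OF C(4)] by (intro SUP_emeasure_incseq incseq_SucI) auto
      also have "(\<Union>i. B \<inter> C i) = B" using B sets.sets_into_space C(2) by blast
      finally show "(SUP i. emeasure \<mu> (B \<inter> C i)) = emeasure \<mu> B" .
    qed
    finally show "(\<lambda>\<mu>. emeasure \<mu> B) \<in> borel_measurable R" .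
  qed (simp add: spR spQ)
  from measurable_sets[OF this, of A] A have "A \<inter> space R \<in> sets R" by (simp add: sQ)
  then show ?thesis
    using A sets.sets_into_space[OF A] by (simp add: sR spR Int_absorb2)
qed

theorem lapl_approx_L2:
  assumes Y: "sigma_finite_measure Y"
    and f [measurable]: "f \<in> borel_measurable Q" and f2: "integrable Q (\<lambda>\<mu>. (f \<mu>)\<^sup>2)"
  shows "lapl_approx Y Q f"
proof -
  have simple: "lapl_approx Y Q s" if "simple_function Q s" for s
  proof -
    have "emeasure Q {y \<in> space Q. s y \<noteq> 0} \<noteq> \<infinity>" by simp
    with that show ?thesis
    proof (induction rule: integrable_simple_function_induct)
      case (cong f g)
      then show ?case by (auto elim: lapl_approx_cong)
    next
      case (indicator A y)
      then show ?case using lapl_approx_scale[OF lapl_approx_indicator[OF Y], of A y] by (simp add: mult.commute)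
    next
      case (add f g)
      then show ?case by (intro lapl_approx_add)
    qed
  qed
  obtain s where s: "\<And>i. simple_function Q (s i)" "\<And>\<mu>. \<mu> \<in> space Q \<Longrightarrow> (\<lambda>i. s i \<mu>) \<longlonglongrightarrow> f \<mu>"
    "\<And>i \<mu>. \<mu> \<in> space Q \<Longrightarrow> \<bar>s i \<mu>\<bar> \<le> 2 * \<bar>f \<mu>\<bar>"
    using borel_measurable_implies_sequence_metric[OF f, of 0] unfolding dist_real_def diff_zero by metis
  show ?thesis
  proof (rule lapl_approx_lim[OF simple[OF s(1)] f s(2)])
    fix j \<mu> assume "\<mu> \<in> space Q"
    \<comment> \<open>The factor 3 is \<open>1 + 2\<close>, from the domination of the simple
      functions by \<open>2 * \<bar>f \<mu>\<bar>\<close>; its square gives the integrable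
      bound.\<close>
    from s(3)[OF this, of j] have "\<bar>f \<mu> - s j \<mu>\<bar> \<le> 3 * \<bar>f \<mu>\<bar>" by linarith
    then have "\<bar>f \<mu> - s j \<mu>\<bar>\<^sup>2 \<le> (3 * \<bar>f \<mu>\<bar>)\<^sup>2" by (intro power_mono) auto
    then show "(f \<mu> - s j \<mu>)\<^sup>2 \<le> 9 * (f \<mu>)\<^sup>2" by (simp add: power_mult_distrib)
  qed (use f2 in auto)
qed

end

text \<open>Approximating \<open>indicator A\<close> in \<open>L^2\<close> of the sum
  \<open>m + m'\<close> gives one function \<open>g\<close> of the span that is close to it under
  both measures, and the integrals of \<open>g\<close> agree by linearity.\<close>

theorem measure_eqI_lapl:
  assumes Y: "sigma_finite_measure Y"
    and fin: "finite_measure m" "finite_measure m'"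
    and s: "sets m = sets (counting_measure_space Y)" "sets m' = sets (counting_measure_space Y)"
    and eq: "\<And>w. step_fun Y w \<Longrightarrow> (\<integral>\<mu>. lapl w \<mu> \<partial>m) = (\<integral>\<mu>. lapl w \<mu> \<partial>m')"
  shows "m = m'"
proof (rule measure_eqI)
  show "sets m = sets m'" by (simp add: s)
  interpret m: finite_measure m by fact
  interpret m': finite_measure m' by fact
  define Q where "Q = add_measure m m'"
  have sQ: "sets Q = sets (counting_measure_space Y)" by (simp add: Q_def s)
  interpret Q: finite_measure Q
    by standard (simp add: Q_def emeasure_add_measure s)
  have Qint: "nn_integral Q h = nn_integral m h + nn_integral m' h" if "h \<in> borel_measurable m" for h
    unfolding Q_def by (rule nn_integral_add_measure) (simp_all add: s that)
  have meas: "h \<in> borel_measurable (counting_measure_space Y) \<Longrightarrow> h \<in> borel_measurable m \<and> h \<in> borel_measurable m'"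
    for h :: "_ \<Rightarrow> real" using measurable_cong_sets[OF s(1) refl] measurable_cong_sets[OF s(2) refl] by auto
  have span_int: "integrable m g" "integrable m' g" if g: "g \<in> lapl_span Y" for g
  proof -
    obtain K where "\<And>\<mu>. \<bar>g \<mu>\<bar> \<le> K" using lapl_span_bounded[OF g] by auto
    then show "integrable m g" "integrable m' g"
      using meas[OF lapl_span_measurable[OF g]]
      by (auto intro!: m.integrable_const_bound[where B=K] m'.integrable_const_bound[where B=K])
  qed
  have span: "(\<integral>\<mu>. g \<mu> \<partial>m) = (\<integral>\<mu>. g \<mu> \<partial>m')" if "g \<in> lapl_span Y" for g
    using that
  proof (induction rule: lapl_span.induct)
    case (add g h)
    then show ?case by (simp add: span_int)
  qed (auto simp: eq)
  fix A assume A: "A \<in> sets m"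
  \<comment> \<open>The pointwise bound \<open>\<bar>x\<bar> \<le> d + x^2 / d\<close> takes the
    place of the Cauchy-Schwarz inequality: an \<open>L^2\<close> error of at most \<open>d\<close>
    costs at most \<open>d\<close> times the total mass plus \<open>d\<close>.\<close>
  have close: "\<bar>measure n A - (\<integral>\<mu>. g \<mu> \<partial>n)\<bar> \<le> d * measure n (space n) + d"
    if "finite_measure n" "sets n = sets m" "integrable n g" "d > 0"
      "(\<integral>\<^sup>+\<mu>. ennreal ((indicator A \<mu> - g \<mu>)\<^sup>2) \<partial>n) \<le> ennreal (d\<^sup>2)" for n g d
  proof -
    interpret n: finite_measure n by fact
    have [measurable]: "A \<in> sets n" "g \<in> borel_measurable n" using A that by auto
    have i2: "integrable n (\<lambda>\<mu>. (indicator A \<mu> - g \<mu>)\<^sup>2)"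
      using that(5) by (intro integrableI_bounded) (auto simp: le_less_trans[OF _ ennreal_less_top])
    have "(\<integral>\<mu>. (indicator A \<mu> - g \<mu>)\<^sup>2 \<partial>n) \<le> d\<^sup>2"
      using that(5) i2 by (subst (asm) nn_integral_eq_integral) auto
    have iA: "integrable n (indicator A :: _ \<Rightarrow> real)" by (simp add: less_top[symmetric])
    have "\<bar>measure n A - (\<integral>\<mu>. g \<mu> \<partial>n)\<bar> = \<bar>\<integral>\<mu>. indicator A \<mu> - g \<mu> \<partial>n\<bar>"
      using iA that(3) by (subst Bochner_Integration.integral_diff) auto
    also have "\<dots> \<le> (\<integral>\<mu>. \<bar>indicator A \<mu> - g \<mu>\<bar> \<partial>n)" by (rule integral_abs_bound)
    also have "\<dots> \<le> (\<integral>\<mu>. d + (indicator A \<mu> - g \<mu>)\<^sup>2 / d \<partial>n)"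
    proof (intro integral_mono)
      fix \<mu>
      define x where "x = (indicator A \<mu> - g \<mu> :: real)"
      have "0 \<le> (\<bar>x\<bar> - d)\<^sup>2 + \<bar>x\<bar> * d" using \<open>d > 0\<close> by simp
      also have "\<dots> = d * d + x\<^sup>2 - \<bar>x\<bar> * d" by (simp add: power2_eq_square algebra_simps)
      finally have "\<bar>x\<bar> * d \<le> d * d + x\<^sup>2" by simp
      then show "\<bar>indicator A \<mu> - g \<mu>\<bar> \<le> d + (indicator A \<mu> - g \<mu>)\<^sup>2 / d"
        using \<open>d > 0\<close> by (simp add: x_def[symmetric] field_simps)
    qed (use iA i2 that(3) in auto)
    also have "\<dots> = d * measure n (space n) + (\<integral>\<mu>. (indicator A \<mu> - g \<mu>)\<^sup>2 \<partial>n) / d"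
      using i2 by (subst Bochner_Integration.integral_add) auto
    also have "\<dots> \<le> d * measure n (space n) + d\<^sup>2 / d"
      using \<open>(\<integral>\<mu>. (indicator A \<mu> - g \<mu>)\<^sup>2 \<partial>n) \<le> d\<^sup>2\<close> \<open>d > 0\<close> by (intro add_left_mono divide_right_mono) auto
    finally show ?thesis using \<open>d > 0\<close> by (simp add: power2_eq_square)
  qed
  \<comment> \<open>\<open>d * K\<close> is the sum of the two error bounds
    \<open>d * mass + d\<close> for \<open>m\<close> and \<open>m'\<close>.\<close>
  define K where "K = measure m (space m) + measure m' (space m') + 2"
  have K: "K > 0" unfolding K_def by (intro add_nonneg_pos add_nonneg_nonneg) auto
  have "\<bar>measure m A - measure m' A\<bar> \<le> e" if "e > 0" for e
  proof -
    define d where "d = e / K"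
    have d: "d > 0" using that K by (simp add: d_def)
    have "lapl_approx Y Q (indicator A)"
      using A by (intro lapl_approx_indicator Y sQ Q.finite_measure_axioms) (simp_all add: Q_def)
    moreover have "d\<^sup>2 > 0" using d by simp
    ultimately obtain g where g: "g \<in> lapl_span Y" "(\<integral>\<^sup>+\<mu>. ennreal ((indicator A \<mu> - g \<mu>)\<^sup>2) \<partial>Q) < ennreal (d\<^sup>2)"
      unfolding lapl_approx_def by blast
    note [measurable] = meas[OF lapl_span_measurable[OF g(1)], THEN conjunct1]
    have "(\<integral>\<^sup>+\<mu>. ennreal ((indicator A \<mu> - g \<mu>)\<^sup>2) \<partial>m) + (\<integral>\<^sup>+\<mu>. ennreal ((indicator A \<mu> - g \<mu>)\<^sup>2) \<partial>m') < ennreal (d\<^sup>2)"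
      using g(2) A by (subst (asm) Qint) auto
    moreover have "a \<le> c \<and> b \<le> c" if "a + b < c" for a b c :: ennreal
      using order_trans[OF _ less_imp_le[OF that], of a] order_trans[OF _ less_imp_le[OF that], of b] by simp
    ultimately have "(\<integral>\<^sup>+\<mu>. ennreal ((indicator A \<mu> - g \<mu>)\<^sup>2) \<partial>m) \<le> ennreal (d\<^sup>2)"
      "(\<integral>\<^sup>+\<mu>. ennreal ((indicator A \<mu> - g \<mu>)\<^sup>2) \<partial>m') \<le> ennreal (d\<^sup>2)"
      by blast+
    then have "\<bar>measure m A - (\<integral>\<mu>. g \<mu> \<partial>m)\<bar> \<le> d * measure m (space m) + d"
      "\<bar>measure m' A - (\<integral>\<mu>. g \<mu> \<partial>m)\<bar> \<le> d * measure m' (space m') + d"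
      using close[of m g d] close[of m' g d] span_int[OF g(1)] span[OF g(1)] d fin s by auto
    then have "\<bar>measure m A - measure m' A\<bar> \<le> d * K"
      by (simp add: K_def algebra_simps)
    then show ?thesis using K by (simp add: d_def)
  qed
  then have "\<bar>measure m A - measure m' A\<bar> \<le> 0" by (rule field_le_epsilon[of _ 0, simplified])
  then show "emeasure m A = emeasure m' A"
    by (simp add: m.emeasure_eq_measure m'.emeasure_eq_measure)
qed

section \<open>The Mecke equation\<close>

text \<open>Halving the step replaces \<open>1 - s^2\<close> by \<open>2 (1 - s)\<close>, where
  \<open>s\<close> is the exponential at the smaller step, and
  \<open>1 - s^2 \<le> 2 (1 - s)\<close> on \<open>[0, 1]\<close>. The value
  \<open>x = \<infinity>\<close> is included because \<open>\<mu>(B)\<close> is not yet known to be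
  almost surely finite.\<close>

lemma dyadic_diff_quotient:
  fixes x :: ennreal
  defines "q \<equiv> \<lambda>k::nat. ennreal (2 ^ k * (1 - nexp (ennreal (1 / 2 ^ k) * x)))"
  shows "incseq q" "q \<longlonglongrightarrow> x"
proof -
  show "incseq q"
  proof (rule incseq_SucI)
    fix k
    define s where "s = nexp (ennreal (1 / 2 ^ Suc k) * x)"
    have s: "0 \<le> s" "s \<le> 1" by (simp_all add: s_def nexp_nonneg nexp_le_1)
    have "ennreal (1 / 2 ^ k) * x = ennreal (1 / 2 ^ Suc k) * x + ennreal (1 / 2 ^ Suc k) * x"
      by (subst distrib_right[symmetric], subst ennreal_plus[symmetric]) (auto simp: field_simps)
    then have "nexp (ennreal (1 / 2 ^ k) * x) = s * s"
      by (simp only: nexp_add s_def)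
    moreover have "(1 - s) * (1 + s) \<le> (1 - s) * 2"
      using s by (intro mult_left_mono) auto
    then have "1 - s * s \<le> 2 * (1 - s)" by (simp add: algebra_simps)
    then have "2 ^ k * (1 - s * s) \<le> 2 ^ k * (2 * (1 - s))" by (intro mult_left_mono) auto
    ultimately show "q k \<le> q (Suc k)"
      unfolding q_def s_def[symmetric] by (intro ennreal_leI) (simp add: algebra_simps)
  qed
  show "q \<longlonglongrightarrow> x"
  proof (cases x)
    case (real r)
    have "ennreal (1 / 2 ^ k) * x = ennreal (r / 2 ^ k)" for k
      using real by (simp add: ennreal_mult[symmetric])
    then have "q = (\<lambda>k. ennreal (2 ^ k * (1 - exp (- (r / 2 ^ k)))))"
      using real by (simp add: q_def)
    moreover have "(\<lambda>k::nat. 2 ^ k * (1 - exp (- (r / 2 ^ k)))) \<longlonglongrightarrow> r"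
      by real_asymp
    ultimately show ?thesis using real by (simp add: tendsto_ennrealI)
  next
    case top
    then have "q = (\<lambda>k. ennreal (2 ^ k))"
      using nexp_top by (auto simp: q_def ennreal_mult_top fun_eq_iff)
    moreover have "filterlim (\<lambda>k::nat. 2 ^ k :: real) at_top sequentially" by real_asymp
    then have "(\<lambda>k::nat. ennreal (2 ^ k)) \<longlonglongrightarrow> \<infinity>"
      using ennreal_tendsto_top_eq_at_top[of "\<lambda>k. 2 ^ k" sequentially] by simp
    ultimately show ?thesis using top by simp
  qed
qed

abbreviation add_point :: "'y measure \<Rightarrow> 'y \<Rightarrow> 'y measure" where
  "add_point \<mu> z \<equiv> add_measure \<mu> (return \<mu> z)"

text \<open>\<open>P\<close> plays the law of the process, so that configurations themselves are the
  sample points and difference operators act on random variables. The Laplace functional is all that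
  is recorded about it.\<close>

locale poisson_space = Y: sigma_finite_measure Y + P: prob_space P
  for Y :: "'y measure" and P :: "'y measure measure" +
  assumes sets_P: "sets P = sets (counting_measure_space Y)"
    and laplace: "\<And>w. step_fun Y w \<Longrightarrow> (\<integral>\<mu>. lapl w \<mu> \<partial>P) = exp (- (\<integral>y. 1 - exp (- w y) \<partial>Y))"
begin

abbreviation N where "N \<equiv> counting_measure_space Y"

lemma space_P: "space P = space N"
  by (rule sets_eq_imp_space_eq) (rule sets_P)

lemma measurable_P [simp]: "measurable P X = measurable N X"
  by (rule measurable_cong_sets) (simp_all add: sets_P)

lemma measurable_add_point: "(\<lambda>(\<mu>, z). add_point \<mu> z) \<in> measurable (P \<Otimes>\<^sub>M Y) N"
  using measurable_add_return[of Y]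
  by (simp add: measurable_cong_sets[OF sets_pair_measure_cong[OF sets_P refl] refl])

lemma lapl_integrable: "step_fun Y w \<Longrightarrow> integrable P (lapl w)"
  by (rule P.integrable_const_bound[where B=1]) (auto simp: lapl_nonneg lapl_le_1)

text \<open>
  The derivative of the Laplace functional in direction \<open>indicator B\<close>, taken along dyadic step sizes
  because the difference quotients are then monotone; the integrability of \<open>\<mu>(B)\<close> is a consequence.
\<close>

lemma lapl_emeasure:
  assumes B [measurable]: "B \<in> sets Y" and fin: "emeasure Y B < \<infinity>" and w: "step_fun Y w"
  shows "(\<integral>\<^sup>+\<mu>. emeasure \<mu> B * ennreal (lapl w \<mu>) \<partial>P) =
    ennreal (\<integral>\<mu>. lapl w \<mu> \<partial>P) * (\<integral>\<^sup>+z. indicator B z * ennreal (exp (- w z)) \<partial>Y)"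
proof -
  note [measurable] = step_fun_measurable[OF w] lapl_measurable[OF w]
  have w0: "0 \<le> w z" for z using w by (auto simp: step_fun_def)
  \<comment> \<open>\<open>exp (- I)\<close> is the Laplace functional at \<open>w\<close>, and
    \<open>J\<close> is the derivative of its exponent in direction \<open>indicator B\<close>;
    hence the limit of the quotients has to be \<open>exp (- I) * J\<close>.\<close>
  define I where "I = (\<integral>y. 1 - exp (- w y) \<partial>Y)"
  define J where "J = (\<integral>z. indicator B z * exp (- w z) \<partial>Y)"
  have intJ: "integrable Y (\<lambda>z. indicator B z * exp (- w z))"
    using w0 fin by (intro Bochner_Integration.integrable_bound[OF integrable_real_indicator[OF B fin]])
      (auto simp: indicator_def)
  have J0: "0 \<le> J" unfolding J_def by (intro integral_nonneg_AE) auto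
  have "(\<integral>\<^sup>+z. indicator B z * ennreal (exp (- w z)) \<partial>Y) = (\<integral>\<^sup>+z. ennreal (indicator B z * exp (- w z)) \<partial>Y)"
    by (intro nn_integral_cong) (auto simp: indicator_def)
  also have "\<dots> = ennreal J"
    unfolding J_def by (rule nn_integral_eq_integral[OF intJ]) auto
  finally have J_eq: "(\<integral>\<^sup>+z. indicator B z * ennreal (exp (- w z)) \<partial>Y) = ennreal J" .
  let ?v = "\<lambda>k y. w y + (1 / 2 ^ k) * indicator B y"
  define q where "q k \<mu> = ennreal (2 ^ k * (1 - nexp (ennreal (1 / 2 ^ k) * emeasure \<mu> B))) * ennreal (lapl w \<mu>)" for k :: nat and \<mu>
  have v: "step_fun Y (?v k)" for k :: nat
    by (intro step_fun_add step_fun_indicator w B fin) simp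
  have Iv: "(\<integral>y. 1 - exp (- ?v k y) \<partial>Y) = I + (1 - exp (- (1 / 2 ^ k))) * J" for k :: nat
  proof -
    have "1 - exp (- (a + c)) = (1 - exp (- a)) + (1 - exp (- c)) * exp (- a)" for a c :: real
      by (simp add: algebra_simps mult_exp_exp)
    then have "(\<integral>y. 1 - exp (- ?v k y) \<partial>Y) =
        (\<integral>y. (1 - exp (- w y)) + (1 - exp (- (1 / 2 ^ k))) * (indicator B y * exp (- w y)) \<partial>Y)"
      by (intro Bochner_Integration.integral_cong) (auto simp: indicator_def)
    also have "\<dots> = I + (1 - exp (- (1 / 2 ^ k))) * J"
      using step_fun_integral(1)[OF w] intJ unfolding I_def J_def
      by (subst Bochner_Integration.integral_add) auto
    finally show ?thesis .
  qed
  have qint: "(\<integral>\<^sup>+\<mu>. q k \<mu> \<partial>P) = ennreal (exp (- I) * (2 ^ k * (1 - exp (- ((1 - exp (- (1 / 2 ^ k))) * J)))))" for k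
  proof -
    have "(\<integral>\<^sup>+\<mu>. q k \<mu> \<partial>P) = (\<integral>\<^sup>+\<mu>. ennreal (2 ^ k * (lapl w \<mu> - lapl (?v k) \<mu>)) \<partial>P)"
    proof (intro nn_integral_cong)
      fix \<mu> assume "\<mu> \<in> space P"
      then have \<mu>: "\<mu> \<in> space N" by (simp add: space_P)
      have [measurable]: "B \<in> sets \<mu>" using counting_measureD(1)[OF \<mu>] by simp
      have "lapl (\<lambda>y. (1 / 2 ^ k) * indicator B y) \<mu> = nexp (\<integral>\<^sup>+y. ennreal (1 / 2 ^ k) * indicator B y \<partial>\<mu>)"
        unfolding lapl_def by (intro arg_cong[where f=nexp] nn_integral_cong) (auto simp: indicator_def)
      also have "\<dots> = nexp (ennreal (1 / 2 ^ k) * emeasure \<mu> B)"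
        by (subst nn_integral_cmult_indicator) auto
      finally have "lapl (?v k) \<mu> = lapl w \<mu> * nexp (ennreal (1 / 2 ^ k) * emeasure \<mu> B)"
        using lapl_add[OF w step_fun_indicator[OF B fin, of "1 / 2 ^ k"] \<mu>] by simp
      then show "q k \<mu> = ennreal (2 ^ k * (lapl w \<mu> - lapl (?v k) \<mu>))"
        unfolding q_def by (subst ennreal_mult[symmetric]) (auto simp: nexp_le_1 lapl_nonneg algebra_simps)
    qed
    also have "\<dots> = ennreal (\<integral>\<mu>. 2 ^ k * (lapl w \<mu> - lapl (?v k) \<mu>) \<partial>P)"
    proof (rule nn_integral_eq_integral)
      show "integrable P (\<lambda>\<mu>. 2 ^ k * (lapl w \<mu> - lapl (?v k) \<mu>))"
        using lapl_integrable[OF w] lapl_integrable[OF v[of k]] by simp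
      show "AE \<mu> in P. 0 \<le> 2 ^ k * (lapl w \<mu> - lapl (?v k) \<mu>)"
      proof (rule AE_I2)
        fix \<mu> assume "\<mu> \<in> space P"
        then have "lapl (?v k) \<mu> = lapl w \<mu> * lapl (\<lambda>y. (1 / 2 ^ k) * indicator B y) \<mu>"
          using lapl_add[OF w step_fun_indicator[OF B fin, of "1 / 2 ^ k"], of \<mu>] by (simp add: space_P)
        then show "0 \<le> 2 ^ k * (lapl w \<mu> - lapl (?v k) \<mu>)"
          using mult_left_le[OF lapl_le_1 lapl_nonneg] by (intro mult_nonneg_nonneg) simp_all
      qed
    qed
    also have "(\<integral>\<mu>. 2 ^ k * (lapl w \<mu> - lapl (?v k) \<mu>) \<partial>P) =
        2 ^ k * (exp (- I) - exp (- (I + (1 - exp (- (1 / 2 ^ k))) * J)))"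
      using lapl_integrable[OF w] lapl_integrable[OF v[of k]]
        laplace[OF w, folded I_def] laplace[OF v[of k], unfolded Iv]
      by simp
    also have "\<dots> = exp (- I) * (2 ^ k * (1 - exp (- ((1 - exp (- (1 / 2 ^ k))) * J))))"
      by (simp only: minus_add_distrib exp_add right_diff_distrib mult_1_right mult_ac)
    finally show ?thesis .
  qed
  have "(\<lambda>k. \<integral>\<^sup>+\<mu>. q k \<mu> \<partial>P) \<longlonglongrightarrow> (\<integral>\<^sup>+\<mu>. emeasure \<mu> B * ennreal (lapl w \<mu>) \<partial>P)"
  proof (rule nn_integral_LIMSEQ)
    show "incseq q"
      using dyadic_diff_quotient(1) unfolding q_def incseq_def le_fun_def
      by (auto intro!: mult_right_mono)
    \<comment> \<open>The case \<open>lapl w \<mu> = 0\<close> is separated because the limit may be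
      \<open>\<infinity> * 0\<close>, where multiplication is not continuous.\<close>
    show "(\<lambda>k. q k \<mu>) \<longlonglongrightarrow> emeasure \<mu> B * ennreal (lapl w \<mu>)" for \<mu>
      unfolding q_def
      by (cases "ennreal (lapl w \<mu>) = 0") (simp, intro tendsto_mult_ennreal dyadic_diff_quotient(2) tendsto_const, auto)
    show "q k \<in> borel_measurable P" for k
      unfolding q_def[abs_def] measurable_P by measurable
  qed
  moreover have "(\<lambda>k. \<integral>\<^sup>+\<mu>. q k \<mu> \<partial>P) \<longlonglongrightarrow> ennreal (exp (- I) * J)"
    unfolding qint by (intro tendsto_ennrealI tendsto_mult tendsto_const) real_asymp
  ultimately have "(\<integral>\<^sup>+\<mu>. emeasure \<mu> B * ennreal (lapl w \<mu>) \<partial>P) = ennreal (exp (- I) * J)"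
    by (rule LIMSEQ_unique)
  then show ?thesis
    unfolding J_eq laplace[OF w] I_def[symmetric] using J0 by (simp add: ennreal_mult)
qed

text \<open>Both sides are integrals of \<open>h\<close>: against \<open>m\<close>, which has
  density \<open>\<mu>(B)\<close>, and against \<open>m'\<close>, the image of
  \<open>P \<Otimes> D\<close> under adding a point, where \<open>D\<close> is the intensity
  restricted to \<open>B\<close>. Adding \<open>z\<close> multiplies \<open>lapl w\<close> by
  \<open>exp (- w z)\<close>, so \<open>lapl_emeasure\<close> says that \<open>m\<close> and
  \<open>m'\<close> have the same Laplace functional.\<close>

theorem mecke:
  assumes B [measurable]: "B \<in> sets Y" and fin: "emeasure Y B < \<infinity>"
    and h [measurable]: "h \<in> borel_measurable N"
  shows "(\<integral>\<^sup>+z. indicator B z * (\<integral>\<^sup>+\<mu>. h (add_point \<mu> z) \<partial>P) \<partial>Y) = (\<integral>\<^sup>+\<mu>. emeasure \<mu> B * h \<mu> \<partial>P)"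
proof -
  define D where "D = density Y (indicator B)"
  define m where "m = density P (\<lambda>\<mu>. emeasure \<mu> B)"
  define m' where "m' = distr (P \<Otimes>\<^sub>M D) N (\<lambda>(\<mu>, z). add_point \<mu> z)"
  interpret D: finite_measure D
    using fin by (auto intro!: finite_measureI simp: D_def emeasure_density)
  interpret PD: pair_sigma_finite P D ..
  have ap [measurable]: "(\<lambda>(\<mu>, z). add_point \<mu> z) \<in> measurable (P \<Otimes>\<^sub>M D) N"
    using measurable_add_point by (simp add: D_def)
  have [measurable]: "(\<lambda>(\<mu>, z). add_point \<mu> z) \<in> measurable (P \<Otimes>\<^sub>M Y) N"
    by (rule measurable_add_point)
  have m_int: "(\<integral>\<^sup>+\<mu>. g \<mu> \<partial>m) = (\<integral>\<^sup>+\<mu>. emeasure \<mu> B * g \<mu> \<partial>P)" if "g \<in> borel_measurable N" for g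
    unfolding m_def using that by (subst nn_integral_density) auto
  have m'_int: "(\<integral>\<^sup>+\<mu>. g \<mu> \<partial>m') = (\<integral>\<^sup>+z. indicator B z * (\<integral>\<^sup>+\<mu>. g (add_point \<mu> z) \<partial>P) \<partial>Y)"
    if [measurable]: "g \<in> borel_measurable N" for g :: "_ \<Rightarrow> ennreal"
  proof -
    have "(\<integral>\<^sup>+\<mu>. g \<mu> \<partial>m') = (\<integral>\<^sup>+x. g (case x of (\<mu>, z) \<Rightarrow> add_point \<mu> z) \<partial>(P \<Otimes>\<^sub>M D))"
      unfolding m'_def by (rule nn_integral_distr) auto
    also have "\<dots> = (\<integral>\<^sup>+z. \<integral>\<^sup>+\<mu>. g (add_point \<mu> z) \<partial>P \<partial>D)"
      by (subst PD.nn_integral_snd[symmetric]) auto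
    also have "\<dots> = (\<integral>\<^sup>+z. indicator B z * (\<integral>\<^sup>+\<mu>. g (add_point \<mu> z) \<partial>P) \<partial>Y)"
      unfolding D_def by (rule nn_integral_density) measurable
    finally show ?thesis .
  qed
  have lap_m': "(\<integral>\<^sup>+\<mu>. ennreal (lapl w \<mu>) \<partial>m') = (\<integral>\<^sup>+\<mu>. ennreal (lapl w \<mu>) \<partial>m)" if w: "step_fun Y w" for w
  proof -
    note [measurable] = step_fun_measurable[OF w] lapl_measurable[OF w]
    have "(\<integral>\<^sup>+\<mu>. ennreal (lapl w \<mu>) \<partial>m') =
        (\<integral>\<^sup>+z. indicator B z * (\<integral>\<^sup>+\<mu>. ennreal (exp (- w z)) * ennreal (lapl w \<mu>) \<partial>P) \<partial>Y)"
      by (subst m'_int, simp)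
        (intro nn_integral_cong arg_cong2[where f="(*)"] refl,
          simp add: lapl_add_return[OF w] space_P ennreal_mult lapl_nonneg)
    also have "\<dots> = (\<integral>\<^sup>+z. indicator B z * ennreal (exp (- w z)) * (\<integral>\<^sup>+\<mu>. ennreal (lapl w \<mu>) \<partial>P) \<partial>Y)"
      by (simp add: nn_integral_cmult mult.assoc)
    also have "\<dots> = (\<integral>\<^sup>+z. indicator B z * ennreal (exp (- w z)) \<partial>Y) * (\<integral>\<^sup>+\<mu>. ennreal (lapl w \<mu>) \<partial>P)"
      by (rule nn_integral_multc) measurable
    also have "(\<integral>\<^sup>+\<mu>. ennreal (lapl w \<mu>) \<partial>P) = ennreal (\<integral>\<mu>. lapl w \<mu> \<partial>P)"
      by (rule nn_integral_eq_integral[OF lapl_integrable[OF w]]) (simp add: lapl_nonneg)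
    also have "(\<integral>\<^sup>+z. indicator B z * ennreal (exp (- w z)) \<partial>Y) * ennreal (\<integral>\<mu>. lapl w \<mu> \<partial>P) =
        (\<integral>\<^sup>+\<mu>. emeasure \<mu> B * ennreal (lapl w \<mu>) \<partial>P)"
      by (simp add: lapl_emeasure[OF B fin w] mult.commute)
    also have "\<dots> = (\<integral>\<^sup>+\<mu>. ennreal (lapl w \<mu>) \<partial>m)"
      by (rule m_int[symmetric]) measurable
    finally show ?thesis .
  qed
  have sm: "sets m = sets N" "sets m' = sets N" by (simp_all add: m_def m'_def sets_P)
  have fm': "finite_measure m'"
    unfolding m'_def by (intro finite_measure.finite_measure_distr finite_measure_pair_measure ap) unfold_locales
  \<comment> \<open>At \<open>w = 0\<close> the comparison equates total masses, so \<open>m\<close>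
    inherits finiteness from \<open>m'\<close>; this is the finiteness of the mean of
    \<open>\<mu>(B)\<close>.\<close>
  have l0: "(\<lambda>\<mu>. lapl (\<lambda>_. 0) \<mu>) = (\<lambda>_. 1)" by (simp add: lapl_def fun_eq_iff)
  have fm: "finite_measure m"
  proof
    have "emeasure m (space m) = emeasure m' (space m')"
      using lap_m'[OF step_fun_zero] by (simp add: l0)
    then show "emeasure m (space m) \<noteq> \<infinity>"
      using finite_measure.emeasure_finite[OF fm'] by simp
  qed
  have "m = m'"
  proof (rule measure_eqI_lapl[OF Y.sigma_finite_measure_axioms fm fm' sm])
    fix w assume w: "step_fun Y w"
    have [measurable]: "lapl w \<in> borel_measurable m" "lapl w \<in> borel_measurable m'"
      using lapl_measurable[OF w] measurable_cong_sets[OF sm(1) refl] measurable_cong_sets[OF sm(2) refl] by auto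
    show "(\<integral>\<mu>. lapl w \<mu> \<partial>m) = (\<integral>\<mu>. lapl w \<mu> \<partial>m')"
      by (subst (1 2) integral_eq_nn_integral) (auto simp: lapl_nonneg lap_m'[OF w])
  qed
  then show ?thesis using m_int[OF h] m'_int[OF h] by simp
qed

end

section \<open>Iterated difference operators\<close>

lemma iter_diff_measurable:
  assumes "f \<in> borel_measurable (counting_measure_space Y)"
  shows "(\<lambda>(y, \<mu>). iter_diff n y f \<mu>) \<in>
    borel_measurable (product_measure n Y \<Otimes>\<^sub>M counting_measure_space Y)"
proof (induction n)
  case 0
  show ?case using assms by (simp add: split_beta')
next
  case (Suc n)
  let ?M = "product_measure (Suc n) Y \<Otimes>\<^sub>M counting_measure_space Y"
  have sh: "(\<lambda>x i. fst x (Suc i)) \<in> measurable ?M (product_measure n Y)"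
  proof (rule measurable_PiM_single')
    show "(\<lambda>x. fst x (Suc i)) \<in> measurable ?M Y" if "i \<in> {..<n}" for i
      using that by (intro measurable_compose[OF measurable_fst measurable_component_singleton]) auto
    show "(\<lambda>x i. fst x (Suc i)) \<in> space ?M \<rightarrow> {..<n} \<rightarrow>\<^sub>E space Y"
    proof
      fix x assume "x \<in> space ?M"
      then have "fst x \<in> {..<Suc n} \<rightarrow>\<^sub>E space Y" by (simp add: space_pair_measure space_PiM mem_Times_iff)
      then show "(\<lambda>i. fst x (Suc i)) \<in> {..<n} \<rightarrow>\<^sub>E space Y"
        by (intro PiE_I) (auto dest: PiE_mem PiE_arb)
    qed
  qed
  have y0: "(\<lambda>x. fst x 0) \<in> measurable ?M Y"
    by (intro measurable_compose[OF measurable_fst measurable_component_singleton]) auto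
  have ap: "(\<lambda>x. add_point (snd x) (fst x 0)) \<in> measurable ?M (counting_measure_space Y)"
    using measurable_compose[OF measurable_Pair[OF measurable_snd y0] measurable_add_return] by simp
  have "(\<lambda>x. iter_diff n (\<lambda>i. fst x (Suc i)) f (add_point (snd x) (fst x 0)) - iter_diff n (\<lambda>i. fst x (Suc i)) f (snd x))
      \<in> borel_measurable ?M"
    using measurable_compose[OF measurable_Pair[OF sh ap] Suc]
      measurable_compose[OF measurable_Pair[OF sh measurable_snd] Suc]
    by (intro borel_measurable_diff) simp_all
  then show ?case by (simp add: split_beta' diff_op_def)
qed

text \<open>The definition peels off the outermost operator, at the point \<open>y 0\<close>. Here
  the innermost one is peeled off, at the last point, in accordance with
  \<open>{..<Suc n} = insert n {..<n}\<close> for product measures. Inductions on \<open>n\<close>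
  can thus replace \<open>f\<close> by \<open>diff_op z f\<close> and integrate over
  \<open>z\<close>.\<close>

lemma iter_diff_Suc_last: "iter_diff (Suc n) (y(n := z)) f = iter_diff n y (diff_op z f)"
proof (induction n arbitrary: y)
  case (Suc n)
  have "(\<lambda>i. (y(Suc n := z)) (Suc i)) = (\<lambda>i. y (Suc i))(n := z)" by (auto simp: fun_eq_iff)
  then have "iter_diff (Suc (Suc n)) (y(Suc n := z)) f =
      diff_op (y 0) (iter_diff (Suc n) ((\<lambda>i. y (Suc i))(n := z)) f)"
    by simp
  also have "\<dots> = iter_diff (Suc n) y (diff_op z f)"
    unfolding Suc.IH by simp
  finally show ?case .
qed simp

lemma iter_diff_diff: "iter_diff n y (\<lambda>\<mu>. f \<mu> - g \<mu>) \<mu> = iter_diff n y f \<mu> - iter_diff n y g \<mu>"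
  by (induction n arbitrary: y \<mu>) (simp_all add: diff_op_def)

lemma iter_diff_add: "iter_diff n y (\<lambda>\<mu>. f \<mu> + g \<mu>) \<mu> = iter_diff n y f \<mu> + iter_diff n y g \<mu>"
  by (induction n arbitrary: y \<mu>) (simp_all add: diff_op_def)

lemma iter_diff_scale: "iter_diff n y (\<lambda>\<mu>. c * f \<mu>) \<mu> = c * iter_diff n y f \<mu>"
  by (induction n arbitrary: y \<mu>) (simp_all add: diff_op_def algebra_simps)

lemma ennreal_add_power_le: "(x + y) ^ n \<le> 2 ^ n * (x ^ n + y ^ n)" for x y :: ennreal
proof -
  have *: "(x + y) ^ n \<le> 2 ^ n * (x ^ n + y ^ n)" if "x \<le> y" for x y :: ennreal
  proof -
    have "(x + y) ^ n \<le> (2 * y) ^ n"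
      using that by (intro power_mono) (auto simp: mult_2 intro: add_mono)
    also have "\<dots> \<le> 2 ^ n * (x ^ n + y ^ n)"
      by (simp add: power_mult_distrib mult_left_mono)
    finally show ?thesis .
  qed
  show ?thesis
    using *[of x y] *[of y x] by (cases "x \<le> y") (auto simp: add.commute)
qed

section \<open>Bounds for iterated differences over boxes, and the kernels
  \<open>T n f\<close>\<close>

context poisson_space
begin

sublocale PF: product_sigma_finite "\<lambda>_::nat. Y" ..

sublocale Pi: sigma_finite_measure "product_measure n Y" for n
  by (rule PF.sigma_finite) simp

sublocale PiP: pair_sigma_finite "product_measure n Y" P for n ..

lemma iter_diff_measurable_pair [measurable]:
  assumes "f \<in> borel_measurable N"
  shows "(\<lambda>(y, \<mu>). iter_diff n y f \<mu>) \<in> borel_measurable (product_measure n Y \<Otimes>\<^sub>M P)"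
  using iter_diff_measurable[OF assms, of n]
  by (simp add: measurable_cong_sets[OF sets_pair_measure_cong[OF refl sets_P] refl])

lemma iter_diff_measurable_snd:
  assumes "f \<in> borel_measurable N" "y \<in> space (product_measure n Y)"
  shows "iter_diff n y f \<in> borel_measurable N"
  using measurable_compose[OF measurable_Pair1'[OF assms(2)] iter_diff_measurable[OF assms(1)]] by simp

lemma diff_op_measurable:
  assumes "f \<in> borel_measurable N" "z \<in> space Y"
  shows "diff_op z f \<in> borel_measurable N"
proof -
  have "(\<lambda>\<mu>. add_point \<mu> z) \<in> measurable N N"
    using measurable_compose[OF measurable_Pair2'[OF assms(2)] measurable_add_return] by simp
  from measurable_compose[OF this assms(1)] assms(1) show ?thesis
    unfolding diff_op_def[abs_def] by (intro borel_measurable_diff) 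
qed

lemma nn_integral_product_Suc:
  assumes "G \<in> borel_measurable (product_measure (Suc n) Y)"
  shows "(\<integral>\<^sup>+y. G y \<partial>product_measure (Suc n) Y) =
    (\<integral>\<^sup>+z. (\<integral>\<^sup>+y. G (y(n := z)) \<partial>product_measure n Y) \<partial>Y)"
  using assms PF.product_nn_integral_insert_rev[of "{..<n}" n G] by (simp add: lessThan_Suc)

text \<open>The \<open>L^1\<close> norm of \<open>D^n h\<close> over \<open>B^n\<close> and
  \<open>P\<close>. First powers are used because Cauchy-Schwarz can absorb the weights
  \<open>\<mu>(B)\<close> produced by the Mecke equation only at the price of one power.\<close>

definition box_norm :: "nat \<Rightarrow> ('y measure \<Rightarrow> real) \<Rightarrow> 'y set \<Rightarrow> ennreal" where
  "box_norm n h B =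
    (\<integral>\<^sup>+y. (\<Prod>l<n. indicator B (y l)) * (\<integral>\<^sup>+\<mu>. ennreal \<bar>iter_diff n y h \<mu>\<bar> \<partial>P) \<partial>product_measure n Y)"

lemma box_norm_integrand_measurable [measurable]:
  assumes [measurable]: "h \<in> borel_measurable N" "B \<in> sets Y"
  shows "(\<lambda>y. (\<Prod>l<n. indicator B (y l)) * (\<integral>\<^sup>+\<mu>. ennreal \<bar>iter_diff n y h \<mu>\<bar> \<partial>P) :: ennreal)
    \<in> borel_measurable (product_measure n Y)"
  by measurable

lemma box_norm_Suc:
  assumes h: "h \<in> borel_measurable N" and B: "B \<in> sets Y"
  shows "box_norm (Suc n) h B = (\<integral>\<^sup>+z. indicator B z * box_norm n (diff_op z h) B \<partial>Y)"
proof -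
  have "box_norm (Suc n) h B = (\<integral>\<^sup>+z. \<integral>\<^sup>+y. (\<Prod>l<Suc n. indicator B ((y(n := z)) l)) *
      (\<integral>\<^sup>+\<mu>. ennreal \<bar>iter_diff n y (diff_op z h) \<mu>\<bar> \<partial>P) \<partial>product_measure n Y \<partial>Y)"
    unfolding box_norm_def
    by (subst nn_integral_product_Suc[OF box_norm_integrand_measurable[OF assms]])
      (simp only: iter_diff_Suc_last)
  also have "\<dots> = (\<integral>\<^sup>+z. indicator B z * box_norm n (diff_op z h) B \<partial>Y)"
  proof (rule nn_integral_cong)
    fix z assume z: "z \<in> space Y"
    show "(\<integral>\<^sup>+y. (\<Prod>l<Suc n. indicator B ((y(n := z)) l)) *
        (\<integral>\<^sup>+\<mu>. ennreal \<bar>iter_diff n y (diff_op z h) \<mu>\<bar> \<partial>P) \<partial>product_measure n Y) =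
        indicator B z * box_norm n (diff_op z h) B"
      unfolding box_norm_def
      by (subst nn_integral_cmult[symmetric, OF box_norm_integrand_measurable[OF diff_op_measurable[OF h z] B]])
        (simp add: mult_ac)
  qed
  finally show ?thesis .
qed

text \<open>
  Each application of \<open>D\<close> costs one factor: \<open>\<mu>(B)\<close> for the shifted term, by the Mecke equation, and
  \<open>\<lambda>(B)\<close> for the other one.
\<close>

lemma box_norm_le:
  assumes h: "h \<in> borel_measurable N" and B: "B \<in> sets Y" and fin: "emeasure Y B < \<infinity>"
  shows "box_norm n h B \<le> (\<integral>\<^sup>+\<mu>. ennreal \<bar>h \<mu>\<bar> * (emeasure \<mu> B + emeasure Y B) ^ n \<partial>P)"
  using h
proof (induction n arbitrary: h)
  case 0
  then show ?case by (simp add: box_norm_def PF.nn_integral_empty del: nn_integral_const)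
next
  case (Suc n)
  note h [measurable] = \<open>h \<in> borel_measurable N\<close>
  note [measurable] = B
  define q where "q \<mu> = (emeasure \<mu> B + emeasure Y B) ^ n" for \<mu>
  have [measurable]: "q \<in> borel_measurable N" unfolding q_def[abs_def] by measurable
  have [measurable]: "(\<lambda>(z, \<mu>). add_point \<mu> z) \<in> measurable (Y \<Otimes>\<^sub>M P) N"
    using measurable_compose[OF measurable_pair_swap' measurable_add_point] by (simp add: split_beta')
  have "box_norm (Suc n) h B = (\<integral>\<^sup>+z. indicator B z * box_norm n (diff_op z h) B \<partial>Y)"
    by (rule box_norm_Suc[OF h B])
  also have "\<dots> \<le> (\<integral>\<^sup>+z. indicator B z * (\<integral>\<^sup>+\<mu>. ennreal \<bar>diff_op z h \<mu>\<bar> * q \<mu> \<partial>P) \<partial>Y)"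
    unfolding q_def by (intro nn_integral_mono mult_left_mono Suc.IH diff_op_measurable h) auto
  also have "\<dots> \<le> (\<integral>\<^sup>+z. indicator B z * (\<integral>\<^sup>+\<mu>. ennreal \<bar>h (add_point \<mu> z)\<bar> * q (add_point \<mu> z) + ennreal \<bar>h \<mu>\<bar> * q \<mu> \<partial>P) \<partial>Y)"
  proof (intro nn_integral_mono mult_left_mono)
    fix z \<mu> assume "z \<in> space Y" "\<mu> \<in> space P"
    then have "sets \<mu> = sets Y" by (intro counting_measureD) (simp add: space_P)
    \<comment> \<open>The weight is moved to the shifted configuration, so that the whole first term
      depends on \<open>add_point \<mu> z\<close> alone, as the Mecke equation requires.\<close>
    then have "q \<mu> \<le> q (add_point \<mu> z)"
      unfolding q_def by (intro power_mono add_mono) (auto simp: emeasure_add_measure)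
    have "ennreal \<bar>diff_op z h \<mu>\<bar> \<le> ennreal \<bar>h (add_point \<mu> z)\<bar> + ennreal \<bar>h \<mu>\<bar>"
      unfolding diff_op_def
      by (subst ennreal_plus[symmetric]) (auto intro!: ennreal_leI abs_triangle_ineq4 simp del: ennreal_plus)
    then have "ennreal \<bar>diff_op z h \<mu>\<bar> * q \<mu> \<le> ennreal \<bar>h (add_point \<mu> z)\<bar> * q \<mu> + ennreal \<bar>h \<mu>\<bar> * q \<mu>"
      by (simp add: distrib_right[symmetric] mult_right_mono)
    also have "\<dots> \<le> ennreal \<bar>h (add_point \<mu> z)\<bar> * q (add_point \<mu> z) + ennreal \<bar>h \<mu>\<bar> * q \<mu>"
      using \<open>q \<mu> \<le> q (add_point \<mu> z)\<close> by (intro add_right_mono mult_left_mono) auto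
    finally show "ennreal \<bar>diff_op z h \<mu>\<bar> * q \<mu> \<le> ennreal \<bar>h (add_point \<mu> z)\<bar> * q (add_point \<mu> z) + ennreal \<bar>h \<mu>\<bar> * q \<mu>" .
  qed auto
  also have "\<dots> = (\<integral>\<^sup>+z. indicator B z * (\<integral>\<^sup>+\<mu>. ennreal \<bar>h (add_point \<mu> z)\<bar> * q (add_point \<mu> z) \<partial>P) +
      indicator B z * (\<integral>\<^sup>+\<mu>. ennreal \<bar>h \<mu>\<bar> * q \<mu> \<partial>P) \<partial>Y)"
  proof (rule nn_integral_cong)
    fix z assume z: "z \<in> space Y"
    have [measurable]: "(\<lambda>\<mu>. add_point \<mu> z) \<in> measurable N N"
      using measurable_compose[OF measurable_Pair2'[OF z] measurable_add_return] by simp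
    show "indicator B z * (\<integral>\<^sup>+\<mu>. ennreal \<bar>h (add_point \<mu> z)\<bar> * q (add_point \<mu> z) + ennreal \<bar>h \<mu>\<bar> * q \<mu> \<partial>P) =
      indicator B z * (\<integral>\<^sup>+\<mu>. ennreal \<bar>h (add_point \<mu> z)\<bar> * q (add_point \<mu> z) \<partial>P) +
      indicator B z * (\<integral>\<^sup>+\<mu>. ennreal \<bar>h \<mu>\<bar> * q \<mu> \<partial>P)"
      by (subst nn_integral_add) (simp_all add: distrib_left)
  qed
  also have "\<dots> = (\<integral>\<^sup>+z. indicator B z * (\<integral>\<^sup>+\<mu>. ennreal \<bar>h (add_point \<mu> z)\<bar> * q (add_point \<mu> z) \<partial>P) \<partial>Y) +
      emeasure Y B * (\<integral>\<^sup>+\<mu>. ennreal \<bar>h \<mu>\<bar> * q \<mu> \<partial>P)"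
    by (subst nn_integral_add) (auto simp: nn_integral_multc)
  also have "\<dots> = (\<integral>\<^sup>+\<mu>. emeasure \<mu> B * (ennreal \<bar>h \<mu>\<bar> * q \<mu>) \<partial>P) + (\<integral>\<^sup>+\<mu>. emeasure Y B * (ennreal \<bar>h \<mu>\<bar> * q \<mu>) \<partial>P)"
    by (subst mecke[OF B fin]) (simp_all add: nn_integral_cmult)
  also have "\<dots> = (\<integral>\<^sup>+\<mu>. ennreal \<bar>h \<mu>\<bar> * (emeasure \<mu> B + emeasure Y B) ^ Suc n \<partial>P)"
    by (subst nn_integral_add[symmetric]) (auto simp: q_def algebra_simps)
  finally show ?case .
qed

text \<open>The Mecke equation with \<open>h = \<mu>(B)^n\<close> trades one power for an integral
  over \<open>B\<close> of \<open>(\<mu>(B) + 1)^n\<close>, which is controlled by the moment of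
  order \<open>n\<close>.\<close>

lemma moments_finite:
  assumes B [measurable]: "B \<in> sets Y" and fin: "emeasure Y B < \<infinity>"
  shows "(\<integral>\<^sup>+\<mu>. emeasure \<mu> B ^ n \<partial>P) < \<infinity>"
proof (induction n)
  case 0
  then show ?case by (simp add: P.emeasure_space_1)
next
  case (Suc n)
  have "(\<integral>\<^sup>+\<mu>. emeasure \<mu> B ^ Suc n \<partial>P) =
      (\<integral>\<^sup>+z. indicator B z * (\<integral>\<^sup>+\<mu>. emeasure (add_point \<mu> z) B ^ n \<partial>P) \<partial>Y)"
    by (subst mecke[OF B fin]) simp_all
  also have "\<dots> \<le> (\<integral>\<^sup>+z. indicator B z * (\<integral>\<^sup>+\<mu>. 2 ^ n * (emeasure \<mu> B ^ n + 1) \<partial>P) \<partial>Y)"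
  proof (intro nn_integral_mono mult_left_mono)
    fix z \<mu> assume "z \<in> space Y" "\<mu> \<in> space P"
    then have s: "sets \<mu> = sets Y" by (intro counting_measureD) (simp add: space_P)
    have "emeasure (add_point \<mu> z) B ^ n \<le> (emeasure \<mu> B + 1) ^ n"
      using s by (intro power_mono) (auto simp: emeasure_add_measure indicator_def)
    also have "\<dots> \<le> 2 ^ n * (emeasure \<mu> B ^ n + 1)"
      using ennreal_add_power_le[of "emeasure \<mu> B" 1 n] by simp
    finally show "emeasure (add_point \<mu> z) B ^ n \<le> 2 ^ n * (emeasure \<mu> B ^ n + 1)" .
  qed auto
  also have "\<dots> = (2 ^ n * ((\<integral>\<^sup>+\<mu>. emeasure \<mu> B ^ n \<partial>P) + 1)) * emeasure Y B"
    by (simp add: nn_integral_cmult nn_integral_add nn_integral_multc P.emeasure_space_1 mult.commute)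
  also have "\<dots> < \<infinity>"
    using Suc fin by (auto simp: ennreal_mult_less_top power_less_top_ennreal)
  finally show ?case .
qed

text \<open>Cauchy-Schwarz applied to \<open>box_norm_le\<close>; \<open>w^2\<close> is the second
  moment of \<open>(\<mu>(B) + \<lambda>(B))^n\<close> and does not depend on \<open>h\<close>. So
  \<open>D^n\<close> is bounded from \<open>L^2(P)\<close> to \<open>L^1\<close> over each box. The
  separate bound \<open>c\<close> is later taken as \<open>0\<close>, as \<open>2^-j\<close>, or as
  the norm itself.\<close>

lemma box_norm_L2:
  assumes B [measurable]: "B \<in> sets Y" and fin: "emeasure Y B < \<infinity>"
  obtains w :: real where "0 \<le> w"
    "\<And>h c. h \<in> borel_measurable N \<Longrightarrow> 0 \<le> c \<Longrightarrow>
      (\<integral>\<^sup>+\<mu>. ennreal ((h \<mu>)\<^sup>2) \<partial>P) \<le> ennreal (c\<^sup>2) \<Longrightarrow> box_norm n h B \<le> ennreal (c * w)"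
proof -
  define W where "W = (\<integral>\<^sup>+\<mu>. ((emeasure \<mu> B + emeasure Y B) ^ n)\<^sup>2 \<partial>P)"
  have "W \<le> (\<integral>\<^sup>+\<mu>. 2 ^ (n * 2) * (emeasure \<mu> B ^ (n * 2) + emeasure Y B ^ (n * 2)) \<partial>P)"
    unfolding W_def power_mult[symmetric] by (intro nn_integral_mono ennreal_add_power_le)
  also have "\<dots> = 2 ^ (n * 2) * ((\<integral>\<^sup>+\<mu>. emeasure \<mu> B ^ (n * 2) \<partial>P) + emeasure Y B ^ (n * 2))"
    by (simp add: nn_integral_cmult nn_integral_add P.emeasure_space_1)
  also have "\<dots> < \<infinity>"
    using fin moments_finite[OF B fin, of "n * 2"] by (auto simp: ennreal_mult_less_top power_less_top_ennreal)
  finally obtain v where v: "0 \<le> v" "W = ennreal v" by (cases W) auto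
  show ?thesis
  proof
    show "0 \<le> sqrt v" using v by simp
    fix h :: "'y measure \<Rightarrow> real" and c :: real
    assume [measurable]: "h \<in> borel_measurable N" and c: "0 \<le> c" "(\<integral>\<^sup>+\<mu>. ennreal ((h \<mu>)\<^sup>2) \<partial>P) \<le> ennreal (c\<^sup>2)"
    define X where "X = (\<integral>\<^sup>+\<mu>. ennreal \<bar>h \<mu>\<bar> * (emeasure \<mu> B + emeasure Y B) ^ n \<partial>P)"
    have "X\<^sup>2 \<le> (\<integral>\<^sup>+\<mu>. (ennreal \<bar>h \<mu>\<bar>)\<^sup>2 \<partial>P) * W"
      unfolding X_def W_def by (rule Cauchy_Schwarz_nn_integral) simp_all
    also have "(\<integral>\<^sup>+\<mu>. (ennreal \<bar>h \<mu>\<bar>)\<^sup>2 \<partial>P) = (\<integral>\<^sup>+\<mu>. ennreal ((h \<mu>)\<^sup>2) \<partial>P)"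
      by (simp add: ennreal_power)
    also have "\<dots> * W \<le> ennreal (c\<^sup>2) * ennreal v"
      unfolding v using c by (intro mult_right_mono) auto
    also have "\<dots> = ennreal ((c * sqrt v)\<^sup>2)"
      using v by (simp add: ennreal_mult[symmetric] power_mult_distrib)
    finally have X: "X\<^sup>2 \<le> ennreal ((c * sqrt v)\<^sup>2)" .
    have "X \<le> ennreal (c * sqrt v)"
    proof (cases X)
      case (real x)
      with X have "x\<^sup>2 \<le> (c * sqrt v)\<^sup>2" by (simp add: ennreal_power)
      then have "x \<le> c * sqrt v" using c v by (simp add: power2_le_iff_abs_le)
      then show ?thesis using real by (simp add: ennreal_leI)
    qed (use X in \<open>auto simp: top_unique power2_eq_square\<close>)
    then show "box_norm n h B \<le> ennreal (c * sqrt v)"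
      using box_norm_le[of h B n] fin unfolding X_def by (intro order_trans[OF box_norm_le]) auto
  qed
qed

text \<open>The cubes over an increasing exhaustion \<open>C\<close> cover the product space: the
  \<open>n\<close> coordinates lie in finitely many members of \<open>C\<close>, hence all in the
  largest of these. Countably many cubes suffice.\<close>

lemma AE_product_boxI:
  assumes "\<And>B. B \<in> sets Y \<Longrightarrow> emeasure Y B < \<infinity> \<Longrightarrow> AE y in product_measure n Y. (\<forall>l<n. y l \<in> B) \<longrightarrow> Q y"
  shows "AE y in product_measure n Y. Q y"
proof -
  obtain C :: "nat \<Rightarrow> _" where C: "range C \<subseteq> sets Y" "(\<Union>i. C i) = space Y"
    "\<And>i. emeasure Y (C i) \<noteq> \<infinity>" "incseq C"
    using Y.sigma_finite_incseq by blast
  have "AE y in product_measure n Y. \<forall>i. (\<forall>l<n. y l \<in> C i) \<longrightarrow> Q y"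
    using C by (subst AE_all_countable) (auto intro!: assms simp: less_top)
  then show ?thesis
  proof (rule AE_mp, intro AE_I2 impI)
    fix y assume y: "y \<in> space (product_measure n Y)" and Q: "\<forall>i. (\<forall>l<n. y l \<in> C i) \<longrightarrow> Q y"
    have "\<forall>l\<in>{..<n}. \<exists>i. y l \<in> C i" using y C(2) by (auto simp: space_PiM PiE_iff)
    then obtain i where i: "\<And>l. l < n \<Longrightarrow> y l \<in> C (i l)" by (metis lessThan_iff)
    have "y l \<in> C (Max (i ` {..<n}))" if "l < n" for l
      using that by (intro subsetD[OF incseqD[OF C(4)] i] Max_ge) auto
    then show "Q y" using Q by blast
  qed
qed

lemma AE_iter_diff_integrable:
  assumes f [measurable]: "f \<in> borel_measurable N" and f2: "(\<integral>\<^sup>+\<mu>. ennreal ((f \<mu>)\<^sup>2) \<partial>P) < \<infinity>"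
  shows "AE y in product_measure n Y. integrable P (iter_diff n y f)"
proof (rule AE_product_boxI)
  fix B assume B [measurable]: "B \<in> sets Y" and fin: "emeasure Y B < \<infinity>"
  obtain c where c: "0 \<le> c" "(\<integral>\<^sup>+\<mu>. ennreal ((f \<mu>)\<^sup>2) \<partial>P) = ennreal c"
    using f2 by (cases "\<integral>\<^sup>+\<mu>. ennreal ((f \<mu>)\<^sup>2) \<partial>P") auto
  obtain w :: real where "box_norm n f B \<le> ennreal (sqrt c * w)"
    using box_norm_L2[OF B fin, of n] f c by (metis order_refl real_sqrt_ge_zero real_sqrt_pow2)
  then have "box_norm n f B \<noteq> \<infinity>" by (auto simp: top_unique)
  from nn_integral_PInf_AE[OF box_norm_integrand_measurable[OF f B] this[unfolded box_norm_def]]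
  show "AE y in product_measure n Y. (\<forall>l<n. y l \<in> B) \<longrightarrow> integrable P (iter_diff n y f)"
  proof (rule AE_mp, intro AE_I2 impI)
    fix y assume y: "y \<in> space (product_measure n Y)" "\<forall>l<n. y l \<in> B"
      "(\<Prod>l<n. indicator B (y l)) * (\<integral>\<^sup>+\<mu>. ennreal \<bar>iter_diff n y f \<mu>\<bar> \<partial>P) \<noteq> \<infinity>"
    then have "(\<integral>\<^sup>+\<mu>. ennreal \<bar>iter_diff n y f \<mu>\<bar> \<partial>P) < \<infinity>" by (simp add: less_top)
    then show "integrable P (iter_diff n y f)"
      using iter_diff_measurable_snd[OF f y(1)] by (intro integrableI_bounded) auto
  qed
qed

text \<open>Where \<open>iter_diff n y f\<close> is not integrable the value is \<open>0\<close> by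
  convention. For square integrable \<open>f\<close> this concerns only a null set of
  \<open>y\<close>, so additivity holds almost everywhere; on the exponentials it holds at every
  \<open>y\<close>.\<close>

definition T :: "nat \<Rightarrow> ('y measure \<Rightarrow> real) \<Rightarrow> (nat \<Rightarrow> 'y) \<Rightarrow> real" where
  "T n f y = (\<integral>\<mu>. iter_diff n y f \<mu> \<partial>P)"

lemma T_measurable [measurable]:
  assumes [measurable]: "f \<in> borel_measurable N"
  shows "T n f \<in> borel_measurable (product_measure n Y)"
  unfolding T_def[abs_def] by measurable

lemma AE_T_diff:
  assumes "f \<in> borel_measurable N" "(\<integral>\<^sup>+\<mu>. ennreal ((f \<mu>)\<^sup>2) \<partial>P) < \<infinity>"
    and "g \<in> borel_measurable N" "(\<integral>\<^sup>+\<mu>. ennreal ((g \<mu>)\<^sup>2) \<partial>P) < \<infinity>"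
  shows "AE y in product_measure n Y. T n (\<lambda>\<mu>. f \<mu> - g \<mu>) y = T n f y - T n g y"
  using AE_iter_diff_integrable[OF assms(1,2), of n] AE_iter_diff_integrable[OF assms(3,4), of n]
  by eventually_elim (simp add: T_def iter_diff_diff)

text \<open>The geometric rate makes the box norms of the errors summable. Their sum is therefore
  finite for almost every \<open>y\<close> in the box, so the errors tend to zero there without
  passing to a subsequence.\<close>

lemma T_convergence:
  assumes f [measurable]: "f \<in> borel_measurable N" and f2: "(\<integral>\<^sup>+\<mu>. ennreal ((f \<mu>)\<^sup>2) \<partial>P) < \<infinity>"
    and g [measurable]: "\<And>j. g j \<in> borel_measurable N" and g2: "\<And>j. (\<integral>\<^sup>+\<mu>. ennreal ((g j \<mu>)\<^sup>2) \<partial>P) < \<infinity>"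
    and lim: "\<And>j. (\<integral>\<^sup>+\<mu>. ennreal ((g j \<mu> - f \<mu>)\<^sup>2) \<partial>P) \<le> ennreal (((1 / 2) ^ j)\<^sup>2)"
  shows "AE y in product_measure n Y. (\<lambda>j. T n (g j) y) \<longlonglongrightarrow> T n f y"
proof (rule AE_product_boxI)
  fix B assume B [measurable]: "B \<in> sets Y" and fin: "emeasure Y B < \<infinity>"
  define d where "d j \<mu> = g j \<mu> - f \<mu>" for j \<mu>
  have d [measurable]: "d j \<in> borel_measurable N" for j unfolding d_def[abs_def] by measurable
  obtain w :: real where w: "0 \<le> w" "\<And>j. box_norm n (d j) B \<le> ennreal ((1 / 2) ^ j * w)"
    using box_norm_L2[OF B fin, of n] d lim unfolding d_def[symmetric]
    by (metis zero_le_divide_1_iff zero_le_numeral zero_le_power)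
  define H where "H j y = (\<Prod>l<n. indicator B (y l)) * (\<integral>\<^sup>+\<mu>. ennreal \<bar>iter_diff n y (d j) \<mu>\<bar> \<partial>P)" for j y
  have [measurable]: "H j \<in> borel_measurable (product_measure n Y)" for j
    unfolding H_def[abs_def] by (rule box_norm_integrand_measurable[OF d B])
  have "(\<integral>\<^sup>+y. (\<Sum>j. H j y) \<partial>product_measure n Y) = (\<Sum>j. box_norm n (d j) B)"
    unfolding box_norm_def H_def[symmetric] by (rule nn_integral_suminf) simp
  also have "\<dots> \<le> (\<Sum>j. ennreal ((1 / 2) ^ j * w))"
    by (intro suminf_le w(2)) auto
  also have "\<dots> = ennreal (\<Sum>j. (1 / 2) ^ j * w)"
    using w(1) by (intro suminf_ennreal2 summable_mult2 summable_geometric) auto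
  finally have "(\<integral>\<^sup>+y. (\<Sum>j. H j y) \<partial>product_measure n Y) \<noteq> \<infinity>" by (auto simp: top_unique)
  then have "AE y in product_measure n Y. (\<Sum>j. H j y) \<noteq> \<infinity>"
    by (rule nn_integral_PInf_AE[rotated]) measurable
  moreover have "AE y in product_measure n Y. \<forall>j. T n (d j) y = T n (g j) y - T n f y"
    unfolding d_def by (subst AE_all_countable) (auto intro!: AE_T_diff f f2 g g2)
  moreover have "AE y in product_measure n Y. \<forall>j. integrable P (iter_diff n y (d j))"
    unfolding AE_all_countable
  proof
    fix j
    show "AE y in product_measure n Y. integrable P (iter_diff n y (d j))"
    proof (rule AE_iter_diff_integrable[OF d])
      show "(\<integral>\<^sup>+\<mu>. ennreal ((d j \<mu>)\<^sup>2) \<partial>P) < \<infinity>"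
        using lim[of j] unfolding d_def by (auto intro: le_less_trans)
    qed
  qed
  ultimately show "AE y in product_measure n Y. (\<forall>l<n. y l \<in> B) \<longrightarrow> (\<lambda>j. T n (g j) y) \<longlonglongrightarrow> T n f y"
  proof (eventually_elim, intro impI)
    fix y assume sum: "(\<Sum>j. H j y) \<noteq> \<infinity>" and T: "\<forall>j. T n (d j) y = T n (g j) y - T n f y"
      and int: "\<forall>j. integrable P (iter_diff n y (d j))" and y: "\<forall>l<n. y l \<in> B"
    define r where "r j = (\<integral>\<mu>. \<bar>iter_diff n y (d j) \<mu>\<bar> \<partial>P)" for j
    have H: "H j y = ennreal (r j)" for j
      using y int by (simp add: H_def r_def nn_integral_eq_integral)
    have "summable r"
      using sum unfolding H by (intro summable_suminf_not_top) (auto simp: r_def)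
    then have "r \<longlonglongrightarrow> 0" by (rule summable_LIMSEQ_zero)
    moreover have "\<bar>T n (d j) y\<bar> \<le> r j" for j
      unfolding T_def r_def by (rule integral_abs_bound)
    ultimately have "(\<lambda>j. T n (d j) y) \<longlonglongrightarrow> 0"
      by (intro Lim_null_comparison[of "\<lambda>j. T n (d j) y" r]) auto
    then show "(\<lambda>j. T n (g j) y) \<longlonglongrightarrow> T n f y"
      unfolding T[rule_format] by (simp add: LIM_zero_iff)
  qed
qed

end

section \<open>The Fock space representation\<close>

text \<open>Pointwise this is \<open>2 a b \<le> e a^2 + b^2 / e\<close>. Unlike the factor 2 in
  \<open>nn_integral_sq_add_le\<close>, the factor \<open>1 + e\<close> tends to 1, so exact limits
  of squared norms can be obtained.\<close>

lemma nn_integral_sq_eps_le: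
  fixes u v d :: "'a \<Rightarrow> real"
  assumes [measurable]: "u \<in> borel_measurable M" "v \<in> borel_measurable M" "d \<in> borel_measurable M"
    and uv: "AE x in M. u x = v x + d x" and e: "0 < e"
  shows "(\<integral>\<^sup>+x. ennreal ((u x)\<^sup>2) \<partial>M) \<le>
    ennreal (1 + e) * (\<integral>\<^sup>+x. ennreal ((v x)\<^sup>2) \<partial>M) + ennreal (1 + 1 / e) * (\<integral>\<^sup>+x. ennreal ((d x)\<^sup>2) \<partial>M)"
proof -
  have *: "(a + b)\<^sup>2 \<le> (1 + e) * a\<^sup>2 + (1 + 1 / e) * b\<^sup>2" for a b :: real
  proof -
    have "0 \<le> (e * a - b)\<^sup>2 / e" using e by simp
    also have "\<dots> = (1 + e) * a\<^sup>2 + (1 + 1 / e) * b\<^sup>2 - (a + b)\<^sup>2"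
      using e by (simp add: field_simps power2_eq_square)
    finally show ?thesis by simp
  qed
  have "(\<integral>\<^sup>+x. ennreal ((u x)\<^sup>2) \<partial>M) \<le>
      (\<integral>\<^sup>+x. ennreal (1 + e) * ennreal ((v x)\<^sup>2) + ennreal (1 + 1 / e) * ennreal ((d x)\<^sup>2) \<partial>M)"
    using uv
  proof (intro nn_integral_mono_AE, eventually_elim)
    case (elim x)
    have "ennreal ((u x)\<^sup>2) \<le> ennreal ((1 + e) * (v x)\<^sup>2 + (1 + 1 / e) * (d x)\<^sup>2)"
      unfolding elim by (intro ennreal_leI *)
    also have "\<dots> = ennreal (1 + e) * ennreal ((v x)\<^sup>2) + ennreal (1 + 1 / e) * ennreal ((d x)\<^sup>2)"
      using e by (subst ennreal_plus) (auto simp: ennreal_mult)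
    finally show ?case .
  qed
  also have "\<dots> = ennreal (1 + e) * (\<integral>\<^sup>+x. ennreal ((v x)\<^sup>2) \<partial>M) + ennreal (1 + 1 / e) * (\<integral>\<^sup>+x. ennreal ((d x)\<^sup>2) \<partial>M)"
    by (simp add: nn_integral_add nn_integral_cmult)
  finally show ?thesis .
qed

text \<open>Exponentials are eigenfunctions of every \<open>D_z\<close>, with eigenvalue
  \<open>exp (- w z) - 1\<close>.\<close>

lemma iter_diff_lapl:
  assumes "step_fun Y w" "\<mu> \<in> space (counting_measure_space Y)" "\<And>l. l < n \<Longrightarrow> y l \<in> space Y"
  shows "iter_diff n y (lapl w) \<mu> = (\<Prod>l<n. exp (- w (y l)) - 1) * lapl w \<mu>"
  using assms(2,3)
proof (induction n arbitrary: y \<mu>)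
  case (Suc n)
  have "add_point \<mu> (y 0) \<in> space (counting_measure_space Y)"
    using Suc.prems by (intro add_return_in_counting) auto
  then show ?case
    using Suc.prems
    by (simp add: diff_op_def Suc.IH lapl_add_return[OF assms(1)] prod.lessThan_Suc_shift algebra_simps
        del: prod.lessThan_Suc)
qed simp

text \<open>
  With \<open>e = 2\<^sup>-\<^sup>j\<close> the error term \<open>(1 + 1 / e) d\<^sub>j\<close> is still \<open>O(2\<^sup>-\<^sup>j)\<close>; this replaces the triangle inequality.
\<close>

lemma eps_limit:
  fixes x :: ennreal and z d :: "nat \<Rightarrow> ennreal"
  assumes x: "x < \<infinity>" and z: "\<And>j. z j < \<infinity>"
    and d: "\<And>j. d j \<le> ennreal (2 * ((1 / 2) ^ j)\<^sup>2)"
    and zx: "\<And>j e. 0 < e \<Longrightarrow> z j \<le> ennreal (1 + e) * x + ennreal (1 + 1 / e) * d j"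
    and xz: "\<And>j e. 0 < e \<Longrightarrow> x \<le> ennreal (1 + e) * z j + ennreal (1 + 1 / e) * d j"
  shows "(\<lambda>j. enn2real (z j)) \<longlonglongrightarrow> enn2real x"
proof -
  define b where "b j = (1 + 1 / (1 / 2) ^ j) * (2 * ((1 / 2) ^ j)\<^sup>2 :: real)" for j :: nat
  have real_le: "enn2real u \<le> (1 + (1 / 2) ^ j) * enn2real v + b j"
    if "v < \<infinity>" "u \<le> ennreal (1 + (1 / 2) ^ j) * v + ennreal (1 + 1 / (1 / 2) ^ j) * d j" for u v :: ennreal and j
  proof -
    have "u \<le> ennreal (1 + (1 / 2) ^ j) * v + ennreal (1 + 1 / (1 / 2) ^ j) * ennreal (2 * ((1 / 2) ^ j)\<^sup>2)"
      by (rule order_trans[OF that(2)]) (intro add_left_mono mult_left_mono d, auto)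
    also have "ennreal (1 + 1 / (1 / 2) ^ j) * ennreal (2 * ((1 / 2) ^ j)\<^sup>2) = ennreal (b j)"
      unfolding b_def by (subst ennreal_mult) auto
    also have "v = ennreal (enn2real v)"
      using that(1) by simp
    also have "ennreal (1 + (1 / 2) ^ j) * ennreal (enn2real v) + ennreal (b j) =
        ennreal ((1 + (1 / 2) ^ j) * enn2real v + b j)"
    proof -
      have nn: "0 \<le> 1 + (1 / 2 :: real) ^ j" "0 \<le> b j" by (auto simp: b_def)
      show ?thesis
        by (simp only: ennreal_plus[OF mult_nonneg_nonneg[OF nn(1) enn2real_nonneg] nn(2)]
            ennreal_mult[OF nn(1) enn2real_nonneg])
    qed
    finally show ?thesis
      by (intro enn2real_leI) (auto simp: b_def intro!: add_nonneg_nonneg mult_nonneg_nonneg)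
  qed
  have up: "enn2real (z j) \<le> (1 + (1 / 2) ^ j) * enn2real x + b j" for j
    using x zx by (intro real_le) auto
  have lo: "(enn2real x - b j) / (1 + (1 / 2) ^ j) \<le> enn2real (z j)" for j
  proof -
    have "enn2real x \<le> (1 + (1 / 2) ^ j) * enn2real (z j) + b j"
      using z xz by (intro real_le) auto
    moreover have "0 < 1 + (1 / 2 :: real) ^ j" by (intro add_pos_pos) auto
    ultimately show ?thesis by (simp add: divide_le_eq mult.commute)
  qed
  have b: "b \<longlonglongrightarrow> 0" unfolding b_def[abs_def] by real_asymp
  have p: "(\<lambda>j. 1 + (1 / 2) ^ j :: real) \<longlonglongrightarrow> 1" by real_asymp
  show ?thesis
  proof (rule tendsto_sandwich[OF always_eventually always_eventually])
    show "\<forall>j. (enn2real x - b j) / (1 + (1 / 2) ^ j) \<le> enn2real (z j)" using lo by auto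
    show "\<forall>j. enn2real (z j) \<le> (1 + (1 / 2) ^ j) * enn2real x + b j" using up by auto
    show "(\<lambda>j. (enn2real x - b j) / (1 + (1 / 2) ^ j)) \<longlonglongrightarrow> enn2real x"
      using tendsto_divide[OF tendsto_diff[OF tendsto_const b] p] by simp
    show "(\<lambda>j. (1 + (1 / 2) ^ j) * enn2real x + b j) \<longlonglongrightarrow> enn2real x"
      using tendsto_add[OF tendsto_mult[OF p tendsto_const] b] by simp
  qed
qed

section \<open>The isometry on the span and its extension to \<open>L^2\<close>\<close>

context poisson_space
begin

lemma span_measurable [measurable]: "g \<in> lapl_span Y \<Longrightarrow> g \<in> borel_measurable N"
  by (rule lapl_span_measurable)

lemma span_bounded_integrable:
  assumes g: "g \<in> lapl_span Y" and h: "h \<in> lapl_span Y"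
  shows "integrable P (\<lambda>\<mu>. g \<mu> * h \<mu>)"
proof -
  obtain K L where K: "\<And>\<mu>. \<bar>g \<mu>\<bar> \<le> K" and L: "\<And>\<mu>. \<bar>h \<mu>\<bar> \<le> L"
    using lapl_span_bounded[OF g] lapl_span_bounded[OF h] by auto
  have "\<bar>g \<mu> * h \<mu>\<bar> \<le> K * L" for \<mu>
    unfolding abs_mult using K[of \<mu>] by (intro mult_mono K L) auto
  moreover have "(\<lambda>\<mu>. g \<mu> * h \<mu>) \<in> borel_measurable N"
    using span_measurable[OF g] span_measurable[OF h] by measurable
  ultimately show ?thesis
    by (intro P.integrable_const_bound[where B="K * L"]) auto
qed

lemma span_L2: "g \<in> lapl_span Y \<Longrightarrow> (\<integral>\<^sup>+\<mu>. ennreal ((g \<mu>)\<^sup>2) \<partial>P) < \<infinity>"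
  using span_bounded_integrable[of g g] by (simp add: power2_eq_square integrable_iff_bounded)

lemma span_iter_diff_integrable:
  assumes g: "g \<in> lapl_span Y" and y: "y \<in> space (product_measure n Y)"
  shows "integrable P (iter_diff n y g)"
  using g
proof (induction rule: lapl_span.induct)
  case (lapl w)
  have "integrable P (\<lambda>\<mu>. (\<Prod>l<n. exp (- w (y l)) - 1) * lapl w \<mu>)"
    using lapl_integrable[OF lapl] by simp
  also have "?this \<longleftrightarrow> ?case"
    using y by (intro Bochner_Integration.integrable_cong)
      (auto simp: space_P iter_diff_lapl[OF lapl] space_PiM PiE_iff)
  finally show ?case .
qed (auto simp: iter_diff_scale iter_diff_add)

lemma T_scale: "T n (\<lambda>\<mu>. c * f \<mu>) y = c * T n f y"
  by (simp add: T_def iter_diff_scale)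

lemma T_add:
  assumes "g \<in> lapl_span Y" "h \<in> lapl_span Y" "y \<in> space (product_measure n Y)"
  shows "T n (\<lambda>\<mu>. g \<mu> + h \<mu>) y = T n g y + T n h y"
  using span_iter_diff_integrable[OF assms(1,3)] span_iter_diff_integrable[OF assms(2,3)]
  by (simp add: T_def iter_diff_add)

lemma T_lapl:
  assumes "step_fun Y w" "y \<in> space (product_measure n Y)"
  shows "T n (lapl w) y = (\<integral>\<mu>. lapl w \<mu> \<partial>P) * (\<Prod>l<n. exp (- w (y l)) - 1)"
proof -
  have "T n (lapl w) y = (\<integral>\<mu>. (\<Prod>l<n. exp (- w (y l)) - 1) * lapl w \<mu> \<partial>P)"
    unfolding T_def using assms
    by (intro Bochner_Integration.integral_cong) (auto simp: space_P iter_diff_lapl space_PiM PiE_iff)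
  then show ?thesis by simp
qed

text \<open>The polarised form of the isometry: being bilinear, it passes from pairs of exponentials
  to their span by induction, which the quadratic form would not do. Integrability is carried along
  to split integrals of sums.\<close>

definition fock_iso :: "('y measure \<Rightarrow> real) \<Rightarrow> ('y measure \<Rightarrow> real) \<Rightarrow> bool" where
  "fock_iso g h \<longleftrightarrow> (\<forall>n. integrable (product_measure n Y) (\<lambda>y. T n g y * T n h y)) \<and>
    (\<lambda>n. (\<integral>y. T n g y * T n h y \<partial>product_measure n Y) / fact n) sums (\<integral>\<mu>. g \<mu> * h \<mu> \<partial>P)"

lemma fock_iso_commute: "fock_iso g h \<longleftrightarrow> fock_iso h g"
  by (simp add: fock_iso_def mult.commute)

lemma fock_iso_scale:
  assumes "fock_iso g h" shows "fock_iso (\<lambda>\<mu>. c * g \<mu>) h"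
proof -
  have "(\<lambda>n. c * ((\<integral>y. T n g y * T n h y \<partial>product_measure n Y) / fact n)) sums (c * (\<integral>\<mu>. g \<mu> * h \<mu> \<partial>P))"
    using assms by (intro sums_mult) (simp add: fock_iso_def)
  then show ?thesis
    using assms by (simp add: fock_iso_def T_scale mult.assoc)
qed

lemma fock_iso_add:
  assumes "fock_iso g1 h" "fock_iso g2 h" "g1 \<in> lapl_span Y" "g2 \<in> lapl_span Y" "h \<in> lapl_span Y"
  shows "fock_iso (\<lambda>\<mu>. g1 \<mu> + g2 \<mu>) h"
proof -
  let ?I = "\<lambda>g n. \<integral>y. T n g y * T n h y \<partial>product_measure n Y"
  have int: "integrable (product_measure n Y) (\<lambda>y. T n g1 y * T n h y)"
    "integrable (product_measure n Y) (\<lambda>y. T n g2 y * T n h y)" for n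
    using assms by (auto simp: fock_iso_def)
  have eq: "T n (\<lambda>\<mu>. g1 \<mu> + g2 \<mu>) y * T n h y = T n g1 y * T n h y + T n g2 y * T n h y"
    if "y \<in> space (product_measure n Y)" for n y
    using T_add[OF assms(3,4) that] by (simp add: distrib_right)
  have "integrable (product_measure n Y) (\<lambda>y. T n (\<lambda>\<mu>. g1 \<mu> + g2 \<mu>) y * T n h y)" for n
    using Bochner_Integration.integrable_add[OF int, of n]
    by (subst Bochner_Integration.integrable_cong[OF refl eq])
  moreover have "?I (\<lambda>\<mu>. g1 \<mu> + g2 \<mu>) n = ?I g1 n + ?I g2 n" for n
    using Bochner_Integration.integral_add[OF int, of n]
    by (subst Bochner_Integration.integral_cong[OF refl eq])
  moreover have "(\<lambda>n. ?I g1 n / fact n + ?I g2 n / fact n) sums ((\<integral>\<mu>. g1 \<mu> * h \<mu> \<partial>P) + (\<integral>\<mu>. g2 \<mu> * h \<mu> \<partial>P))"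
    using assms by (intro sums_add) (auto simp: fock_iso_def)
  moreover have "(\<integral>\<mu>. (g1 \<mu> + g2 \<mu>) * h \<mu> \<partial>P) = (\<integral>\<mu>. g1 \<mu> * h \<mu> \<partial>P) + (\<integral>\<mu>. g2 \<mu> * h \<mu> \<partial>P)"
    unfolding distrib_right using assms by (intro Bochner_Integration.integral_add span_bounded_integrable)
  ultimately show ?thesis by (simp add: fock_iso_def add_divide_distrib)
qed

text \<open>The product of the kernels is \<open>c\<close> times the \<open>n\<close>-fold tensor
  power of \<open>p\<close>, so the series is \<open>c * exp (\<integral>p)\<close>. As
  \<open>p\<close> is the sum of \<open>1 - exp (- v)\<close> and \<open>1 - exp (- w)\<close> minus
  \<open>1 - exp (- (v + w))\<close>, this is the Laplace functional at
  \<open>v + w\<close>.\<close>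

lemma fock_iso_lapl:
  assumes v: "step_fun Y v" and w: "step_fun Y w"
  shows "fock_iso (lapl v) (lapl w)"
proof -
  define p where "p z = (exp (- v z) - 1) * (exp (- w z) - 1)" for z
  define c where "c = (\<integral>\<mu>. lapl v \<mu> \<partial>P) * (\<integral>\<mu>. lapl w \<mu> \<partial>P)"
  note iv = step_fun_integral(1)[OF v] and iw = step_fun_integral(1)[OF w]
    and ivw = step_fun_integral(1)[OF step_fun_add[OF v w]]
  have p_eq: "p z = (1 - exp (- v z)) + (1 - exp (- w z)) - (1 - exp (- (v z + w z)))" for z
    by (simp add: p_def algebra_simps mult_exp_exp)
  have ip: "integrable Y p"
    unfolding p_eq[abs_def]
    by (rule Bochner_Integration.integrable_diff[OF Bochner_Integration.integrable_add[OF iv iw] ivw])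
  have T: "T n (lapl v) y * T n (lapl w) y = c * (\<Prod>l<n. p (y l))"
    if "y \<in> space (product_measure n Y)" for n y
    using T_lapl[OF v that] T_lapl[OF w that] by (simp add: c_def p_def prod.distrib)
  have int: "integrable (product_measure n Y) (\<lambda>y. c * (\<Prod>l<n. p (y l)))" for n
    by (intro integrable_mult_right PF.product_integrable_prod ip) auto
  have I: "(\<integral>y. T n (lapl v) y * T n (lapl w) y \<partial>product_measure n Y) = c * (\<integral>z. p z \<partial>Y) ^ n" for n
  proof -
    have "(\<integral>y. T n (lapl v) y * T n (lapl w) y \<partial>product_measure n Y) = (\<integral>y. c * (\<Prod>l<n. p (y l)) \<partial>product_measure n Y)"
      by (intro Bochner_Integration.integral_cong T refl)
    also have "\<dots> = c * (\<integral>y. (\<Prod>l<n. p (y l)) \<partial>product_measure n Y)" by simp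
    also have "(\<integral>y. (\<Prod>l<n. p (y l)) \<partial>product_measure n Y) = (\<Prod>l<n. \<integral>z. p z \<partial>Y)"
      by (intro PF.product_integral_prod ip) auto
    finally show ?thesis by simp
  qed
  have "c * exp (\<integral>z. p z \<partial>Y) = (\<integral>\<mu>. lapl (\<lambda>y. v y + w y) \<mu> \<partial>P)"
  proof -
    have "(\<integral>z. p z \<partial>Y) = (\<integral>z. 1 - exp (- v z) \<partial>Y) + (\<integral>z. 1 - exp (- w z) \<partial>Y) - (\<integral>z. 1 - exp (- (v z + w z)) \<partial>Y)"
      unfolding p_eq
      by (simp only: Bochner_Integration.integral_diff[OF Bochner_Integration.integrable_add[OF iv iw] ivw]
          Bochner_Integration.integral_add[OF iv iw])
    then show ?thesis
      unfolding c_def laplace[OF v] laplace[OF w] laplace[OF step_fun_add[OF v w]] mult_exp_exp by simp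
  qed
  also have "\<dots> = (\<integral>\<mu>. lapl v \<mu> * lapl w \<mu> \<partial>P)"
    by (intro Bochner_Integration.integral_cong) (auto simp: lapl_add[OF v w] space_P)
  finally have "c * exp (\<integral>z. p z \<partial>Y) = (\<integral>\<mu>. lapl v \<mu> * lapl w \<mu> \<partial>P)" .
  moreover have "(\<lambda>n. c * ((\<integral>z. p z \<partial>Y) ^ n /\<^sub>R fact n)) sums (c * exp (\<integral>z. p z \<partial>Y))"
    by (intro sums_mult exp_converges)
  ultimately have "(\<lambda>n. (\<integral>y. T n (lapl v) y * T n (lapl w) y \<partial>product_measure n Y) / fact n) sums (\<integral>\<mu>. lapl v \<mu> * lapl w \<mu> \<partial>P)"
    unfolding I by (simp add: field_simps)
  moreover have "integrable (product_measure n Y) (\<lambda>y. T n (lapl v) y * T n (lapl w) y)" for n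
    using int[of n] by (subst Bochner_Integration.integrable_cong[OF refl T])
  ultimately show ?thesis by (simp add: fock_iso_def)
qed

lemma fock_iso_span:
  assumes "g \<in> lapl_span Y" "h \<in> lapl_span Y"
  shows "fock_iso g h"
  using assms
proof (induction rule: lapl_span.induct)
  case (lapl v)
  from lapl(2) have "fock_iso h (lapl v)"
  proof (induction rule: lapl_span.induct)
    case (lapl w)
    with \<open>step_fun Y v\<close> show ?case by (intro fock_iso_lapl)
  next
    case (scale g c)
    then show ?case by (intro fock_iso_scale)
  next
    case (add g1 g2)
    then show ?case using \<open>step_fun Y v\<close> by (intro fock_iso_add lapl_span.lapl)
  qed
  then show ?case by (simp add: fock_iso_commute)
next
  case (scale g c)
  then show ?case by (intro fock_iso_scale)
next
  case (add g1 g2)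
  then show ?case by (intro fock_iso_add)
qed

text \<open>This is \<open>a_n(f)\<close>. Despite the names, \<open>chaos_norm\<close>,
  \<open>fock_norm\<close>, \<open>L2_norm\<close> and later \<open>diff_norm\<close> are squared
  norms; extended values permit series and Fubini arguments before finiteness is known.\<close>

definition chaos_norm :: "nat \<Rightarrow> ('y measure \<Rightarrow> real) \<Rightarrow> ennreal" where
  "chaos_norm n f = (\<integral>\<^sup>+y. ennreal ((T n f y)\<^sup>2) \<partial>product_measure n Y)"

definition fock_norm :: "('y measure \<Rightarrow> real) \<Rightarrow> ennreal" where
  "fock_norm f = (\<Sum>n. ennreal (1 / fact n) * chaos_norm n f)"

definition L2_norm :: "('y measure \<Rightarrow> real) \<Rightarrow> ennreal" where
  "L2_norm f = (\<integral>\<^sup>+\<mu>. ennreal ((f \<mu>)\<^sup>2) \<partial>P)"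

lemma fock_norm_span:
  assumes g: "g \<in> lapl_span Y" shows "fock_norm g = L2_norm g"
proof -
  have iso: "integrable (product_measure n Y) (\<lambda>y. T n g y * T n g y)"
    "(\<lambda>n. (\<integral>y. T n g y * T n g y \<partial>product_measure n Y) / fact n) sums (\<integral>\<mu>. g \<mu> * g \<mu> \<partial>P)" for n
    using fock_iso_span[OF g g] by (auto simp: fock_iso_def)
  have "ennreal (1 / fact n) * chaos_norm n g = ennreal ((\<integral>y. T n g y * T n g y \<partial>product_measure n Y) / fact n)" for n
    using iso(1)[of n] unfolding chaos_norm_def power2_eq_square
    by (subst nn_integral_eq_integral) (auto simp: ennreal_mult[symmetric] integral_nonneg_AE)
  then have "fock_norm g = (\<Sum>n. ennreal ((\<integral>y. T n g y * T n g y \<partial>product_measure n Y) / fact n))"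
    by (simp add: fock_norm_def)
  also have "\<dots> = ennreal (\<integral>\<mu>. g \<mu> * g \<mu> \<partial>P)"
    by (rule suminf_ennreal_eq[OF _ iso(2)]) (auto intro!: divide_nonneg_nonneg integral_nonneg_AE)
  also have "\<dots> = L2_norm g"
    using span_bounded_integrable[OF g g] unfolding L2_norm_def power2_eq_square
    by (subst nn_integral_eq_integral) auto
  finally show ?thesis .
qed

text \<open>The distance \<open>2^-j\<close> is summable, as \<open>T_convergence\<close> needs, and
  its square outweighs the factor \<open>1 + 2^j\<close> in \<open>eps_limit\<close>.\<close>

lemma ex_span_sequence:
  assumes f [measurable]: "f \<in> borel_measurable N" and f2: "L2_norm f < \<infinity>"
  obtains g where "\<And>j::nat. g j \<in> lapl_span Y" "\<And>j. L2_norm (\<lambda>\<mu>. g j \<mu> - f \<mu>) \<le> ennreal (((1 / 2) ^ j)\<^sup>2)"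
proof -
  have "lapl_approx Y P f"
    using f2 by (intro lapl_approx_L2 sets_P Y.sigma_finite_measure_axioms P.finite_measure_axioms)
      (auto simp: L2_norm_def integrable_iff_bounded)
  then have "\<exists>g\<in>lapl_span Y. L2_norm (\<lambda>\<mu>. f \<mu> - g \<mu>) < ennreal (((1 / 2) ^ j)\<^sup>2)" for j :: nat
    unfolding lapl_approx_def L2_norm_def by simp
  then obtain g where "\<And>j. g j \<in> lapl_span Y" "\<And>j. L2_norm (\<lambda>\<mu>. f \<mu> - g j \<mu>) < ennreal (((1 / 2) ^ j)\<^sup>2)"
    by metis
  then show ?thesis
    by (intro that[of g]) (auto simp: L2_norm_def power2_commute intro: less_imp_le)
qed

text \<open>Fatou only gives an inequality; the constant \<open>2\<close> is irrelevant for the isometry.\<close>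

lemma bessel:
  assumes f [measurable]: "f \<in> borel_measurable N" and f2: "L2_norm f < \<infinity>"
  shows "fock_norm f \<le> 2 * L2_norm f"
proof -
  obtain g where g: "\<And>j::nat. g j \<in> lapl_span Y" "\<And>j. L2_norm (\<lambda>\<mu>. g j \<mu> - f \<mu>) \<le> ennreal (((1 / 2) ^ j)\<^sup>2)"
    using ex_span_sequence[OF assms] by blast
  note [measurable] = span_measurable[OF g(1)]
  have le: "ennreal (1 / fact n) * chaos_norm n f \<le> liminf (\<lambda>j. ennreal (1 / fact n) * chaos_norm n (g j))" for n
  proof -
    have "AE y in product_measure n Y. (\<lambda>j. T n (g j) y) \<longlonglongrightarrow> T n f y"
      using f2 g span_L2 unfolding L2_norm_def by (intro T_convergence) auto
    then have "ennreal (1 / fact n) * chaos_norm n f =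
        (\<integral>\<^sup>+y. liminf (\<lambda>j. ennreal (1 / fact n) * ennreal ((T n (g j) y)\<^sup>2)) \<partial>product_measure n Y)"
      unfolding chaos_norm_def
    proof (subst nn_integral_cmult[symmetric], simp, intro nn_integral_cong_AE, eventually_elim)
      case (elim y)
      have "(\<lambda>j. ennreal (1 / fact n) * ennreal ((T n (g j) y)\<^sup>2)) \<longlonglongrightarrow> ennreal (1 / fact n) * ennreal ((T n f y)\<^sup>2)"
        by (intro ennreal_tendsto_cmult tendsto_ennrealI tendsto_intros elim) simp
      from lim_imp_Liminf[OF sequentially_bot this] show ?case by simp
    qed
    also have "\<dots> \<le> liminf (\<lambda>j. \<integral>\<^sup>+y. ennreal (1 / fact n) * ennreal ((T n (g j) y)\<^sup>2) \<partial>product_measure n Y)"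
      by (rule nn_integral_liminf) simp
    finally show ?thesis by (simp add: chaos_norm_def nn_integral_cmult)
  qed
  \<comment> \<open>The series is read as an integral over the counting measure so that Fatou
    applies a second time, now to the sum over \<open>n\<close>.\<close>
  have "fock_norm f \<le> (\<integral>\<^sup>+n. liminf (\<lambda>j. ennreal (1 / fact n) * chaos_norm n (g j)) \<partial>count_space UNIV)"
    unfolding fock_norm_def nn_integral_count_space_nat[symmetric] by (intro nn_integral_mono le)
  also have "\<dots> \<le> liminf (\<lambda>j. \<integral>\<^sup>+n. ennreal (1 / fact n) * chaos_norm n (g j) \<partial>count_space UNIV)"
    by (rule nn_integral_liminf) simp
  also have "\<dots> = liminf (\<lambda>j. L2_norm (g j))"
    by (simp add: nn_integral_count_space_nat fock_norm_def[symmetric] fock_norm_span[OF g(1)])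
  also have "\<dots> \<le> liminf (\<lambda>j. 2 * L2_norm f + ennreal (2 * ((1 / 2) ^ j)\<^sup>2))"
  proof (intro Liminf_mono always_eventually allI)
    fix j
    have "L2_norm (g j) \<le> 2 * L2_norm f + 2 * L2_norm (\<lambda>\<mu>. g j \<mu> - f \<mu>)"
      using nn_integral_sq_add_le[of f P "\<lambda>\<mu>. g j \<mu> - f \<mu>"] by (simp add: L2_norm_def)
    also have "\<dots> \<le> 2 * L2_norm f + 2 * ennreal (((1 / 2) ^ j)\<^sup>2)"
      by (intro add_left_mono mult_left_mono g(2)) auto
    finally show "L2_norm (g j) \<le> 2 * L2_norm f + ennreal (2 * ((1 / 2) ^ j)\<^sup>2)"
      by (simp add: ennreal_mult)
  qed
  also have "\<dots> = 2 * L2_norm f"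
  proof (rule lim_imp_Liminf)
    have "(\<lambda>j::nat. 2 * ((1 / 2) ^ j)\<^sup>2 :: real) \<longlonglongrightarrow> 0" by real_asymp
    then have "(\<lambda>j::nat. 2 * L2_norm f + ennreal (2 * ((1 / 2) ^ j)\<^sup>2)) \<longlonglongrightarrow> 2 * L2_norm f + ennreal 0"
      by (intro tendsto_add tendsto_const tendsto_ennrealI)
    then show "(\<lambda>j::nat. 2 * L2_norm f + ennreal (2 * ((1 / 2) ^ j)\<^sup>2)) \<longlonglongrightarrow> 2 * L2_norm f" by simp
  qed simp
  finally show ?thesis .
qed

lemma L2_norm_eps_le:
  assumes "f \<in> borel_measurable N" "g \<in> borel_measurable N" "d \<in> borel_measurable N"
    and "\<And>\<mu>. \<mu> \<in> space N \<Longrightarrow> f \<mu> = g \<mu> + d \<mu>" and "0 < e"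
  shows "L2_norm f \<le> ennreal (1 + e) * L2_norm g + ennreal (1 + 1 / e) * L2_norm d"
  unfolding L2_norm_def using assms by (intro nn_integral_sq_eps_le AE_I2) (auto simp: space_P)

lemma fock_norm_eps_le:
  assumes [measurable]: "f \<in> borel_measurable N" "g \<in> borel_measurable N" "d \<in> borel_measurable N"
    and eq: "\<And>n. AE y in product_measure n Y. T n f y = T n g y + T n d y" and e: "0 < e"
  shows "fock_norm f \<le> ennreal (1 + e) * fock_norm g + ennreal (1 + 1 / e) * fock_norm d"
proof -
  have *: "chaos_norm n f \<le> ennreal (1 + e) * chaos_norm n g + ennreal (1 + 1 / e) * chaos_norm n d" for n
    unfolding chaos_norm_def using eq e by (intro nn_integral_sq_eps_le) auto
  have "fock_norm f \<le> (\<Sum>n. ennreal (1 + e) * (ennreal (1 / fact n) * chaos_norm n g) +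
      ennreal (1 + 1 / e) * (ennreal (1 / fact n) * chaos_norm n d))"
    unfolding fock_norm_def
  proof (intro suminf_le)
    fix n
    have "ennreal (1 / fact n) * chaos_norm n f \<le>
        ennreal (1 / fact n) * (ennreal (1 + e) * chaos_norm n g + ennreal (1 + 1 / e) * chaos_norm n d)"
      by (intro mult_left_mono *) auto
    then show "ennreal (1 / fact n) * chaos_norm n f \<le> ennreal (1 + e) * (ennreal (1 / fact n) * chaos_norm n g) +
      ennreal (1 + 1 / e) * (ennreal (1 / fact n) * chaos_norm n d)"
      by (simp only: distrib_left mult_ac)
  qed auto
  also have "\<dots> = ennreal (1 + e) * fock_norm g + ennreal (1 + 1 / e) * fock_norm d"
    unfolding fock_norm_def by (simp add: suminf_add[symmetric])
  finally show ?thesis .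
qed

text \<open>Both squared norms agree on the approximants \<open>g j\<close>, and both are continuous
  along them: \<open>L2_norm\<close> by the choice of \<open>g\<close>, \<open>fock_norm\<close>
  because \<open>bessel\<close> bounds the error \<open>d j\<close>.\<close>

theorem fock_representation:
  assumes f [measurable]: "f \<in> borel_measurable N" and f2: "L2_norm f < \<infinity>"
  shows "L2_norm f = fock_norm f"
proof -
  obtain g where g: "\<And>j::nat. g j \<in> lapl_span Y" "\<And>j. L2_norm (\<lambda>\<mu>. g j \<mu> - f \<mu>) \<le> ennreal (((1 / 2) ^ j)\<^sup>2)"
    using ex_span_sequence[OF assms] by blast
  note [measurable] = span_measurable[OF g(1)]
  define d where "d j \<mu> = g j \<mu> - f \<mu>" for j \<mu>
  \<comment> \<open>\<open>eps_limit\<close> compares \<open>f\<close> and \<open>g j\<close> in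
    both directions, which calls for the error with either sign.\<close>
  define d' where "d' j \<mu> = f \<mu> - g j \<mu>" for j \<mu>
  have [measurable]: "d j \<in> borel_measurable N" "d' j \<in> borel_measurable N" for j
    unfolding d_def[abs_def] d'_def[abs_def] by measurable
  have dd': "L2_norm (d' j) = L2_norm (d j)" for j
    by (simp add: L2_norm_def d_def d'_def power2_commute)
  have fd: "fock_norm (d' j) = fock_norm (d j)" for j
  proof -
    have "d' j = (\<lambda>\<mu>. - 1 * d j \<mu>)" by (auto simp: d_def d'_def)
    then have "T n (d' j) y = - T n (d j) y" for n y using T_scale[of n "-1" "d j" y] by simp
    then show ?thesis by (simp add: fock_norm_def chaos_norm_def)
  qed
  have d_le: "L2_norm (d j) \<le> ennreal (((1 / 2) ^ j)\<^sup>2)" for j using g(2)[of j] by (simp add: d_def[abs_def])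
  have d_fin: "L2_norm (d j) < \<infinity>" for j using le_less_trans[OF d_le] by auto
  have d_le2: "L2_norm (d j) \<le> ennreal (2 * ((1 / 2) ^ j)\<^sup>2)" for j
    by (rule order_trans[OF d_le]) (auto intro: ennreal_leI)
  have fd_le: "fock_norm (d j) \<le> ennreal (2 * ((1 / 2) ^ j)\<^sup>2)" for j
  proof -
    have "fock_norm (d j) \<le> 2 * L2_norm (d j)" using d_fin by (intro bessel) auto
    also have "\<dots> \<le> 2 * ennreal (((1 / 2) ^ j)\<^sup>2)" by (intro mult_left_mono d_le) auto
    finally show ?thesis by (simp add: ennreal_mult)
  qed
  have g2: "L2_norm (g j) < \<infinity>" for j using span_L2[OF g(1)] by (simp add: L2_norm_def)
  have F_fin: "fock_norm f < \<infinity>"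
    using le_less_trans[OF bessel[OF f f2]] f2 by (simp add: ennreal_mult_less_top)
  have Td: "AE y in product_measure n Y. T n (g j) y = T n f y + T n (d j) y" for n j
    using AE_T_diff[of "g j" f n] f2 g2[of j] unfolding d_def[abs_def] L2_norm_def by auto
  have Td': "AE y in product_measure n Y. T n f y = T n (g j) y + T n (d' j) y" for n j
    using AE_T_diff[of f "g j" n] f2 g2[of j] unfolding d'_def[abs_def] L2_norm_def by auto
  have "(\<lambda>j. enn2real (L2_norm (g j))) \<longlonglongrightarrow> enn2real (L2_norm f)"
  proof (rule eps_limit[OF f2 g2 d_le2])
    show "L2_norm (g j) \<le> ennreal (1 + e) * L2_norm f + ennreal (1 + 1 / e) * L2_norm (d j)" if "0 < e" for e j
      using that by (intro L2_norm_eps_le) (auto simp: d_def)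
    show "L2_norm f \<le> ennreal (1 + e) * L2_norm (g j) + ennreal (1 + 1 / e) * L2_norm (d j)" if "0 < e" for e j
      unfolding dd'[symmetric] using that by (intro L2_norm_eps_le) (auto simp: d'_def)
  qed
  moreover have "(\<lambda>j. enn2real (fock_norm (g j))) \<longlonglongrightarrow> enn2real (fock_norm f)"
  proof (rule eps_limit[OF F_fin _ fd_le])
    show "fock_norm (g j) < \<infinity>" for j using g2 by (simp add: fock_norm_span[OF g(1)])
    show "fock_norm (g j) \<le> ennreal (1 + e) * fock_norm f + ennreal (1 + 1 / e) * fock_norm (d j)" if "0 < e" for e j
      using that Td by (intro fock_norm_eps_le) auto
    show "fock_norm f \<le> ennreal (1 + e) * fock_norm (g j) + ennreal (1 + 1 / e) * fock_norm (d j)" if "0 < e" for e j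
      unfolding fd[symmetric] using that Td' by (intro fock_norm_eps_le) auto
  qed
  ultimately have "enn2real (L2_norm f) = enn2real (fock_norm f)"
    unfolding fock_norm_span[OF g(1)] by (rule LIMSEQ_unique)
  then show ?thesis
    using f2 F_fin by (metis ennreal_enn2real infinity_ennreal_def)
qed

end

section \<open>Variance and partial sums\<close>

lemma ennreal_suminf_real_sums:
  fixes g :: "nat \<Rightarrow> real"
  assumes "(\<Sum>m. ennreal (g m)) = x" "x < \<infinity>" "\<And>m. 0 \<le> g m"
  shows "g sums enn2real x"
proof -
  have "summable g" using assms by (intro summable_suminf_not_top) auto
  moreover from this have "x = ennreal (suminf g)"
    using assms by (simp add: suminf_ennreal2)
  ultimately show ?thesis
    using assms(3) by (simp add: summable_sums suminf_nonneg)
qed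

text \<open>Pascal's rule makes the sum telescope. The upper index is a successor since for index
  \<open>0\<close> the sum is \<open>1\<close> for every \<open>K\<close>; that term is the squared
  mean and does not occur in the variance.\<close>

lemma alternating_binomial_sum:
  "(\<Sum>n\<le>K. (- 1) ^ n * real (Suc m choose n)) = (- 1) ^ K * real (m choose K)"
  by (induction K) (simp_all add: algebra_simps)

section \<open>Expected norms of \<open>D^n f\<close>, their expansion, and the remainder\<close>

context poisson_space
begin

lemma nn_integral_upd_measurable [measurable]:
  assumes [measurable]: "G \<in> borel_measurable (product_measure (Suc n) Y)"
  shows "(\<lambda>z. \<integral>\<^sup>+y. G (y(n := z)) \<partial>product_measure n Y) \<in> borel_measurable Y"
proof -
  have "(\<lambda>x. (snd x)(n := fst x)) \<in> measurable (Y \<Otimes>\<^sub>M product_measure n Y) (product_measure (Suc n) Y)"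
    by (rule measurable_fun_upd[where J="{..<n}"]) auto
  from measurable_compose[OF this assms] show ?thesis
    by (intro Pi.borel_measurable_nn_integral) (simp add: split_beta')
qed

text \<open>The integrals are in the opposite order to \<open>expected_diff_norm_sq\<close>: with
  the points outside, one of them can be split off and an inductive statement applied to
  \<open>diff_op z f\<close> for fixed \<open>z\<close>.\<close>

definition diff_norm :: "nat \<Rightarrow> ('y measure \<Rightarrow> real) \<Rightarrow> ennreal" where
  "diff_norm n f = (\<integral>\<^sup>+y. (\<integral>\<^sup>+\<mu>. ennreal ((iter_diff n y f \<mu>)\<^sup>2) \<partial>P) \<partial>product_measure n Y)"

lemma diff_norm_integrand_measurable [measurable]:
  assumes [measurable]: "f \<in> borel_measurable N"
  shows "(\<lambda>y. \<integral>\<^sup>+\<mu>. ennreal ((iter_diff n y f \<mu>)\<^sup>2) \<partial>P) \<in> borel_measurable (product_measure n Y)"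
  by measurable

lemma diff_norm_0: "diff_norm 0 f = L2_norm f"
  by (simp add: diff_norm_def L2_norm_def PF.nn_integral_empty del: nn_integral_const)

lemma diff_norm_Suc:
  assumes [measurable]: "f \<in> borel_measurable N"
  shows "diff_norm (Suc n) f = (\<integral>\<^sup>+z. diff_norm n (diff_op z f) \<partial>Y)"
    and "(\<lambda>z. diff_norm n (diff_op z f)) \<in> borel_measurable Y"
proof -
  show "diff_norm (Suc n) f = (\<integral>\<^sup>+z. diff_norm n (diff_op z f) \<partial>Y)"
    unfolding diff_norm_def
    by (subst nn_integral_product_Suc, measurable) (simp only: iter_diff_Suc_last)
  have "(\<lambda>z. diff_norm n (diff_op z f)) = (\<lambda>z. \<integral>\<^sup>+y. (\<integral>\<^sup>+\<mu>. ennreal ((iter_diff (Suc n) (y(n := z)) f \<mu>)\<^sup>2) \<partial>P) \<partial>product_measure n Y)"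
    unfolding diff_norm_def iter_diff_Suc_last ..
  also have "\<dots> \<in> borel_measurable Y"
    by (rule nn_integral_upd_measurable[OF diff_norm_integrand_measurable[OF assms]])
  finally show "(\<lambda>z. diff_norm n (diff_op z f)) \<in> borel_measurable Y" .
qed

lemma T_diff_op: "T n (diff_op z f) y = T (Suc n) f (y(n := z))"
  unfolding T_def iter_diff_Suc_last ..

lemma chaos_norm_Suc:
  assumes [measurable]: "f \<in> borel_measurable N"
  shows "chaos_norm (Suc n) f = (\<integral>\<^sup>+z. chaos_norm n (diff_op z f) \<partial>Y)"
    and "(\<lambda>z. chaos_norm n (diff_op z f)) \<in> borel_measurable Y"
proof -
  have [measurable]: "(\<lambda>y. ennreal ((T (Suc n) f y)\<^sup>2)) \<in> borel_measurable (product_measure (Suc n) Y)"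
    by measurable
  show "chaos_norm (Suc n) f = (\<integral>\<^sup>+z. chaos_norm n (diff_op z f) \<partial>Y)"
    unfolding chaos_norm_def T_diff_op by (rule nn_integral_product_Suc) measurable
  show "(\<lambda>z. chaos_norm n (diff_op z f)) \<in> borel_measurable Y"
    unfolding chaos_norm_def T_diff_op by (rule nn_integral_upd_measurable) measurable
qed

text \<open>Finiteness of the integral over \<open>z\<close> makes
  \<open>diff_norm n (diff_op z f)\<close> finite for almost every \<open>z\<close>, where the
  induction hypothesis applies. Integrating over \<open>z\<close> raises the order of each
  \<open>chaos_norm\<close> by one. The base case is the Fock space representation.\<close>

theorem diff_norm_expansion:
  assumes "f \<in> borel_measurable N" "diff_norm n f < \<infinity>"
  shows "diff_norm n f = (\<Sum>m. ennreal (1 / fact m) * chaos_norm (m + n) f)"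
  using assms
proof (induction n arbitrary: f)
  case 0
  then show ?case using fock_representation[of f] by (simp add: diff_norm_0 fock_norm_def)
next
  case (Suc n)
  note f [measurable] = \<open>f \<in> borel_measurable N\<close>
  note [measurable] = chaos_norm_Suc(2)[OF f]
  have "AE z in Y. diff_norm n (diff_op z f) \<noteq> \<infinity>"
    using Suc.prems(2) unfolding diff_norm_Suc(1)[OF f]
    by (intro nn_integral_PInf_AE diff_norm_Suc(2)[OF f]) auto
  then have "AE z in Y. diff_norm n (diff_op z f) = (\<Sum>m. ennreal (1 / fact m) * chaos_norm (m + n) (diff_op z f))"
  proof (rule AE_mp, intro AE_I2 impI)
    fix z assume "z \<in> space Y" "diff_norm n (diff_op z f) \<noteq> \<infinity>"
    then show "diff_norm n (diff_op z f) = (\<Sum>m. ennreal (1 / fact m) * chaos_norm (m + n) (diff_op z f))"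
      by (intro Suc.IH diff_op_measurable f) (auto simp: less_top)
  qed
  then have "diff_norm (Suc n) f = (\<integral>\<^sup>+z. (\<Sum>m. ennreal (1 / fact m) * chaos_norm (m + n) (diff_op z f)) \<partial>Y)"
    unfolding diff_norm_Suc(1)[OF f] by (rule nn_integral_cong_AE)
  also have "\<dots> = (\<Sum>m. \<integral>\<^sup>+z. ennreal (1 / fact m) * chaos_norm (m + n) (diff_op z f) \<partial>Y)"
    by (rule nn_integral_suminf) measurable
  also have "\<dots> = (\<Sum>m. ennreal (1 / fact m) * chaos_norm (m + Suc n) f)"
    by (intro suminf_cong) (simp add: nn_integral_cmult chaos_norm_Suc(1)[OF f])
  finally show ?case .
qed

lemma diff_norm_eq_0_iff:
  assumes f [measurable]: "f \<in> borel_measurable N"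
  shows "diff_norm n f = 0 \<longleftrightarrow> (AE y in product_measure n Y. AE \<mu> in P. iter_diff n y f \<mu> = 0)"
proof -
  have "diff_norm n f = 0 \<longleftrightarrow>
      (AE y in product_measure n Y. (\<integral>\<^sup>+\<mu>. ennreal ((iter_diff n y f \<mu>)\<^sup>2) \<partial>P) = 0)"
    unfolding diff_norm_def by (rule nn_integral_0_iff_AE) measurable
  also have "\<dots> \<longleftrightarrow> (AE y in product_measure n Y. AE \<mu> in P. iter_diff n y f \<mu> = 0)"
  proof (rule AE_cong)
    fix y assume "y \<in> space (product_measure n Y)"
    from iter_diff_measurable_snd[OF f this]
    show "(\<integral>\<^sup>+\<mu>. ennreal ((iter_diff n y f \<mu>)\<^sup>2) \<partial>P) = 0 \<longleftrightarrow> (AE \<mu> in P. iter_diff n y f \<mu> = 0)"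
      by (subst nn_integral_0_iff_AE) auto
  qed
  finally show ?thesis .
qed

text \<open>That \<open>f\<close> vanishes almost surely says nothing directly about
  \<open>f\<close> at shifted configurations. \<open>box_norm_L2\<close> with \<open>c = 0\<close>,
  and through it the Mecke equation, excludes trouble for almost all points.\<close>

lemma diff_norm_null:
  assumes f [measurable]: "f \<in> borel_measurable N" and 0: "L2_norm f = 0"
  shows "diff_norm n f = 0"
  unfolding diff_norm_eq_0_iff[OF f]
proof (rule AE_product_boxI)
  fix B assume B [measurable]: "B \<in> sets Y" and fin: "emeasure Y B < \<infinity>"
  obtain w :: real where "box_norm n f B \<le> ennreal (0 * w)"
    using box_norm_L2[OF B fin, of n] f 0 unfolding L2_norm_def by (metis order_refl zero_le)
  then have "box_norm n f B = 0" by simp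
  then have "AE y in product_measure n Y. (\<Prod>l<n. indicator B (y l)) * (\<integral>\<^sup>+\<mu>. ennreal \<bar>iter_diff n y f \<mu>\<bar> \<partial>P) = 0"
    unfolding box_norm_def by (subst (asm) nn_integral_0_iff_AE) measurable
  then show "AE y in product_measure n Y. (\<forall>l<n. y l \<in> B) \<longrightarrow> (AE \<mu> in P. iter_diff n y f \<mu> = 0)"
  proof (rule AE_mp[OF _ AE_I2], intro impI)
    fix y assume y: "y \<in> space (product_measure n Y)" "\<forall>l<n. y l \<in> B"
      and "(\<Prod>l<n. indicator B (y l)) * (\<integral>\<^sup>+\<mu>. ennreal \<bar>iter_diff n y f \<mu>\<bar> \<partial>P) = 0"
    then have "(\<integral>\<^sup>+\<mu>. ennreal \<bar>iter_diff n y f \<mu>\<bar> \<partial>P) = 0" by simp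
    then show "AE \<mu> in P. iter_diff n y f \<mu> = 0"
      using iter_diff_measurable_snd[OF f y(1)] by (subst (asm) nn_integral_0_iff_AE) auto
  qed
qed

lemma chaos_norm_0: "chaos_norm 0 f = ennreal ((\<integral>\<mu>. f \<mu> \<partial>P)\<^sup>2)"
  by (simp add: chaos_norm_def T_def PF.nn_integral_empty del: nn_integral_const)

lemma L2_normD:
  assumes f [measurable]: "f \<in> borel_measurable N" and f2: "L2_norm f < \<infinity>"
  shows "integrable P f" "integrable P (\<lambda>\<mu>. (f \<mu>)\<^sup>2)" "L2_norm f = ennreal (\<integral>\<mu>. (f \<mu>)\<^sup>2 \<partial>P)"
    "(\<integral>\<mu>. (f \<mu> - (\<integral>\<mu>. f \<mu> \<partial>P))\<^sup>2 \<partial>P) = (\<integral>\<mu>. (f \<mu>)\<^sup>2 \<partial>P) - (\<integral>\<mu>. f \<mu> \<partial>P)\<^sup>2"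
proof -
  show *: "integrable P (\<lambda>\<mu>. (f \<mu>)\<^sup>2)"
    using f2 by (simp add: L2_norm_def integrable_iff_bounded)
  then show **: "integrable P f"
    by (rule P.square_integrable_imp_integrable[rotated]) simp
  show "L2_norm f = ennreal (\<integral>\<mu>. (f \<mu>)\<^sup>2 \<partial>P)"
    unfolding L2_norm_def using * by (intro nn_integral_eq_integral) auto
  show "(\<integral>\<mu>. (f \<mu> - (\<integral>\<mu>. f \<mu> \<partial>P))\<^sup>2 \<partial>P) = (\<integral>\<mu>. (f \<mu>)\<^sup>2 \<partial>P) - (\<integral>\<mu>. f \<mu> \<partial>P)\<^sup>2"
    by (rule P.variance_eq[OF ** *])
qed

text \<open>Finiteness is known only up to order \<open>n\<close>, so the expansion cannot be
  evaluated at \<open>Suc n\<close>. The induction moves to \<open>diff_op z f\<close> for almost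
  every \<open>z\<close>. In the base case only \<open>a_0(f)\<close> survives, so \<open>f\<close>
  has zero variance, is almost surely constant, and \<open>diff_norm_null\<close> applies to
  \<open>f\<close> minus its mean.\<close>

lemma diff_norm_Suc_eq_0:
  assumes "f \<in> borel_measurable N" "diff_norm n f < \<infinity>" "\<And>m. n < m \<Longrightarrow> chaos_norm m f = 0"
  shows "diff_norm (Suc n) f = 0"
  using assms
proof (induction n arbitrary: f)
  case 0
  note f [measurable] = \<open>f \<in> borel_measurable N\<close>
  have f2: "L2_norm f < \<infinity>" using 0 by (simp add: diff_norm_0)
  note D = L2_normD[OF f f2]
  have "L2_norm f = (\<Sum>m. ennreal (1 / fact m) * chaos_norm m f)"
    using fock_representation[OF f f2] by (simp add: fock_norm_def)
  also have "\<dots> = (\<Sum>m\<in>{0}. ennreal (1 / fact m) * chaos_norm m f)"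
    using 0 by (intro suminf_finite) auto
  also have "\<dots> = ennreal ((\<integral>\<mu>. f \<mu> \<partial>P)\<^sup>2)" by (simp add: chaos_norm_0)
  finally have "(\<integral>\<mu>. (f \<mu>)\<^sup>2 \<partial>P) = (\<integral>\<mu>. f \<mu> \<partial>P)\<^sup>2" unfolding D(3) by simp
  then have var: "(\<integral>\<mu>. (f \<mu> - (\<integral>\<mu>. f \<mu> \<partial>P))\<^sup>2 \<partial>P) = 0" using D(4) by simp
  define c where "c = (\<integral>\<mu>. f \<mu> \<partial>P)"
  have "integrable P (\<lambda>\<mu>. (f \<mu> - c)\<^sup>2)"
    using D(1,2) by (simp add: power2_diff)
  then have "L2_norm (\<lambda>\<mu>. f \<mu> - c) = 0"
    using var unfolding L2_norm_def c_def[symmetric] by (subst nn_integral_eq_integral) auto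
  then have "diff_norm (Suc 0) (\<lambda>\<mu>. f \<mu> - c) = 0" by (intro diff_norm_null) auto
  moreover have "diff_norm (Suc 0) (\<lambda>\<mu>. f \<mu> - c) = diff_norm (Suc 0) f"
    by (simp add: diff_norm_def diff_op_def)
  ultimately show ?case by simp
next
  case (Suc n)
  note f [measurable] = \<open>f \<in> borel_measurable N\<close>
  note [measurable] = chaos_norm_Suc(2)[OF f]
  have "AE z in Y. diff_norm n (diff_op z f) \<noteq> \<infinity>"
    using Suc.prems(2) unfolding diff_norm_Suc(1)[OF f]
    by (intro nn_integral_PInf_AE diff_norm_Suc(2)[OF f]) auto
  moreover have "AE z in Y. \<forall>m. n < m \<longrightarrow> chaos_norm m (diff_op z f) = 0"
    unfolding AE_all_countable
  proof
    fix m
    show "AE z in Y. n < m \<longrightarrow> chaos_norm m (diff_op z f) = 0"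
    proof (cases "n < m")
      case True
      then have "(\<integral>\<^sup>+z. chaos_norm m (diff_op z f) \<partial>Y) = 0"
        using Suc.prems(3)[of "Suc m"] by (simp add: chaos_norm_Suc(1)[OF f])
      then show ?thesis by (subst (asm) nn_integral_0_iff_AE) auto
    qed simp
  qed
  ultimately have "AE z in Y. diff_norm (Suc n) (diff_op z f) = 0"
  proof (rule AE_mp[OF AE_conjI], intro AE_I2 impI)
    fix z assume "z \<in> space Y"
      "diff_norm n (diff_op z f) \<noteq> \<infinity> \<and> (\<forall>m. n < m \<longrightarrow> chaos_norm m (diff_op z f) = 0)"
    then show "diff_norm (Suc n) (diff_op z f) = 0"
      by (intro Suc.IH diff_op_measurable f) (auto simp: less_top)
  qed
  then show ?case
    unfolding diff_norm_Suc(1)[OF f, of "Suc n"]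
    by (subst nn_integral_0_iff_AE) (auto intro: diff_norm_Suc(2)[OF f])
qed

lemma chaos_norm_vanishes_iff:
  assumes f: "f \<in> borel_measurable N" and fin: "diff_norm n f < \<infinity>"
  shows "(\<forall>m>n. chaos_norm m f = 0) \<longleftrightarrow> diff_norm (Suc n) f = 0"
proof
  assume "\<forall>m>n. chaos_norm m f = 0"
  then show "diff_norm (Suc n) f = 0" by (intro diff_norm_Suc_eq_0 f fin) auto
next
  assume 0: "diff_norm (Suc n) f = 0"
  \<comment> \<open>In this direction the norm of order \<open>Suc n\<close> is \<open>0\<close>,
    hence finite, and the expansion is available.\<close>
  with diff_norm_expansion[OF f, of "Suc n"]
  have "(\<Sum>m. ennreal (1 / fact m) * chaos_norm (m + Suc n) f) = 0" by simp
  then have "ennreal (1 / fact m) * chaos_norm (m + Suc n) f = 0" for m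
    by (subst (asm) suminf_eq_zero_iff) auto
  then have *: "chaos_norm (m + Suc n) f = 0" for m by simp
  show "\<forall>m>n. chaos_norm m f = 0"
  proof (intro allI impI)
    fix m assume "n < m"
    then show "chaos_norm m f = 0" using *[of "m - Suc n"] by simp
  qed
qed

text \<open>In \<open>(- 1)^K * (V - S)\<close> the weight of \<open>b (Suc m)\<close> is
  \<open>m choose K\<close>, which is zero for \<open>m < K\<close> and positive for
  \<open>m \<ge> K\<close>. Sign and equality case can therefore be read off termwise, for both
  parities of \<open>K\<close> at once.\<close>

theorem variance_remainder:
  fixes f :: "'y measure \<Rightarrow> real" and K :: nat
  assumes f: "f \<in> borel_measurable N"
    and fin: "\<And>n. n \<le> K \<Longrightarrow> diff_norm n f < \<infinity>"
  defines "S \<equiv> \<Sum>n=1..K. (- 1) ^ (n + 1) / fact n * enn2real (diff_norm n f)"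
    and "V \<equiv> (\<integral>\<mu>. (f \<mu> - (\<integral>\<mu>. f \<mu> \<partial>P))\<^sup>2 \<partial>P)"
  shows "0 \<le> (- 1) ^ K * (V - S)"
    and "V = S \<longleftrightarrow> diff_norm (Suc K) f = 0"
proof -
  have f2: "L2_norm f < \<infinity>" using fin[of 0] by (simp add: diff_norm_0)
  note D = L2_normD[OF f f2]
  define b where "b m = enn2real (chaos_norm m f) / fact m" for m
  have b0: "0 \<le> b m" for m by (simp add: b_def)
  have cf: "chaos_norm m f < \<infinity>" for m
  proof (rule ccontr)
    assume "\<not> chaos_norm m f < \<infinity>"
    then have "chaos_norm m f = \<top>" by (simp add: not_less top_unique)
    then have "ennreal (1 / fact m) * chaos_norm m f = \<infinity>" by (simp add: ennreal_mult_eq_top_iff)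
    moreover have "ennreal (1 / fact m) * chaos_norm m f \<le> fock_norm f"
      unfolding fock_norm_def
      using sum_le_suminf[of "\<lambda>m. ennreal (1 / fact m) * chaos_norm m f" "{m}"] by auto
    ultimately show False
      using f2 by (simp add: fock_representation[OF f f2, symmetric] top_unique)
  qed
  \<comment> \<open>Since \<open>1 / (m! n!) = (m + n choose n) / (m + n)!\<close>, the expansion
    indexed by total order has the coefficient \<open>m choose n\<close>; this vanishes for
    \<open>m < n\<close>, so the shifted series may start at \<open>0\<close>.\<close>
  have diff_sums: "(\<lambda>m. b m * real (m choose n)) sums (enn2real (diff_norm n f) / fact n)" if n: "n \<le> K" for n
  proof -
    have "(\<lambda>m. enn2real (chaos_norm (m + n) f) / fact m) sums enn2real (diff_norm n f)"
    proof (rule ennreal_suminf_real_sums)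
      have "ennreal (enn2real (chaos_norm (m + n) f) / fact m) = ennreal (1 / fact m) * chaos_norm (m + n) f" for m
        using cf[of "m + n"] by (cases "chaos_norm (m + n) f") (auto simp: ennreal_mult[symmetric])
      then show "(\<Sum>m. ennreal (enn2real (chaos_norm (m + n) f) / fact m)) = diff_norm n f"
        using diff_norm_expansion[OF f fin[OF n]] by simp
    qed (use fin[OF n] in auto)
    then have "(\<lambda>m. enn2real (chaos_norm (m + n) f) / fact m / fact n) sums (enn2real (diff_norm n f) / fact n)"
      by (rule sums_divide)
    moreover have "enn2real (chaos_norm (m + n) f) / fact m / fact n = b (m + n) * real (m + n choose n)" for m
      by (simp add: b_def binomial_fact field_simps)
    ultimately have "(\<lambda>m. b (m + n) * real (m + n choose n)) sums (enn2real (diff_norm n f) / fact n)"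
      by simp
    then show ?thesis
      by (subst (asm) sums_zero_iff_shift) (auto simp: binomial_eq_0)
  qed
  have S_sums: "(\<lambda>m. \<Sum>n=1..K. (- 1) ^ (n + 1) * (b m * real (m choose n))) sums S"
  proof -
    have "(\<lambda>m. \<Sum>n=1..K. (- 1) ^ (n + 1) * (b m * real (m choose n))) sums
        (\<Sum>n=1..K. (- 1) ^ (n + 1) * (enn2real (diff_norm n f) / fact n))"
      by (intro sums_sum sums_mult diff_sums) auto
    then show ?thesis by (simp add: S_def)
  qed
  have "b sums enn2real (L2_norm f)"
    using diff_sums[of 0] by (simp add: diff_norm_0)
  \<comment> \<open>Passing to the variance removes exactly the term of order
    \<open>0\<close>.\<close>
  moreover have "b 0 = (\<integral>\<mu>. f \<mu> \<partial>P)\<^sup>2" by (simp add: b_def chaos_norm_0)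
  ultimately have "(\<lambda>m. b (Suc m)) sums (enn2real (L2_norm f) - (\<integral>\<mu>. f \<mu> \<partial>P)\<^sup>2)"
    by (subst sums_Suc_iff) simp
  also have "enn2real (L2_norm f) - (\<integral>\<mu>. f \<mu> \<partial>P)\<^sup>2 = V"
    unfolding V_def D(4) D(3) by simp
  finally have V_sums: "(\<lambda>m. b (Suc m)) sums V" .
  \<comment> \<open>Dropping the term \<open>m = 0\<close> leaves the sum unchanged, as
    \<open>0 choose n = 0\<close> for \<open>n \<ge> 1\<close>.\<close>
  have "(\<lambda>m. \<Sum>n=1..K. (- 1) ^ (n + 1) * (b (Suc m) * real (Suc m choose n))) sums S"
    by (subst sums_Suc_iff) (use S_sums in \<open>simp add: binomial_eq_0\<close>)
  then have "(\<lambda>m. (- 1) ^ K * (b (Suc m) - (\<Sum>n=1..K. (- 1) ^ (n + 1) * (b (Suc m) * real (Suc m choose n)))))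
      sums ((- 1) ^ K * (V - S))"
    by (intro sums_mult sums_diff V_sums)
  moreover have "(- 1) ^ K * (b (Suc m) - (\<Sum>n=1..K. (- 1) ^ (n + 1) * (b (Suc m) * real (Suc m choose n)))) =
      b (Suc m) * real (m choose K)" for m
  proof -
    have "{..K} = insert 0 {1..K}" by auto
    then have "(\<Sum>n\<le>K. (- 1) ^ n * real (Suc m choose n)) = 1 + (\<Sum>n=1..K. (- 1) ^ n * real (Suc m choose n))"
      by simp
    then have *: "1 + (\<Sum>n=1..K. (- 1) ^ n * real (Suc m choose n)) = (- 1) ^ K * real (m choose K)"
      by (simp only: alternating_binomial_sum)
    have "b (Suc m) - (\<Sum>n=1..K. (- 1) ^ (n + 1) * (b (Suc m) * real (Suc m choose n))) =
        b (Suc m) * (1 + (\<Sum>n=1..K. (- 1) ^ n * real (Suc m choose n)))"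
      by (simp add: distrib_left sum_distrib_left sum_negf mult_ac)
    also have "\<dots> = (- 1) ^ K * (b (Suc m) * real (m choose K))"
      unfolding * by (simp only: mult_ac)
    finally have "(- 1) ^ K * (b (Suc m) - (\<Sum>n=1..K. (- 1) ^ (n + 1) * (b (Suc m) * real (Suc m choose n)))) =
        (- 1) ^ K * ((- 1) ^ K * (b (Suc m) * real (m choose K)))"
      by (rule arg_cong)
    also have "\<dots> = b (Suc m) * real (m choose K)"
      by (cases "even K") auto
    finally show ?thesis .
  qed
  ultimately have R: "(\<lambda>m. b (Suc m) * real (m choose K)) sums ((- 1) ^ K * (V - S))" by simp
  have r0: "0 \<le> b (Suc m) * real (m choose K)" for m using b0 by simp
  show "0 \<le> (- 1) ^ K * (V - S)"
    using suminf_nonneg[OF sums_summable[OF R] r0] sums_unique[OF R] by simp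
  have "V = S \<longleftrightarrow> (- 1) ^ K * (V - S) = 0" by simp
  also have "\<dots> \<longleftrightarrow> (\<forall>m. b (Suc m) * real (m choose K) = 0)"
    using suminf_eq_zero_iff[OF sums_summable[OF R] r0] sums_unique[OF R] by simp
  also have "\<dots> \<longleftrightarrow> (\<forall>m>K. chaos_norm m f = 0)"
  proof
    assume *: "\<forall>m. b (Suc m) * real (m choose K) = 0"
    show "\<forall>m>K. chaos_norm m f = 0"
    proof (intro allI impI)
      fix m assume "K < m"
      then obtain l where "m = Suc l" "K \<le> l" by (cases m) auto
      then have "b m = 0" using *[rule_format, of l] by (simp add: binomial_eq_0_iff)
      then show "chaos_norm m f = 0" using cf[of m] by (auto simp: b_def enn2real_eq_0_iff)
    qed
  next
    assume "\<forall>m>K. chaos_norm m f = 0"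
    then have "b (Suc m) = 0 \<or> m < K" for m by (cases "m < K") (auto simp: b_def)
    then show "\<forall>m. b (Suc m) * real (m choose K) = 0" by (auto simp: binomial_eq_0)
  qed
  also have "\<dots> \<longleftrightarrow> diff_norm (Suc K) f = 0"
    by (rule chaos_norm_vanishes_iff[OF f fin]) simp
  finally show "V = S \<longleftrightarrow> diff_norm (Suc K) f = 0" .
qed

end

section \<open>Transfer from the law \<open>P\<close> to the process on \<open>M\<close>\<close>

theorem theorem1p2:
  fixes M :: "'w measure" and lam :: "'y measure"
    and \<eta> :: "'w \<Rightarrow> 'y measure" and f :: "'y measure \<Rightarrow> real" and k :: nat
  assumes "prob_space M"
    and "sigma_finite_measure lam"
    and "poisson_process M lam \<eta>"
    and "f \<in> borel_measurable (counting_measure_space lam)"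
    and "integrable M (\<lambda>\<omega>. (f (\<eta> \<omega>))\<^sup>2)"
    and "k \<ge> 1"
    and "\<And>n. n \<in> {1..2 * k} \<Longrightarrow> expected_diff_norm_sq M lam \<eta> f n < \<infinity>"
  defines "S m \<equiv> \<Sum>n=1..m. (- 1) ^ (n + 1) / fact n * enn2real (expected_diff_norm_sq M lam \<eta> f n)"
    and "V \<equiv> prob_space.variance M (\<lambda>\<omega>. f (\<eta> \<omega>))"
  shows "S (2 * k) \<le> V \<and> V \<le> S (2 * k - 1) \<and>
    (S (2 * k) = V \<longleftrightarrow>
      (AE y in product_measure (2 * k + 1) lam. AE \<omega> in M. iter_diff (2 * k + 1) y f (\<eta> \<omega>) = 0)) \<and>
    (V = S (2 * k - 1) \<longleftrightarrow>
      (AE y in product_measure (2 * k) lam. AE \<omega> in M. iter_diff (2 * k) y f (\<eta> \<omega>) = 0))"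
proof -
  interpret M: prob_space M by fact
  interpret lam: sigma_finite_measure lam by fact
  have eta [measurable]: "\<eta> \<in> measurable M (counting_measure_space lam)"
    using assms(3) by (simp add: poisson_process_def)
  note f [measurable] = assms(4)
  define P where "P = distr M (counting_measure_space lam) \<eta>"
  interpret P: prob_space P
    unfolding P_def by (rule M.prob_space_distr) measurable
  interpret poisson_space lam P
  proof
    show "sets P = sets (counting_measure_space lam)" by (simp add: P_def)
    fix w assume w: "step_fun lam w"
    have "(\<integral>\<mu>. lapl w \<mu> \<partial>P) = (\<integral>\<omega>. lapl w (\<eta> \<omega>) \<partial>M)"
      unfolding P_def using w by (intro integral_distr) auto
    then show "(\<integral>\<mu>. lapl w \<mu> \<partial>P) = exp (- (\<integral>y. 1 - exp (- w y) \<partial>lam))"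
      using poisson_process_lapl[OF assms(1,3) w] by simp
  qed
  \<comment> \<open>Tonelli reverses the order of integration, and the image measure formula passes
    from \<open>P\<close> to \<open>M\<close>.\<close>
  have E: "expected_diff_norm_sq M lam \<eta> f n = diff_norm n f" for n
  proof -
    have "(\<lambda>(\<mu>, y). ennreal ((iter_diff n y f \<mu>)\<^sup>2)) \<in>
        borel_measurable (counting_measure_space lam \<Otimes>\<^sub>M product_measure n lam)"
      using measurable_compose[OF measurable_pair_swap' iter_diff_measurable[OF f, of n]]
      by (simp add: split_beta')
    then have [measurable]: "(\<lambda>\<mu>. \<integral>\<^sup>+y. ennreal ((iter_diff n y f \<mu>)\<^sup>2) \<partial>product_measure n lam) \<in>
        borel_measurable (counting_measure_space lam)"
      by (rule Pi.borel_measurable_nn_integral)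
    have "diff_norm n f = (\<integral>\<^sup>+\<mu>. (\<integral>\<^sup>+y. ennreal ((iter_diff n y f \<mu>)\<^sup>2) \<partial>product_measure n lam) \<partial>P)"
      unfolding diff_norm_def by (rule PiP.Fubini'[symmetric]) measurable
    also have "\<dots> = expected_diff_norm_sq M lam \<eta> f n"
      unfolding expected_diff_norm_sq_def L2_norm_sq_def P_def by (rule nn_integral_distr) measurable
    finally show ?thesis ..
  qed
  have V: "V = (\<integral>\<mu>. (f \<mu> - (\<integral>\<mu>. f \<mu> \<partial>P))\<^sup>2 \<partial>P)"
    unfolding V_def P_def by (simp add: integral_distr)
  have "diff_norm 0 f = (\<integral>\<^sup>+\<omega>. ennreal ((f (\<eta> \<omega>))\<^sup>2) \<partial>M)"
    unfolding diff_norm_0 L2_norm_def unfolding P_def by (rule nn_integral_distr) measurable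
  also have "\<dots> < \<infinity>" using assms(5) by (simp add: integrable_iff_bounded)
  \<comment> \<open>Order \<open>0\<close> is the square integrability of
    \<open>f (\<eta> \<omega>)\<close>; the other orders are assumed.\<close>
  finally have fin: "diff_norm n f < \<infinity>" if "n \<le> 2 * k" for n
    using assms(7)[of n] that by (cases "n = 0") (auto simp: E)
  have AE: "diff_norm n f = 0 \<longleftrightarrow>
      (AE y in product_measure n lam. AE \<omega> in M. iter_diff n y f (\<eta> \<omega>) = 0)" for n
    unfolding diff_norm_eq_0_iff[OF f]
  proof (rule AE_cong)
    fix y assume "y \<in> space (product_measure n lam)"
    note [measurable] = iter_diff_measurable_snd[OF f this]
    show "(AE \<mu> in P. iter_diff n y f \<mu> = 0) \<longleftrightarrow> (AE \<omega> in M. iter_diff n y f (\<eta> \<omega>) = 0)"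
      unfolding P_def by (rule AE_distr_iff) measurable
  qed
  \<comment> \<open>Even \<open>K = 2 * k\<close> gives the lower bound and odd
    \<open>K = 2 * k - 1\<close> the upper one, with equality governed by the differences of order
    \<open>K + 1\<close>.\<close>
  have rem: "0 \<le> (- 1) ^ K * (V - S K)" "V = S K \<longleftrightarrow> diff_norm (Suc K) f = 0" if "K \<le> 2 * k" for K
    using variance_remainder[OF f, of K] fin that unfolding S_def V E by auto
  have odd: "(- 1 :: real) ^ (2 * k - 1) = - 1"
    using \<open>k \<ge> 1\<close> by (intro uminus_power_if[THEN trans]) auto
  have "Suc (2 * k - 1) = 2 * k" using \<open>k \<ge> 1\<close> by simp
  then show ?thesis
    using rem[of "2 * k"] rem[of "2 * k - 1"] AE[of "2 * k"] AE[of "2 * k + 1"] odd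
    by (auto simp: eq_commute[of "S (2 * k)" V])
qed

end
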